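(* Let $\mathcal{F}$ be a foliation of degree $d\geq2$ on $\mathbb{P}^2_{\mathbb{C}}$. The following assertions are equivalent: (1) $\mathcal{F}$ is linearly conjugated to the Fermat foliation $\mathcal{F}_0^d$; (2) $\mathcal{F}$ is reduced convex and $\mathcal{CS}(\mathcal{F})=\{1-d,\frac{1}{1-d}\}$; (3) $\mathcal{F}$ possesses three (distinct) radial singularities of maximal order $d-1$. Moreover, three such radial singularities as in (3) are necessarily non-aligned.
   Context: Foliations on $\mathbb{P}^2_{\mathbb{C}}$ are holomorphic, with isolated singularities. The degree of a foliation is the number of tangencies (with multiplicity) with a generic line. Linearly conjugated means conjugated by an element of $\mathrm{Aut}(\mathbb{P}^2_{\mathbb{C}})$. The Fermat foliation $\mathcal{F}_0^d$ is the foliation of degree $d$ on $\mathbb{P}^2_{\mathbb{C}}$ defined in an affine chart by $(x^d-x)\,\mathrm{d}y-(y^d-y)\,\mathrm{d}x$. Convexity: a foliation on $\mathbb{P}^2_{\mathbb{C}}$ is convex if its leaves other than straight lines have no inflection points. A foliation of degree $d\ge1$ has at most $3d$ distinct invariant lines, and if this bound is reached it is convex; a foliation of degree $d$ having exactly $3d$ distinct invariant lines is called reduced convex. Singularities: let $s$ be a singular point and $X$ a local vector field (with isolated zero) defining the foliation near $s$. The algebraic multiplicity $\nu(\mathcal{F},s)$ is the vanishing order of $X$ at $s$; the tangency order $\tau(\mathcal{F},s)$ of $\mathcal{F}$ with a generic line through $s$ is $\min\{k\ge\nu(\mathcal{F},s): \det(J^k_sX,R_s)\neq0\}$, where $J^k_sX$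 is the $k$-jet of $X$ at $s$ in affine coordinates and $R_s$ is the radial vector field centered at $s$. The point $s$ is a radial singularity of order $k\ge1$ if $\nu(\mathcal{F},s)=1$ and $\tau(\mathcal{F},s)=k+1$; in degree $d$ one always has $k\le d-1$. The point $s$ is non-degenerate if the linear part of $X$ at $s$ is invertible. If $\ell$ is an invariant line through $s$, choose local coordinates $(u,v)$ centered at $s$ with $\ell=\{v=0\}$ and write $X=P(u,v)\partial_u+vQ(u,v)\partial_v$; the Camacho–Sad index is $\mathrm{CS}(\mathcal{F},\ell,s)=\mathrm{Res}_{u=0}\frac{Q(u,0)}{P(u,0)}\,\mathrm{d}u$. $\mathcal{CS}(\mathcal{F})$ is the set of $\lambda\in\mathbb{C}\setminus\{0,1\}$ for which there is a line $\ell$ invariant by $\mathcal{F}$ and a non-degenerate singular point $s\in\ell$ of $\mathcal{F}$ such that $\mathrm{CS}(\mathcal{F},\ell,s)=\lambda$. *)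

theory Defs
  imports "HOL-Complex_Analysis.Complex_Analysis"
begin

text \<open>
  The complex projective plane is the set of lines through the origin of \<open>complex ^ 3\<close>.  A point of
  the plane is a one-dimensional, and a line of the plane a two-dimensional, complex linear
  subspace; incidence is inclusion.
\<close>

definition proj_point :: "(complex ^ 3) set \<Rightarrow> bool" where
  "proj_point s \<longleftrightarrow> vec.subspace s \<and> vec.dim s = 1"

definition proj_line :: "(complex ^ 3) set \<Rightarrow> bool" where
  "proj_line l \<longleftrightarrow> vec.subspace l \<and> vec.dim l = 2"

definition hom_poly :: "nat \<Rightarrow> (complex ^ 3 \<Rightarrow> complex) \<Rightarrow> bool" where
  "hom_poly m f \<longleftrightarrow> (\<exists>c :: nat \<Rightarrow> nat \<Rightarrow> complex. \<forall>v.
     f v = (\<Sum>i\<le>m. \<Sum>j\<le>m - i. c i j * v $ 1 ^ i * v $ 2 ^ j * v $ 3 ^ (m - i - j)))"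

text \<open>
  A holomorphic foliation of the plane is given by a homogeneous 1-form \<open>a dx + b dy + c dz\<close> on
  \<open>complex ^ 3\<close>, here the map \<open>\<omega>\<close> with \<open>\<omega> v = (a v, b v, c v)\<close>, so that
  \<open>scalar_product (\<omega> v) w\<close> is the value of the form at \<open>v\<close> on the tangent vector \<open>w\<close>.  The form is
  annihilated by the Euler field, and the singularities are isolated, that is (the plane being
  compact) finite in number.  Two such forms define the same foliation iff they are proportional.
\<close>

definition singular_point :: "(complex ^ 3 \<Rightarrow> complex ^ 3) \<Rightarrow> (complex ^ 3) set \<Rightarrow> bool" where
  "singular_point \<omega> s \<longleftrightarrow> proj_point s \<and> (\<forall>v\<in>s. \<omega> v = 0)"

definition foliation :: "(complex ^ 3 \<Rightarrow> complex ^ 3) \<Rightarrow> bool" where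
  "foliation \<omega> \<longleftrightarrow>
     (\<exists>m. \<forall>i. hom_poly m (\<lambda>v. \<omega> v $ i)) \<and>
     (\<forall>v. scalar_product (\<omega> v) v = 0) \<and>
     finite {s. singular_point \<omega> s}"

definition same_foliation ::
  "(complex ^ 3 \<Rightarrow> complex ^ 3) \<Rightarrow> (complex ^ 3 \<Rightarrow> complex ^ 3) \<Rightarrow> bool" where
  "same_foliation \<omega> \<eta> \<longleftrightarrow> (\<exists>c. c \<noteq> 0 \<and> (\<forall>v. \<omega> v = c *s \<eta> v))"

definition pullback_form ::
  "complex ^ 3 ^ 3 \<Rightarrow> (complex ^ 3 \<Rightarrow> complex ^ 3) \<Rightarrow> complex ^ 3 \<Rightarrow> complex ^ 3" where
  "pullback_form A \<omega> v = transpose A *v \<omega> (A *v v)"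

lemma scalar_product_pullback_form:
  "scalar_product (pullback_form A \<omega> v) w = scalar_product (\<omega> (A *v v)) (A *v w)"
  unfolding pullback_form_def scalar_product_def matrix_vector_mult_def transpose_def
  by (simp add: sum_3) algebra

definition linearly_conjugated ::
  "(complex ^ 3 \<Rightarrow> complex ^ 3) \<Rightarrow> (complex ^ 3 \<Rightarrow> complex ^ 3) \<Rightarrow> bool" where
  "linearly_conjugated \<omega> \<eta> \<longleftrightarrow>
     (\<exists>A :: complex ^ 3 ^ 3. invertible A \<and> same_foliation (pullback_form A \<omega>) \<eta>)"

definition invariant_line :: "(complex ^ 3 \<Rightarrow> complex ^ 3) \<Rightarrow> (complex ^ 3) set \<Rightarrow> bool" where
  "invariant_line \<omega> l \<longleftrightarrow> proj_line l \<and> (\<forall>v\<in>l. \<forall>w\<in>l. scalar_product (\<omega> v) w = 0)"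

text \<open>
  For a point \<open>[p]\<close> of a non-invariant line \<open>l\<close> and a second point \<open>[q]\<close> of \<open>l\<close>, the line is
  parametrised near \<open>[p]\<close> by \<open>t \<mapsto> [p + t q]\<close>.  The tangency order at \<open>[p]\<close> is the vanishing order at
  \<open>t = 0\<close> of the restriction of the form to \<open>l\<close>; it does not depend on \<open>p\<close> and \<open>q\<close>.
\<close>

definition tangency_points ::
  "(complex ^ 3 \<Rightarrow> complex ^ 3) \<Rightarrow> (complex ^ 3) set \<Rightarrow> (complex ^ 3) set set" where
  "tangency_points \<omega> l =
     {s. proj_point s \<and> s \<subseteq> l \<and> (\<forall>p\<in>s. \<forall>q\<in>l. scalar_product (\<omega> p) q = 0)}"

definition tangency_order_with_line ::
  "(complex ^ 3 \<Rightarrow> complex ^ 3) \<Rightarrow> (complex ^ 3) set \<Rightarrow> (complex ^ 3) set \<Rightarrow> int" where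
  "tangency_order_with_line \<omega> l s =
     (THE k. \<forall>p\<in>s - {0}. \<forall>q\<in>l - s.
        zorder (\<lambda>t. scalar_product (\<omega> (p + t *s q)) q) 0 = k)"

text \<open>Generic means outside a proper algebraic subset \<open>{G = 0}\<close> of the dual plane.\<close>

definition foliation_degree :: "(complex ^ 3 \<Rightarrow> complex ^ 3) \<Rightarrow> nat \<Rightarrow> bool" where
  "foliation_degree \<omega> d \<longleftrightarrow>
     (\<exists>n G. hom_poly n G \<and> (\<exists>a. G a \<noteq> 0) \<and>
        (\<forall>a l. a \<noteq> 0 \<and> G a \<noteq> 0 \<and> l = {v. scalar_product a v = 0} \<longrightarrow>
           \<not> invariant_line \<omega> l \<and>
           (\<Sum>s\<in>tangency_points \<omega> l. tangency_order_with_line \<omega> l s) = int d))"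

definition reduced_convex :: "(complex ^ 3 \<Rightarrow> complex ^ 3) \<Rightarrow> nat \<Rightarrow> bool" where
  "reduced_convex \<omega> d \<longleftrightarrow>
     finite {l. invariant_line \<omega> l} \<and> card {l. invariant_line \<omega> l} = 3 * d"

text \<open>
  An affine chart centred at \<open>s = [p]\<close> is \<open>(u, v) \<mapsto> [p + u e + v f]\<close> for a basis \<open>p, e, f\<close> of
  \<open>complex ^ 3\<close>.  In it the form reads \<open>A du + B dv\<close>, and the foliation is defined by the vector
  field \<open>B \<partial>\<^sub>u - A \<partial>\<^sub>v\<close>, whose zeros are isolated.
\<close>

definition affine_frame ::
  "(complex ^ 3) set \<Rightarrow> complex ^ 3 \<Rightarrow> complex ^ 3 \<Rightarrow> complex ^ 3 \<Rightarrow> bool" where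
  "affine_frame s p e f \<longleftrightarrow> s = vec.span {p} \<and> vec.span {p, e, f} = UNIV"

definition chart_field ::
  "(complex ^ 3 \<Rightarrow> complex ^ 3) \<Rightarrow> complex ^ 3 \<Rightarrow> complex ^ 3 \<Rightarrow> complex ^ 3
     \<Rightarrow> complex ^ 2 \<Rightarrow> complex ^ 2" where
  "chart_field \<omega> p e f w =
     (let \<alpha> = \<omega> (p + w $ 1 *s e + w $ 2 *s f)
      in vector [scalar_product \<alpha> f, - scalar_product \<alpha> e])"

definition defining_field ::
  "(complex ^ 3 \<Rightarrow> complex ^ 3) \<Rightarrow> (complex ^ 3) set \<Rightarrow> (complex ^ 2 \<Rightarrow> complex ^ 2) \<Rightarrow> bool" where
  "defining_field \<omega> s X \<longleftrightarrow> (\<exists>p e f. affine_frame s p e f \<and> X = chart_field \<omega> p e f)"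

text \<open>
  The \<open>k\<close>-jet at the origin: the homogeneous component of degree \<open>i\<close> of \<open>X\<close> at \<open>w\<close> is the \<open>i\<close>-th
  Taylor coefficient of \<open>t \<mapsto> X (t w)\<close> at \<open>0\<close>.
\<close>

definition jet :: "nat \<Rightarrow> (complex ^ 2 \<Rightarrow> complex ^ 2) \<Rightarrow> complex ^ 2 \<Rightarrow> complex ^ 2" where
  "jet k X w = (\<chi> j. \<Sum>i\<le>k. (deriv ^^ i) (\<lambda>t. X (t *s w) $ j) 0 / fact i)"

definition field_multiplicity :: "(complex ^ 2 \<Rightarrow> complex ^ 2) \<Rightarrow> nat" where
  "field_multiplicity X = (LEAST k. \<exists>w. jet k X w \<noteq> 0)"

text \<open>The radial field centred at the origin is \<open>w \<mapsto> w\<close>.\<close>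

definition field_tangency_order :: "(complex ^ 2 \<Rightarrow> complex ^ 2) \<Rightarrow> nat" where
  "field_tangency_order X =
     (LEAST k. field_multiplicity X \<le> k \<and> (\<exists>w. det (vector [jet k X w, w]) \<noteq> 0))"

text \<open>The notions below do not depend on the choice of the affine chart.\<close>

definition radial_singularity ::
  "(complex ^ 3 \<Rightarrow> complex ^ 3) \<Rightarrow> (complex ^ 3) set \<Rightarrow> nat \<Rightarrow> bool" where
  "radial_singularity \<omega> s k \<longleftrightarrow> 1 \<le> k \<and> singular_point \<omega> s \<and>
     (\<exists>X. defining_field \<omega> s X \<and> field_multiplicity X = 1 \<and> field_tangency_order X = k + 1)"

definition nondegenerate_singularity ::
  "(complex ^ 3 \<Rightarrow> complex ^ 3) \<Rightarrow> (complex ^ 3) set \<Rightarrow> bool" where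
  "nondegenerate_singularity \<omega> s \<longleftrightarrow> singular_point \<omega> s \<and>
     (\<exists>X. \<exists>A :: complex ^ 2 ^ 2.
        defining_field \<omega> s X \<and> (X has_derivative (*v) A) (at 0) \<and> invertible A)"

text \<open>
  The Camacho-Sad index at \<open>s\<close> along an invariant line \<open>l\<close>, in an affine chart where \<open>l\<close> is
  \<open>{v = 0}\<close>.  Holomorphy of \<open>Q\<close> determines \<open>Q u 0\<close>.
\<close>

definition camacho_sad_index ::
  "(complex ^ 3 \<Rightarrow> complex ^ 3) \<Rightarrow> (complex ^ 3) set \<Rightarrow> (complex ^ 3) set \<Rightarrow> complex \<Rightarrow> bool" where
  "camacho_sad_index \<omega> l s z \<longleftrightarrow>
     (\<exists>p e f P Q. affine_frame s p e f \<and> l = vec.span {p, e} \<and>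
        (\<forall>u v. chart_field \<omega> p e f (vector [u, v]) = vector [P u v, v * Q u v]) \<and>
        (\<forall>u. (\<lambda>v. Q u v) holomorphic_on UNIV) \<and> (\<forall>v. (\<lambda>u. Q u v) holomorphic_on UNIV) \<and>
        z = residue (\<lambda>u. Q u 0 / P u 0) 0)"

definition CS :: "(complex ^ 3 \<Rightarrow> complex ^ 3) \<Rightarrow> complex set" where
  "CS \<omega> = {z. z \<notin> {0, 1} \<and>
     (\<exists>l s. invariant_line \<omega> l \<and> s \<subseteq> l \<and> nondegenerate_singularity \<omega> s \<and>
        camacho_sad_index \<omega> l s z)}"

text \<open>
  The homogeneous form of degree \<open>d + 1\<close> whose restriction to the chart \<open>z = 1\<close> is
  \<open>(x ^ d - x) dy - (y ^ d - y) dx\<close>.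
\<close>

definition fermat_form :: "nat \<Rightarrow> complex ^ 3 \<Rightarrow> complex ^ 3" where
  "fermat_form d v =
     (let x = v $ 1; y = v $ 2; z = v $ 3
      in vector [- z * (y ^ d - y * z ^ (d - 1)), z * (x ^ d - x * z ^ (d - 1)),
                 x * y ^ d - y * x ^ d])"

lemma fermat_form_affine:
  "scalar_product (fermat_form d (vector [x, y, 1])) (vector [dx, dy, 0]) =
     (x ^ d - x) * dy - (y ^ d - y) * dx"
  by (simp add: fermat_form_def scalar_product_def sum_3) algebra

lemma fermat_form_euler: "scalar_product (fermat_form d v) v = 0"
  by (simp add: fermat_form_def scalar_product_def sum_3 Let_def) algebra

end

theory Submission
  imports Defs "HOL-Computational_Algebra.Fundamental_Theorem_Algebra"
begin

text \<open>
  Let \<open>\<omega>\<close> have degree \<open>d\<close>, so that its coefficients are homogeneous of degree \<open>d + 1\<close>.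

  \<^item> (3) \<open>\<Longrightarrow>\<close> (1): \<open>[p]\<close> is radial of order \<open>d - 1\<close> iff \<open>\<omega> v \<star> p\<close> does not change when \<open>v\<close> moves along
  \<open>p\<close> (and the linear part is non-zero).  If \<open>[p\<^sub>1], [p\<^sub>2], [p\<^sub>3]\<close> are aligned, then the
  polynomial \<open>x \<mapsto> \<omega> (x p\<^sub>1 + f) \<star> p\<^sub>2\<close> is affine, which kills the linear part at \<open>p\<^sub>1\<close>.  If they
  are not, the Euler relation \<open>x C\<^sub>1(y, z) + y C\<^sub>2(x, z) + z C\<^sub>3(x, y) = 0\<close> leaves only the monomials of
  the Fermat form, and a diagonal scaling normalises the coefficients.

  \<^item> (2) \<open>\<Longrightarrow>\<close> (3): On an invariant line with parameter \<open>u\<close> the singularities are the roots of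
  \<open>P = u q + h\<close>, where \<open>q\<close> and \<open>h\<close> are normal derivatives of the form along the line, of degree at most
  \<open>d\<close>.  If \<open>r\<close> further invariant lines pass through the point \<open>u = c\<close>, then \<open>(u - c)\<^sup>r\<close> divides
  \<open>h + c q\<close>, hence (for \<open>r > 0\<close>) also the product of \<open>P\<close> and the Wronskian of \<open>h\<close> and \<open>q\<close>, whose
  degree is at most \<open>3 d - 1\<close>.  If \<open>3 d\<close> lines are invariant, all these inequalities are
  equalities: each invariant line has \<open>d + 1\<close> singularities, all non-degenerate, those of index
  \<open>\<noteq> 1\<close> lie on exactly one further invariant line, and the indices \<open>q / P'\<close> add up to \<open>1\<close> by Lagrange
  interpolation.  With indices in \<open>{1, 1 - d, 1 / (1 - d)}\<close>, a line has either a single singularity of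
  index \<open>1 - d\<close> besides those of index \<open>1\<close>, or exactly two singularities of index \<open>1\<close>; counting lines
  shows that the latter two are radial of order \<open>d - 1\<close>.  There are at least two lines of the second
  kind, because the two indices at a non-degenerate singularity are inverse to each other.

  \<^item> (1) \<open>\<Longrightarrow>\<close> (2): The lines \<open>x = c y\<close>, \<open>y = c z\<close>, \<open>z = c x\<close> with \<open>c\<^sup>d = c\<close> are \<open>3 d\<close> invariant lines, and a
  singularity of index other than \<open>1\<close> lies on at most two of them, hence is some
  \<open>[c : 1 : 0]\<close> with \<open>c\<^sup>d\<^sup>-\<^sup>1 = 1\<close>, up to cyclic permutation.
\<close>

section \<open>Points, lines and frames\<close>

no_notation fps_nth (infixl "$" 75)

notation scalar_product (infixl "\<star>" 70)

lemma star_expand: "a \<star> b = a $ 1 * b $ 1 + a $ 2 * b $ 2 + a $ 3 * b $ 3"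
  for a b :: "complex ^ 3"
  by (simp add: scalar_product_def sum_3)

lemma star_add_left: "(a + b) \<star> c = a \<star> c + b \<star> c"
  and star_add_right: "c \<star> (a + b) = c \<star> a + c \<star> b"
  and star_scale_left: "(k *s a) \<star> c = k * (a \<star> c)"
  and star_scale_right: "c \<star> (k *s a) = k * (c \<star> a)"
  and star_zero_left: "0 \<star> c = 0"
  and star_zero_right: "c \<star> 0 = 0"
  and star_minus_left: "(- a) \<star> c = - (a \<star> c)"
  and star_minus_right: "c \<star> (- a) = - (c \<star> a)"
  and star_diff_left: "(a - b) \<star> c = a \<star> c - b \<star> c"
  and star_diff_right: "c \<star> (a - b) = c \<star> a - c \<star> b"
  for a b c :: "complex ^ 3"
  by (simp_all add: star_expand algebra_simps)

lemmas star_simps = star_add_left star_add_right star_scale_left star_scale_right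
  star_zero_left star_zero_right star_minus_left star_minus_right star_diff_left star_diff_right

lemma bounded_linear_star: "bounded_linear (\<lambda>v. v \<star> a)" for a :: "complex ^ 3"
  unfolding linear_conv_bounded_linear[symmetric]
  by (rule linearI) (simp_all add: star_expand algebra_simps)

lemma has_derivative_vec:
  fixes f :: "'a::real_normed_vector \<Rightarrow> complex ^ 'n"
  assumes "\<And>i. ((\<lambda>x. f x $ i) has_derivative (\<lambda>w. g w $ i)) (at p)"
  shows "(f has_derivative g) (at p)"
  unfolding has_derivative_componentwise_within[of f] Basis_vec_def
proof safe
  fix i :: 'n and b :: complex assume "b \<in> Basis"
  from bounded_linear.has_derivative[OF bounded_linear_inner_left assms]
  show "((\<lambda>x. f x \<bullet> axis i b) has_derivative (\<lambda>w. g w \<bullet> axis i b)) (at p)"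
    by (simp add: inner_axis)
qed

text \<open>The part of \<open>affine_frame\<close> that does not mention the point. In dimension
  three spanning is the same as being a basis; \<open>frame_indep\<close> and \<open>frameI\<close>
  switch between the two views.\<close>

definition frame :: "complex ^ 3 \<Rightarrow> complex ^ 3 \<Rightarrow> complex ^ 3 \<Rightarrow> bool" where
  "frame p e f \<longleftrightarrow> vec.span {p, e, f} = UNIV"

lemma vec_span_1: "v \<in> vec.span {p} \<longleftrightarrow> (\<exists>x. v = x *s p)" for v :: "complex ^ 3"
  by (auto simp: vec.span_breakdown_eq)

lemma vec_span_2: "v \<in> vec.span {p, e} \<longleftrightarrow> (\<exists>x u. v = x *s p + u *s e)" for v :: "complex ^ 3"
  by (simp add: vec.span_breakdown_eq diff_eq_eq add_ac)

lemma vec_span_3: "v \<in> vec.span {p, e, f} \<longleftrightarrow> (\<exists>x u w. v = x *s p + u *s e + w *s f)"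
  for v :: "complex ^ 3"
proof -
  have "v \<in> vec.span {p, e, f} \<longleftrightarrow> (\<exists>k. v - k *s p \<in> vec.span {e, f})"
    by (simp add: vec.span_breakdown_eq)
  also have "\<dots> \<longleftrightarrow> (\<exists>x u w. v - x *s p = u *s e + w *s f)"
    unfolding vec_span_2 by simp
  also have "\<dots> \<longleftrightarrow> (\<exists>x u w. v = x *s p + u *s e + w *s f)"
    by (simp add: diff_eq_eq add_ac)
  finally show ?thesis .
qed

text \<open>The dimension of the span is built up one vector at a time, each contributing 1 exactly
  when it is new; the total 3 forces all three contributions.\<close>

lemma frame_iff: "frame p e f \<longleftrightarrow> p \<noteq> 0 \<and> e \<notin> vec.span {p} \<and> f \<notin> vec.span {p, e}"
proof -
  have d: "vec.dim {p, e, f} =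
      (if f \<in> vec.span {p, e} then 0 else 1) + ((if e \<in> vec.span {p} then 0 else 1) +
        (if p = 0 then 0 else (1::nat)))"
  proof -
    have "{p, e, f} = insert f (insert e {p})" "{p, e} = insert e {p}" by auto
    then show ?thesis by (simp only: vec.dim_insert vec.dim_singleton) simp
  qed
  have "frame p e f \<longleftrightarrow> vec.dim {p, e, f} = 3"
    unfolding frame_def
    using vec.dim_eq_full[of "{p, e, f}"] vec_dim_card[where 'a=complex and 'n=3]
    by (simp add: vec.dimension_def)
  then show ?thesis using d by (auto split: if_splits)
qed


lemma frame_coords:
  assumes "frame p e f"
  obtains x u w where "v = x *s p + u *s e + w *s f"
  using assms vec_span_3[of v p e f] unfolding frame_def by auto

lemma frame_indep:
  assumes "frame p e f" "x *s p + u *s e + w *s f = 0"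
  shows "x = 0" "u = 0" "w = 0"
proof -
  have fr: "p \<noteq> 0" "e \<notin> vec.span {p}" "f \<notin> vec.span {p, e}"
    using assms(1) unfolding frame_iff by auto
  show w: "w = 0"
  proof (rule ccontr)
    assume "w \<noteq> 0"
    have "f = (- x / w) *s p + (- u / w) *s e"
      unfolding vec_eq_iff
    proof
      fix i
      have "x * p $ i + u * e $ i + w * f $ i = 0"
        using arg_cong[OF assms(2), of "\<lambda>v. v $ i"] by simp
      then have 1: "- x * p $ i - u * e $ i = w * f $ i" by algebra
      have "f $ i = (- x * p $ i - u * e $ i) / w" unfolding 1 using \<open>w \<noteq> 0\<close> by simp
      then show "f $ i = ((- x / w) *s p + (- u / w) *s e) $ i" by (simp add: diff_divide_distrib)
    qed
    then show False using fr(3) unfolding vec_span_2 by blast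
  qed
  show u: "u = 0"
  proof (rule ccontr)
    assume "u \<noteq> 0"
    have "e = (- x / u) *s p"
      using assms(2) w \<open>u \<noteq> 0\<close> by (simp add: vec_eq_iff field_simps add_eq_0_iff2)
    then show False using fr(2) unfolding vec_span_1 by blast
  qed
  show "x = 0" using assms(2) w u fr(1) by simp
qed

lemma frame_unique:
  assumes "frame p e f" "x *s p + u *s e + w *s f = x' *s p + u' *s e + w' *s f"
  shows "x = x'" "u = u'" "w = w'"
proof -
  have "(x - x') *s p + (u - u') *s e + (w - w') *s f = 0"
    using assms(2) by (simp add: vec_eq_iff algebra_simps)
  from frame_indep[OF assms(1) this] show "x = x'" "u = u'" "w = w'" by simp_all
qed

lemma frameI:
  assumes "\<And>x u w. x *s p + u *s e + w *s f = 0 \<Longrightarrow> x = 0 \<and> u = 0 \<and> w = 0"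
  shows "frame p e f"
  unfolding frame_iff
proof (intro conjI notI)
  assume "p = 0"
  then show False using assms[of 1 0 0] by simp
next
  assume "e \<in> vec.span {p}"
  then obtain x where "e = x *s p" unfolding vec_span_1 by blast
  then show False using assms[of "- x" 1 0] by simp
next
  assume "f \<in> vec.span {p, e}"
  then obtain x u where "f = x *s p + u *s e" unfolding vec_span_2 by blast
  then show False using assms[of "- x" "- u" 1] by (simp add: vec_eq_iff)
qed

lemma frame_rotate: "frame p e f \<Longrightarrow> frame e f p"
  unfolding frame_def by (simp add: insert_commute)

lemma frame_swap: "frame p e f \<Longrightarrow> frame p f e"
  unfolding frame_def by (simp add: insert_commute)

lemma vector_eqI_star:
  assumes "frame p e f" "a \<star> p = 0" "a \<star> e = 0" "a \<star> f = 0"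
  shows "a = 0"
proof -
  have "a \<star> v = 0" for v
  proof -
    obtain x u w where "v = x *s p + u *s e + w *s f" by (rule frame_coords[OF assms(1)])
    then show ?thesis using assms(2-) by (simp add: star_simps)
  qed
  from this[of "axis 1 1"] this[of "axis 2 1"] this[of "axis 3 1"] show ?thesis
    by (simp add: star_expand axis_def vec_eq_iff forall_3)
qed

section \<open>Points and lines as spans of vectors\<close>

lemma proj_point_iff: "proj_point s \<longleftrightarrow> (\<exists>p. p \<noteq> 0 \<and> s = vec.span {p})"
proof
  assume s: "proj_point s"
  obtain B where B: "B \<subseteq> s" "vec.independent B" "s \<subseteq> vec.span B" "card B = vec.dim s"
    using vec.basis_exists[of s] by blast
  then obtain p where p: "B = {p}" using s unfolding proj_point_def by (metis card_1_singletonE)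
  have "p \<noteq> 0" using B(2) p vec.dependent_zero by auto
  moreover have "s = vec.span {p}"
    using B p s unfolding proj_point_def by (metis subset_antisym vec.span_minimal)
  ultimately show "\<exists>p. p \<noteq> 0 \<and> s = vec.span {p}" by blast
next
  assume "\<exists>p. p \<noteq> 0 \<and> s = vec.span {p}"
  then show "proj_point s" unfolding proj_point_def by auto
qed

lemma proj_line_iff:
  "proj_line l \<longleftrightarrow> (\<exists>p e. p \<noteq> 0 \<and> e \<notin> vec.span {p} \<and> l = vec.span {p, e})"
proof
  assume s: "proj_line l"
  obtain B where B: "B \<subseteq> l" "vec.independent B" "l \<subseteq> vec.span B" "card B = vec.dim l"
    using vec.basis_exists[of l] by blast
  then have "card B = 2" using s unfolding proj_line_def by simp
  then obtain e p where p: "B = {e, p}" "e \<noteq> p" unfolding card_2_iff by blast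
  have "p \<noteq> 0" using B(2) p vec.dependent_zero by auto
  moreover have "e \<notin> vec.span {p}" using B(2) p vec.independent_insert[of e "{p}"] by simp
  moreover have "l = vec.span {p, e}"
  proof
    show "l \<subseteq> vec.span {p, e}" using B(3) p by (simp add: insert_commute)
    show "vec.span {p, e} \<subseteq> l" using B(1) p s unfolding proj_line_def by (simp add: vec.span_minimal)
  qed
  ultimately show "\<exists>p e. p \<noteq> 0 \<and> e \<notin> vec.span {p} \<and> l = vec.span {p, e}" by blast
next
  assume "\<exists>p e. p \<noteq> 0 \<and> e \<notin> vec.span {p} \<and> l = vec.span {p, e}"
  then obtain p e where *: "p \<noteq> 0" "e \<notin> vec.span {p}" "l = vec.span {p, e}" by blast
  then have "l = vec.span (insert e {p})" by (simp add: insert_commute)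
  then show "proj_line l" using * unfolding proj_line_def by (simp only: vec.dim_span vec.dim_insert) simp
qed

lemma frame_extend:
  assumes "p \<noteq> 0" "e \<notin> vec.span {p}"
  obtains f where "frame p e f"
proof -
  have "proj_line (vec.span {p, e})" using assms proj_line_iff by blast
  then have "vec.dim (vec.span {p, e}) \<noteq> vec.dim (UNIV :: (complex ^ 3) set)"
    unfolding proj_line_def vec_dim_card by simp
  then have "vec.span {p, e} \<noteq> UNIV" by metis
  then show ?thesis using that assms unfolding frame_iff by blast
qed

lemma frame_extend_point:
  assumes "p \<noteq> 0"
  obtains e f where "frame p e f"
proof -
  have "vec.span {p} \<noteq> (UNIV :: (complex ^ 3) set)"
  proof
    assume "vec.span {p} = (UNIV :: (complex ^ 3) set)"
    then have "vec.dim (UNIV :: (complex ^ 3) set) = vec.dim {p}" by (metis vec.dim_span)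
    then show False using assms vec_dim_card[where 'a=complex and 'n=3] by simp
  qed
  then show ?thesis using that assms frame_extend by (metis UNIV_I subsetI subset_antisym)
qed

lemma frame_span_line: "frame p e f \<Longrightarrow> proj_line (vec.span {p, e})"
  using proj_line_iff frame_iff by blast

lemma span_scale: "k \<noteq> 0 \<Longrightarrow> vec.span {k *s p} = vec.span {p}" for p :: "complex ^ 3"
  using vec.span_image_scale[of "{p}" "\<lambda>_. k"] by simp

lemma span_eq_scale:
  fixes p q :: "complex ^ 3"
  assumes "vec.span {p} = vec.span {q}" "p \<noteq> 0"
  obtains k where "k \<noteq> 0" "p = k *s q"
proof -
  have "p \<in> vec.span {q}" using assms(1) vec.span_base by blast
  then obtain k where "p = k *s q" by (auto simp: vec_span_1)
  then show ?thesis using that assms(2) by (metis vector_smult_lzero)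
qed

lemma span_point_subset_line: "proj_line l \<Longrightarrow> p \<in> l \<Longrightarrow> vec.span {p} \<subseteq> l"
  unfolding proj_line_def by (simp add: vec.span_minimal)

lemma proj_line_closed:
  assumes "proj_line l" "a \<in> l" "b \<in> l" shows "x *s a + y *s b \<in> l" "x *s a \<in> l"
  using assms unfolding proj_line_def by (auto intro: vec.subspace_add vec.subspace_scale)

lemma line_eq_span:
  assumes "proj_line l" "a \<in> l" "b \<in> l" "a \<noteq> 0" "b \<notin> vec.span {a}"
  shows "l = vec.span {a, b}"
proof -
  have "vec.span {a, b} \<subseteq> l"
    using assms(1-3) unfolding proj_line_def by (simp add: vec.span_minimal)
  moreover have "proj_line (vec.span {a, b})" using assms proj_line_iff by blast
  ultimately show ?thesis
    using assms(1) unfolding proj_line_def by (metis vec.subspace_dim_equal order_refl)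
qed

lemma line_frame:
  assumes "proj_line l" "p \<in> l" "p \<noteq> 0"
  obtains e f where "frame p e f" "l = vec.span {p, e}" "e \<in> l"
proof -
  have "\<not> l \<subseteq> vec.span {p}"
  proof
    assume "l \<subseteq> vec.span {p}"
    then have "vec.dim l \<le> vec.dim {p}" by (metis vec.dim_subset vec.dim_span)
    then show False using assms unfolding proj_line_def by simp
  qed
  then obtain e where e: "e \<in> l" "e \<notin> vec.span {p}" by blast
  then have "l = vec.span {p, e}" using line_eq_span assms by blast
  moreover obtain f where "frame p e f" using frame_extend assms(3) e(2) by blast
  ultimately show ?thesis using that e by blast
qed

text \<open>A basis of \<open>l\<close> together with \<open>e\<close> is a frame, so removing
  suitable multiples of \<open>e\<close> moves \<open>p\<close> and \<open>f\<close> into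
  \<open>l\<close>. The pair \<open>(c, t)\<close> gives coordinates for the lines missing
  \<open>[e]\<close>: \<open>c\<close> is the intersection with the line through \<open>[p]\<close>
  and \<open>[e]\<close>, \<open>t\<close> a slope.\<close>

lemma line_cases:
  assumes "frame p e f" "proj_line l" "l \<noteq> vec.span {p, e}" "e \<notin> l"
  obtains c t where "l = vec.span {p + c *s e, f + t *s e}"
proof -
  obtain a b where ab: "a \<noteq> 0" "b \<notin> vec.span {a}" "l = vec.span {a, b}"
    using assms(2) proj_line_iff by blast
  have fr: "frame a b e" using ab assms(4) unfolding frame_iff by blast
  obtain x y c where p: "p = x *s a + y *s b + c *s e" by (rule frame_coords[OF fr])
  obtain x' y' t where f: "f = x' *s a + y' *s b + t *s e" by (rule frame_coords[OF fr])
  have 1: "p + (- c) *s e \<in> l" "f + (- t) *s e \<in> l" unfolding ab vec_span_2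
    using p f by (auto simp: vec_eq_iff)
  have 2: "p + (- c) *s e \<noteq> 0" "f + (- t) *s e \<notin> vec.span {p + (- c) *s e}"
  proof -
    show "p + (- c) *s e \<noteq> 0" using frame_indep(1)[OF assms(1), of 1 "- c" 0] by auto
    show "f + (- t) *s e \<notin> vec.span {p + (- c) *s e}"
    proof
      assume "f + (- t) *s e \<in> vec.span {p + (- c) *s e}"
      then obtain k where "f + (- t) *s e = k *s (p + (- c) *s e)" unfolding vec_span_1 by blast
      then have "0 *s p + (- t) *s e + 1 *s f = k *s p + (- k * c) *s e + 0 *s f"
        by (simp add: vec_eq_iff algebra_simps)
      from frame_unique(3)[OF assms(1) this] show False by simp
    qed
  qed
  show ?thesis using that line_eq_span[OF assms(2) 1 2] by blast
qed

section \<open>Homogeneous polynomial functions\<close>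

lemma hom_poly_monom:
  assumes "i + j + k = m"
  shows "hom_poly m (\<lambda>v. a * v $ 1 ^ i * v $ 2 ^ j * v $ 3 ^ k)"
  unfolding hom_poly_def
proof (intro exI allI)
  fix v :: "complex ^ 3"
  let ?t = "a * v $ 1 ^ i * v $ 2 ^ j * v $ 3 ^ k"
  have k: "k = m - i - j" and ij: "i \<le> m" "j \<le> m - i" using assms by auto
  have "?t = (\<Sum>i'\<le>m. if i' = i then ?t else 0)" using ij by simp
  also have "\<dots> = (\<Sum>i'\<le>m. \<Sum>j'\<le>m - i'. if i' = i \<and> j' = j then ?t else 0)"
    using ij by (intro sum.cong refl) auto
  also have "\<dots> = (\<Sum>i'\<le>m. \<Sum>j'\<le>m - i'. (if i' = i \<and> j' = j then a else 0) *
          v $ 1 ^ i' * v $ 2 ^ j' * v $ 3 ^ (m - i' - j'))"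
    unfolding k by (intro sum.cong refl) auto
  finally show "?t = \<dots>" .
qed

lemma hom_poly_zero: "hom_poly m (\<lambda>v. 0)"
  unfolding hom_poly_def by (rule exI[of _ "\<lambda>_ _. 0"]) simp

lemma hom_poly_add:
  assumes "hom_poly m f" "hom_poly m g"
  shows "hom_poly m (\<lambda>v. f v + g v)"
proof -
  obtain c c' where "\<And>v. f v = (\<Sum>i\<le>m. \<Sum>j\<le>m - i. c i j * v $ 1 ^ i * v $ 2 ^ j * v $ 3 ^ (m - i - j))"
    "\<And>v. g v = (\<Sum>i\<le>m. \<Sum>j\<le>m - i. c' i j * v $ 1 ^ i * v $ 2 ^ j * v $ 3 ^ (m - i - j))"
    using assms unfolding hom_poly_def by blast
  then show ?thesis unfolding hom_poly_def
    by (intro exI[of _ "\<lambda>i j. c i j + c' i j"]) (simp add: sum.distrib algebra_simps)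
qed

lemma hom_poly_sum:
  assumes "\<And>a. a \<in> S \<Longrightarrow> hom_poly m (f a)"
  shows "hom_poly m (\<lambda>v. \<Sum>a\<in>S. f a v)"
  using assms by (induction S rule: infinite_finite_induct) (auto intro: hom_poly_zero hom_poly_add)

lemma hom_poly_cmult:
  assumes "hom_poly m f"
  shows "hom_poly m (\<lambda>v. k * f v)"
proof -
  obtain c where "\<And>v. f v = (\<Sum>i\<le>m. \<Sum>j\<le>m - i. c i j * v $ 1 ^ i * v $ 2 ^ j * v $ 3 ^ (m - i - j))"
    using assms unfolding hom_poly_def by blast
  then show ?thesis unfolding hom_poly_def
    by (intro exI[of _ "\<lambda>i j. k * c i j"]) (simp add: sum_distrib_left algebra_simps)
qed

text \<open>The sum rule takes sums over \<open>{..n}\<close> so that two applications of it match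
  the double sum in \<open>hom_poly_def\<close>.\<close>

lemma hom_poly_induct [consumes 1, case_names monom sum]:
  assumes "hom_poly m f"
    and monom: "\<And>a i j k. i + j + k = m \<Longrightarrow> P (\<lambda>v. a * v $ 1 ^ i * v $ 2 ^ j * v $ 3 ^ k)"
    and sum: "\<And>n (g :: nat \<Rightarrow> complex ^ 3 \<Rightarrow> complex). (\<And>i. i \<le> n \<Longrightarrow> P (g i)) \<Longrightarrow> P (\<lambda>v. \<Sum>i\<le>n. g i v)"
  shows "P f"
proof -
  obtain c where "f = (\<lambda>v. \<Sum>i\<le>m. \<Sum>j\<le>m - i. c i j * v $ 1 ^ i * v $ 2 ^ j * v $ 3 ^ (m - i - j))"
    using assms(1) unfolding hom_poly_def by blast
  then show ?thesis by (auto intro!: sum monom)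
qed

lemma hom_poly_mult_linear:
  assumes "hom_poly m f"
  shows "hom_poly (Suc m) (\<lambda>v. (a \<star> v) * f v)"
  using assms
proof (induction rule: hom_poly_induct)
  case (monom b i j k)
  have "hom_poly (Suc m) (\<lambda>v. (a $ 1 * b) * v $ 1 ^ Suc i * v $ 2 ^ j * v $ 3 ^ k +
      (a $ 2 * b) * v $ 1 ^ i * v $ 2 ^ Suc j * v $ 3 ^ k +
      (a $ 3 * b) * v $ 1 ^ i * v $ 2 ^ j * v $ 3 ^ Suc k)"
    using monom by (intro hom_poly_add hom_poly_monom) auto
  then show ?case by (simp add: star_expand algebra_simps)
next
  case (sum n g)
  then show ?case unfolding sum_distrib_left by (intro hom_poly_sum) auto
qed

lemma hom_poly_linear_powers:
  "hom_poly (i + j + k) (\<lambda>v. b * (a \<star> v) ^ i * (a' \<star> v) ^ j * (a'' \<star> v) ^ k)"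
proof (induction i)
  case 0
  show ?case
  proof (induction j)
    case 0
    show ?case
    proof (induction k)
      case 0
      show ?case using hom_poly_monom[of 0 0 0 0 b] by simp
    next
      case (Suc k)
      show ?case using hom_poly_mult_linear[OF Suc, of a''] by (simp add: algebra_simps)
    qed
  next
    case (Suc j)
    show ?case using hom_poly_mult_linear[OF Suc, of a'] by (simp add: algebra_simps)
  qed
next
  case (Suc i)
  show ?case using hom_poly_mult_linear[OF Suc, of a] by (simp add: algebra_simps)
qed

text \<open>Every coordinate of the substituted vector is a linear form in \<open>v\<close>, so a
  monomial becomes a product of powers of linear forms.\<close>

lemma hom_poly_linear_subst:
  assumes "hom_poly m f"
  shows "hom_poly m (\<lambda>v. f (v $ 1 *s p + v $ 2 *s e + v $ 3 *s q))"
  using assms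
proof (induction rule: hom_poly_induct)
  case (monom b i j k)
  have "(v $ 1 *s p + v $ 2 *s e + v $ 3 *s q) $ r = vector [p $ r, e $ r, q $ r] \<star> v"
    for r and v :: "complex ^ 3"
    by (simp add: star_expand mult.commute)
  then show ?case using hom_poly_linear_powers[of i j k b] monom by simp
next
  case (sum n g)
  then show ?case by (rule hom_poly_sum) auto
qed

lemma hom_poly_expand:
  assumes "hom_poly m g"
  obtains c where "\<And>x u w. g (x *s p + u *s e + w *s f) =
    (\<Sum>i\<le>m. \<Sum>j\<le>m - i. c i j * x ^ i * u ^ j * w ^ (m - i - j))"
proof -
  obtain c where c: "\<And>v :: complex ^ 3. g (v $ 1 *s p + v $ 2 *s e + v $ 3 *s f) =
      (\<Sum>i\<le>m. \<Sum>j\<le>m - i. c i j * v $ 1 ^ i * v $ 2 ^ j * v $ 3 ^ (m - i - j))"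
    using hom_poly_linear_subst[OF assms, of p e f] unfolding hom_poly_def by blast
  have "g (x *s p + u *s e + w *s f) =
    (\<Sum>i\<le>m. \<Sum>j\<le>m - i. c i j * x ^ i * u ^ j * w ^ (m - i - j))" for x u w
    using c[of "vector [x, u, w]"] by simp
  then show ?thesis by (rule that)
qed

lemma hom_poly_scale:
  assumes "hom_poly m f"
  shows "f (k *s v) = k ^ m * f v"
  using assms
proof (induction rule: hom_poly_induct)
  case (monom b i j l)
  then have "k ^ m = k ^ i * k ^ j * k ^ l" by (metis power_add)
  then show ?case by (simp add: power_mult_distrib)
next
  case (sum n g)
  then show ?case by (simp add: sum_distrib_left)
qed

text \<open>The top coefficient is the value at the point at infinity \<open>[a]\<close> of the
  parametrised line; this turns non-vanishing at a point into an exact degree.\<close>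

lemma hom_poly_line:
  assumes "hom_poly m g"
  obtains P where "degree P \<le> m" "coeff P m = g a" "\<And>x. g (x *s a + b) = poly P x"
proof -
  obtain c where c: "\<And>x u w. g (x *s a + u *s b + w *s 0) =
      (\<Sum>i\<le>m. \<Sum>j\<le>m - i. c i j * x ^ i * u ^ j * w ^ (m - i - j))"
    using hom_poly_expand[OF assms] by blast
  \<comment> \<open>The third direction is a dummy: with \<open>w = 0\<close>, the convention
    \<open>0 ^ 0 = 1\<close> keeps just the term \<open>j = m - i\<close>.\<close>
  define C where "C i = (\<Sum>j\<le>m - i. c i j * 0 ^ (m - i - j))" for i
  define P where "P = (\<Sum>i\<le>m. monom (C i) i)"
  have "degree P \<le> m" unfolding P_def
    by (rule degree_sum_le) (auto intro: order_trans[OF degree_monom_le])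
  moreover have "coeff P m = g a"
  proof -
    have "coeff P m = C m" unfolding P_def by (simp add: coeff_sum)
    also have "\<dots> = c m 0" by (simp add: C_def)
    also have "\<dots> = (\<Sum>i\<le>m. if i = m then c m 0 else 0)" by simp
    also have "\<dots> = (\<Sum>i\<le>m. \<Sum>j\<le>m - i. c i j * 1 ^ i * 0 ^ j * 0 ^ (m - i - j))"
    proof (rule sum.cong[OF refl])
      fix i assume i: "i \<in> {..m}"
      have "(\<Sum>j\<le>m - i. c i j * 1 ^ i * 0 ^ j * 0 ^ (m - i - j)) =
          (\<Sum>j\<le>m - i. if j = 0 then (if i = m then c m 0 else 0) else 0)"
        using i by (intro sum.cong) (auto simp: power_0_left)
      then show "(if i = m then c m 0 else 0) =
          (\<Sum>j\<le>m - i. c i j * 1 ^ i * 0 ^ j * 0 ^ (m - i - j))" by simp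
    qed
    also have "\<dots> = g a" using c[of 1 0 0] by simp
    finally show ?thesis .
  qed
  moreover have "g (x *s a + b) = poly P x" for x
    using c[of x 1 0] by (simp add: P_def C_def poly_sum poly_monom sum_distrib_left mult_ac)
  ultimately show ?thesis by (rule that)
qed

lemma hom_poly_star:
  fixes \<omega> :: "complex ^ 3 \<Rightarrow> complex ^ 3"
  assumes "\<forall>i. hom_poly m (\<lambda>v. \<omega> v $ i)"
  shows "hom_poly m (\<lambda>v. \<omega> v \<star> w)"
proof -
  have "hom_poly m (\<lambda>v. w $ 1 * \<omega> v $ 1 + w $ 2 * \<omega> v $ 2 + w $ 3 * \<omega> v $ 3)"
    using assms by (intro hom_poly_add hom_poly_cmult) auto
  then show ?thesis by (simp add: star_expand mult.commute)
qed

text \<open>\<open>has_derivative\<close> is a real notion; the shape \<open>a \<star> w\<close>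
  keeps the complex linearity of the derivative. Functions with such a derivative include constants
  and coordinates and are closed under sums and products.\<close>

lemma hom_poly_has_derivative:
  assumes "hom_poly m g"
  shows "\<exists>a. (g has_derivative (\<lambda>w. a \<star> w)) (at p)"
proof -
  define D where "D f \<longleftrightarrow> (\<exists>a. (f has_derivative (\<lambda>w. a \<star> w)) (at p))"
    for f :: "complex ^ 3 \<Rightarrow> complex"
  have const: "D (\<lambda>v. k)" for k unfolding D_def
    by (rule exI[of _ 0]) (simp add: star_zero_left[abs_def])
  have add: "D (\<lambda>v. f v + h v)" if fh: "D f" "D h" for f h
  proof -
    obtain a b where "(f has_derivative (\<lambda>w. a \<star> w)) (at p)" "(h has_derivative (\<lambda>w. b \<star> w)) (at p)"
      using fh unfolding D_def by blast
    from has_derivative_add[OF this] show ?thesis unfolding D_def star_add_left[symmetric] by blast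
  qed
  have mult: "D (\<lambda>v. f v * h v)" if fh: "D f" "D h" for f h
  proof -
    obtain a b where "(f has_derivative (\<lambda>w. a \<star> w)) (at p)" "(h has_derivative (\<lambda>w. b \<star> w)) (at p)"
      using fh unfolding D_def by blast
    note has_derivative_mult[OF this]
    moreover have "(\<lambda>w. f p * (b \<star> w) + (a \<star> w) * h p) = (\<lambda>w. (f p *s b + h p *s a) \<star> w)"
      by (simp add: star_simps mult.commute)
    ultimately show ?thesis unfolding D_def by (intro exI[of _ "f p *s b + h p *s a"]) simp
  qed
  have coord: "D (\<lambda>v. v $ i)" for i
  proof -
    have "((\<lambda>v. v $ i) has_derivative (\<lambda>w. w $ i)) (at p)"
      by (rule bounded_linear_imp_has_derivative[OF bounded_linear_vec_nth])
    moreover have "(\<star>) (axis i 1) = (\<lambda>w :: complex ^ 3. w $ i)"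
      using exhaust_3[of i] by (auto simp: star_expand axis_def)
    ultimately show ?thesis unfolding D_def by (intro exI[of _ "axis i 1"]) simp
  qed
  have power: "D (\<lambda>v. f v ^ n)" if "D f" for f n
    by (induction n) (auto intro: const mult that)
  have sum: "D (\<lambda>v. \<Sum>i\<le>n. h i v)" if "\<And>i. i \<le> n \<Longrightarrow> D (h i)" for h and n :: nat
    using that by (induction n) (auto intro: add)
  have "D g" using assms
    by (induction rule: hom_poly_induct) (auto intro!: mult power const coord sum)
  then show ?thesis unfolding D_def .
qed

lemma hom_poly_jacobian:
  fixes \<omega> :: "complex ^ 3 \<Rightarrow> complex ^ 3"
  assumes "\<forall>i. hom_poly m (\<lambda>v. \<omega> v $ i)"
  shows "\<exists>M :: complex ^ 3 ^ 3. (\<omega> has_derivative (\<lambda>w. M *v w)) (at p)"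
proof -
  have "\<forall>i. \<exists>a. ((\<lambda>v. \<omega> v $ i) has_derivative (\<lambda>w. a \<star> w)) (at p)"
    using assms hom_poly_has_derivative by blast
  then obtain a where a: "\<And>i. ((\<lambda>v. \<omega> v $ i) has_derivative (\<lambda>w. a i \<star> w)) (at p)" by metis
  have "(\<omega> has_derivative (\<lambda>w. (\<chi> i. a i) *v w)) (at p)"
    by (rule has_derivative_vec) (use a in \<open>simp add: matrix_vector_mult_def scalar_product_def\<close>)
  then show ?thesis by blast
qed

section \<open>Homogeneous forms and their linear parts\<close>

text \<open>The degree \<open>m\<close> is left open: its relation to the degree of the foliation is
  a theorem, \<open>foliation_degree_unique\<close>.\<close>

locale homogeneous_form =
  fixes \<omega> :: "complex ^ 3 \<Rightarrow> complex ^ 3" and m :: nat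
  assumes hom: "\<forall>i. hom_poly m (\<lambda>v. \<omega> v $ i)"
    and euler: "\<omega> v \<star> v = 0"
begin

definition jacobian :: "complex ^ 3 \<Rightarrow> complex ^ 3 ^ 3" where
  "jacobian p = (SOME M. (\<omega> has_derivative (\<lambda>w. M *v w)) (at p))"

text \<open>The linear part of the form at \<open>p\<close>, read as a bilinear form: differentiate
  in direction \<open>w\<close>, then evaluate on \<open>w'\<close>. Most later arguments use it
  instead of a chart.\<close>

definition lin :: "complex ^ 3 \<Rightarrow> complex ^ 3 \<Rightarrow> complex ^ 3 \<Rightarrow> complex" where
  "lin p w w' = (jacobian p *v w) \<star> w'"

lemma hom_star: "hom_poly m (\<lambda>v. \<omega> v \<star> w)"
  using hom_poly_star[OF hom] .

lemma scale: "\<omega> (k *s v) = k ^ m *s \<omega> v"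
  using hom_poly_scale[OF hom[rule_format]] by (simp add: vec_eq_iff)

lemma has_derivative_form: "(\<omega> has_derivative (\<lambda>w. jacobian p *v w)) (at p)"
  unfolding jacobian_def by (rule someI_ex) (rule hom_poly_jacobian[OF hom])

lemma lin_simps [simp]:
  "lin p (w + v) w' = lin p w w' + lin p v w'" "lin p w (w' + v') = lin p w w' + lin p w v'"
  "lin p (k *s w) w' = k * lin p w w'" "lin p w (k *s w') = k * lin p w w'"
  "lin p 0 w' = 0" "lin p w 0 = 0"
  unfolding lin_def
  by (simp_all add: star_simps vec.add vec.scale)

lemma has_field_derivative_lin:
  "((\<lambda>t. \<omega> (p + t *s w) \<star> w') has_field_derivative lin p w w') (at 0)"
proof -
  have l1: "bounded_linear (\<lambda>t. t *s w)"
    unfolding linear_conv_bounded_linear[symmetric]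
    by (rule linearI) (simp_all add: vec_eq_iff algebra_simps)
  have "((\<lambda>t. p + t *s w) has_derivative (\<lambda>t. t *s w)) (at 0)"
    using has_derivative_add[OF has_derivative_const[of p] bounded_linear_imp_has_derivative[OF l1]]
    by simp
  from has_derivative_compose[OF this, of \<omega> "\<lambda>w. jacobian p *v w"]
  have "((\<lambda>t. \<omega> (p + t *s w)) has_derivative (\<lambda>t. jacobian p *v (t *s w))) (at 0)"
    using has_derivative_form[of p] by simp
  from bounded_linear.has_derivative[OF bounded_linear_star this]
  show ?thesis unfolding has_field_derivative_def lin_def
    by (simp add: vec.scale star_simps mult_commute_abs)
qed

lemma lin_eqI:
  assumes "((\<lambda>t. \<omega> (p + t *s w) \<star> w') has_field_derivative D) (at 0)"
  shows "lin p w w' = D"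
  using DERIV_unique[OF has_field_derivative_lin assms] .

lemma lin_zeroI:
  assumes "\<And>t. \<omega> (p + t *s w) \<star> w' = 0"
  shows "lin p w w' = 0"
  by (rule lin_eqI) (simp add: assms)

text \<open>The Euler relation at \<open>p + t w\<close> expresses the contraction with
  \<open>p\<close> as \<open>- t\<close> times the contraction with \<open>w\<close>; differentiate
  at \<open>t = 0\<close>.\<close>

lemma lin_base_right: "lin p w p = - (\<omega> p \<star> w)"
proof (rule lin_eqI)
  have *: "\<omega> (p + t *s w) \<star> p = - t * (\<omega> (p + t *s w) \<star> w)" for t
    using euler[of "p + t *s w"] by (simp add: star_simps eq_neg_iff_add_eq_0)
  show "((\<lambda>t. \<omega> (p + t *s w) \<star> p) has_field_derivative - (\<omega> p \<star> w)) (at 0)"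
    unfolding *
    by (rule derivative_eq_intros has_field_derivative_lin refl)+ simp
qed

lemma lin_base_left: "\<omega> p = 0 \<Longrightarrow> lin p p w = 0"
proof (rule lin_zeroI)
  fix t assume "\<omega> p = 0"
  have "p + t *s p = (1 + t) *s p" by (simp add: vec_eq_iff algebra_simps)
  then show "\<omega> (p + t *s p) \<star> w = 0" using scale[of "1 + t" p] \<open>\<omega> p = 0\<close>
    by (simp add: star_simps)
qed

lemma invariant_lin_zero:
  assumes "invariant_line \<omega> l" "p \<in> l" "w \<in> l" "w' \<in> l"
  shows "lin p w w' = 0"
proof (rule lin_zeroI)
  fix t
  have "p + t *s w \<in> l" using proj_line_closed(1)[of l p w 1 t] assms
    unfolding invariant_line_def by simp
  then show "\<omega> (p + t *s w) \<star> w' = 0" using assms unfolding invariant_line_def by blast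
qed

lemma form_frame_zero:
  assumes "frame p e f" "\<omega> v \<star> p = 0" "\<omega> v \<star> e = 0" "\<omega> v \<star> f = 0"
  shows "\<omega> v = 0"
  using vector_eqI_star[OF assms] .

lemma invariant_line_span_iff:
  assumes "frame p e f"
  shows "invariant_line \<omega> (vec.span {p, e}) \<longleftrightarrow>
    (\<forall>x u. \<omega> (x *s p + u *s e) \<star> p = 0 \<and> \<omega> (x *s p + u *s e) \<star> e = 0)"
proof
  assume inv: "invariant_line \<omega> (vec.span {p, e})"
  have "x *s p + u *s e \<in> vec.span {p, e}" for x u unfolding vec_span_2 by blast
  then show "\<forall>x u. \<omega> (x *s p + u *s e) \<star> p = 0 \<and> \<omega> (x *s p + u *s e) \<star> e = 0"
    using inv unfolding invariant_line_def by (simp add: vec.span_base)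
next
  assume *: "\<forall>x u. \<omega> (x *s p + u *s e) \<star> p = 0 \<and> \<omega> (x *s p + u *s e) \<star> e = 0"
  show "invariant_line \<omega> (vec.span {p, e})"
    unfolding invariant_line_def
  proof (intro conjI ballI)
    fix v w assume "v \<in> vec.span {p, e}" "w \<in> vec.span {p, e}"
    then obtain x u x' u' where "v = x *s p + u *s e" "w = x' *s p + u' *s e"
      unfolding vec_span_2 by blast
    then show "\<omega> v \<star> w = 0" using * by (simp add: star_simps)
  qed (rule frame_span_line[OF assms])
qed

text \<open>For \<open>m > 0\<close> this is homogeneity; a constant form is forced to vanish by the
  Euler relation.\<close>

lemma form_zero: "\<omega> 0 = 0"
proof (cases "m = 0")
  case False
  then show ?thesis using scale[of 0 0] by (simp add: power_0_left)
next
  case m: True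
  have "\<omega> v = \<omega> 0" for v using scale[of 0 v] m by simp
  then have "\<omega> 0 \<star> v = 0" for v using euler[of v] by metis
  from this[of "axis 1 1"] this[of "axis 2 1"] this[of "axis 3 1"] show ?thesis
    by (simp add: star_expand axis_def vec_eq_iff forall_3)
qed

text \<open>At a common point the form vanishes on \<open>p\<close> and on one further direction in
  each line, and these three vectors form a frame.\<close>

lemma invariant_lines_meet:
  assumes "invariant_line \<omega> l" "invariant_line \<omega> l'" "l \<noteq> l'" "p \<in> l" "p \<in> l'"
  shows "\<omega> p = 0"
proof (cases "p = 0")
  case True
  then show ?thesis using form_zero by simp
next
  case False
  have pl: "proj_line l" "proj_line l'" using assms unfolding invariant_line_def by auto
  obtain e f where e: "frame p e f" "l = vec.span {p, e}" "e \<in> l"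
    using line_frame[OF pl(1) assms(4) False] .
  obtain e' f' where e': "frame p e' f'" "l' = vec.span {p, e'}" "e' \<in> l'"
    using line_frame[OF pl(2) assms(5) False] .
  have "e' \<notin> l"
  proof
    assume "e' \<in> l"
    then have "l = l'" using line_eq_span[OF pl(1) assms(4) _ False, of e'] e' unfolding frame_iff by simp
    then show False using assms by simp
  qed
  then have "frame p e e'" using e unfolding frame_iff by simp
  then show ?thesis
    using form_frame_zero[of p e e' p] assms e(3) e'(3) euler unfolding invariant_line_def by simp
qed

end

section \<open>Radial singularities of maximal order\<close>

lemma frame_span_inj:
  assumes "frame p e f" "vec.span {x *s p + u *s e + f} = vec.span {x' *s p + u' *s e + f}"
  shows "x = x'" "u = u'"
proof -
  have "x *s p + u *s e + f \<noteq> 0" using frame_indep(3)[OF assms(1), of x u 1] by auto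
  then obtain k where k: "x *s p + u *s e + f = k *s (x' *s p + u' *s e + f)"
    using span_eq_scale[OF assms(2)] by blast
  then have *: "x *s p + u *s e + 1 *s f = (k * x') *s p + (k * u') *s e + k *s f"
    by (simp add: vec_eq_iff algebra_simps)
  have "1 = k" by (rule frame_unique(3)[OF assms(1) *])
  then show "x = x'" "u = u'" using frame_unique[OF assms(1) *] by simp_all
qed

lemma higher_deriv_poly_zero: "(deriv ^^ i) (poly P) 0 / fact i = coeff P i"
  for P :: "complex poly"
proof -
  have "(deriv ^^ i) (poly P) = poly ((pderiv ^^ i) P)"
    by (induction i) (auto intro!: DERIV_imp_deriv poly_DERIV)
  then show ?thesis
    by (simp add: poly_0_coeff_0 coeff_higher_pderiv pochhammer_fact[symmetric])
qed

lemma poly_at_one: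
  fixes P :: "complex poly"
  assumes "degree P \<le> n"
  shows "poly P 1 = (\<Sum>i\<le>n. coeff P i)"
proof -
  have "(\<Sum>i\<le>n. coeff P i) = (\<Sum>i\<le>degree P. coeff P i)"
    using assms by (intro sum.mono_neutral_right) (auto simp: coeff_eq_0)
  then show ?thesis by (simp add: poly_altdef)
qed

locale foliation_form = homogeneous_form \<omega> "Suc d" for \<omega> d +
  assumes d2: "2 \<le> d" and finite_singular: "finite {s. singular_point \<omega> s}"
begin

lemma singular_point_iff:
  assumes "p \<noteq> 0"
  shows "singular_point \<omega> (vec.span {p}) \<longleftrightarrow> \<omega> p = 0"
proof -
  have "proj_point (vec.span {p})" using assms proj_point_iff by blast
  moreover have "\<omega> v = 0" if "\<omega> p = 0" "v \<in> vec.span {p}" for v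
    using that scale unfolding vec_span_1 by fastforce
  ultimately show ?thesis unfolding singular_point_def by (auto simp: vec.span_base)
qed

text \<open>The points \<open>[g \<tau> p + \<tau> e + f]\<close> are pairwise distinct because the
  \<open>f\<close>-coordinate is 1, so they cannot all be singular. The free function
  \<open>g\<close> allows a root to be chosen separately for each \<open>\<tau>\<close>.\<close>

lemma infinite_singularD:
  assumes "frame p e f" "\<And>\<tau>. \<omega> (g \<tau> *s p + \<tau> *s e + f) = 0"
  shows False
proof -
  define S where "S \<tau> = vec.span {g \<tau> *s p + \<tau> *s e + f}" for \<tau> :: complex
  have "inj S" unfolding S_def by (rule injI) (rule frame_span_inj(2)[OF assms(1)])
  moreover have "singular_point \<omega> (S \<tau>)" for \<tau>
  proof -
    have "g \<tau> *s p + \<tau> *s e + f \<noteq> 0" using frame_indep(3)[OF assms(1), of "g \<tau>" \<tau> 1] by auto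
    then show ?thesis unfolding S_def using assms(2) singular_point_iff by blast
  qed
  then have "range S \<subseteq> {s. singular_point \<omega> s}" by auto
  ultimately show False
    using finite_singular infinite_UNIV_char_0[where 'a=complex] by (metis finite_imageD finite_subset)
qed

lemma form_nonzero: obtains v where "\<omega> v \<noteq> 0"
proof -
  obtain e f where fr: "frame (axis 1 1) e f" by (rule frame_extend_point[of "axis 1 1"]) auto
  have "\<exists>v. \<omega> v \<noteq> 0"
  proof (rule ccontr)
    assume "\<not> ?thesis"
    then show False using infinite_singularD[OF fr, of "\<lambda>_. 0"] by simp
  qed
  then show ?thesis using that by blast
qed

text \<open>Otherwise each of the curves \<open>x \<mapsto> [x p0 + \<tau> p + f]\<close> would contain a singularity.\<close>

lemma form_star_nonzero:
  assumes "p \<noteq> 0"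
  obtains v where "\<omega> v \<star> p \<noteq> 0"
proof -
  have "\<exists>v. \<omega> v \<star> p \<noteq> 0"
  proof (rule ccontr)
    assume "\<not> ?thesis"
    then have z: "\<omega> v \<star> p = 0" for v by simp
    \<comment> \<open>Differentiating the vanishing contraction shows that \<open>[p]\<close> is
      itself singular.\<close>
    have "\<omega> p \<star> w = 0" for w
      using lin_base_right[of p w] lin_zeroI[of p w p] z by simp
    then have wp: "\<omega> p = 0"
      using frame_extend_point[OF assms] vector_eqI_star by metis
    obtain p0 where p0: "\<omega> p0 \<noteq> 0" by (rule form_nonzero)
    have "p \<notin> vec.span {p0}"
    proof
      assume "p \<in> vec.span {p0}"
      then obtain k where k: "p = k *s p0" unfolding vec_span_1 by blast
      then have "k \<noteq> 0" using assms by auto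
      then have "p0 = (1 / k) *s p" using k by (simp add: vec_eq_iff)
      then show False using p0 scale[of "1 / k" p] wp by simp
    qed
    moreover have "p0 \<noteq> 0" using scale[of 0 0] p0 by auto
    ultimately obtain f where fr: "frame p0 p f" using frame_extend by blast
    have nz: "\<omega> p0 \<star> f \<noteq> 0" using form_frame_zero[OF fr, of p0] p0 euler z by blast
    have "\<exists>x. \<omega> (x *s p0 + \<tau> *s p + f) = 0" for \<tau>
    proof -
      let ?v = "\<lambda>x. x *s p0 + (\<tau> *s p + f)"
      obtain P where P: "degree P \<le> Suc d" "coeff P (Suc d) = \<omega> p0 \<star> f"
        "\<And>x. \<omega> (?v x) \<star> f = poly P x"
        using hom_poly_line[OF hom_star] by blast
      obtain Q where Q: "\<And>x. \<omega> (?v x) \<star> p0 = poly Q x"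
        using hom_poly_line[OF hom_star] by blast
      have PQ: "\<omega> (?v x) \<star> f = - x * (\<omega> (?v x) \<star> p0)" for x
        using euler[of "?v x"] z by (simp add: star_simps eq_neg_iff_add_eq_0 add.commute)
      \<comment> \<open>The coefficient of \<open>x ^ (d + 1)\<close> in \<open>P\<close> is
        \<open>\<omega> p0 \<star> f\<close>, which is non-zero, so \<open>Q\<close> has degree at
        least \<open>d\<close> and therefore a root. There the form vanishes on the whole
        frame.\<close>
      then have "P = [:0, -1:] * Q"
        by (intro poly_eq_poly_eq_iff[THEN iffD1] ext) (simp add: P(3)[symmetric] Q[symmetric])
      then have "coeff P (Suc d) = - coeff Q d" by (simp add: coeff_pCons)
      then have "d \<le> degree Q" using P(2) nz by (intro le_degree) auto
      then have "degree Q > 0" using d2 by simp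
      from alg_closed_imp_poly_has_root[OF this] obtain x where "poly Q x = 0" ..
      then have "\<omega> (?v x) \<star> p0 = 0" "\<omega> (?v x) \<star> f = 0" using Q PQ by simp_all
      then have "\<omega> (?v x) = 0" using form_frame_zero[OF fr] z by blast
      then show ?thesis by (auto simp: add.assoc)
    qed
    then obtain g where "\<And>\<tau>. \<omega> (g \<tau> *s p0 + \<tau> *s p + f) = 0" by metis
    then show False by (rule infinite_singularD[OF fr])
  qed
  then show ?thesis using that by blast
qed

text \<open>A chart-free form of being radial of order \<open>d - 1\<close>. Invariance along
  \<open>p\<close> says that the polynomial which decides tangency with the radial field is
  homogeneous of degree \<open>d + 1\<close>; the last conjunct expresses multiplicity one. The
  equivalence is \<open>radial_singularity_imp\<close> with \<open>radial_at_imp\<close>.\<close>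

definition radial_at :: "complex ^ 3 \<Rightarrow> bool" where
  "radial_at p \<longleftrightarrow> \<omega> p = 0 \<and> (\<forall>v x. \<omega> (v + x *s p) \<star> p = \<omega> v \<star> p) \<and> (\<exists>w w'. lin p w w' \<noteq> 0)"

section \<open>Jets of the chart field along a ray\<close>

lemma chart_polys:
  obtains A B C where
    "\<And>t. \<omega> (p + t *s W) \<star> e = poly A t" "\<And>t. \<omega> (p + t *s W) \<star> f = poly B t"
    "\<And>t. \<omega> (p + t *s W) \<star> p = poly C t" 
    "degree A \<le> Suc d" "degree B \<le> Suc d" "degree C \<le> Suc d" "coeff C (Suc d) = \<omega> W \<star> p"
proof -
  obtain A B C where 
    "\<And>t. \<omega> (t *s W + p) \<star> e = poly A t" "\<And>t. \<omega> (t *s W + p) \<star> f = poly B t"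
    "\<And>t. \<omega> (t *s W + p) \<star> p = poly C t"
    "degree A \<le> Suc d" "degree B \<le> Suc d" "degree C \<le> Suc d" "coeff C (Suc d) = \<omega> W \<star> p"
    using hom_poly_line[OF hom_star] by metis
  then show ?thesis by (intro that[of A B C]) (simp_all add: add.commute)
qed

context
  fixes p e f :: "complex ^ 3" and w :: "complex ^ 2" and W A B C
  assumes W: "W = w $ 1 *s e + w $ 2 *s f"
    and A: "\<And>t. \<omega> (p + t *s W) \<star> e = poly A t"
    and B: "\<And>t. \<omega> (p + t *s W) \<star> f = poly B t"
    and C: "\<And>t. \<omega> (p + t *s W) \<star> p = poly C t"
begin

text \<open>Along the ray the chart field is \<open>(B t, - A t)\<close>, so its homogeneous
  components at \<open>w\<close> are coefficients of \<open>B\<close> and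
  \<open>- A\<close>.\<close>

lemma jet_chart_field:
  "jet k (chart_field \<omega> p e f) w $ 1 = (\<Sum>i\<le>k. coeff B i)"
  "jet k (chart_field \<omega> p e f) w $ 2 = - (\<Sum>i\<le>k. coeff A i)"
proof -
  have *: "p + (t *s w) $ 1 *s e + (t *s w) $ 2 *s f = p + t *s W" for t
    unfolding W by (simp add: vec_eq_iff algebra_simps)
  have 1: "(\<lambda>t. chart_field \<omega> p e f (t *s w) $ 1) = poly B"
    unfolding chart_field_def Let_def * by (simp add: B)
  have 2: "(\<lambda>t. chart_field \<omega> p e f (t *s w) $ 2) = poly (- A)"
    unfolding chart_field_def Let_def * by (simp add: A fun_eq_iff)
  show "jet k (chart_field \<omega> p e f) w $ 1 = (\<Sum>i\<le>k. coeff B i)"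
    unfolding jet_def by (simp only: vec_lambda_beta 1 higher_deriv_poly_zero)
  show "jet k (chart_field \<omega> p e f) w $ 2 = - (\<Sum>i\<le>k. coeff A i)"
    unfolding jet_def by (simp only: vec_lambda_beta 2 higher_deriv_poly_zero coeff_minus sum_negf)
qed

lemma euler_polys: "coeff C 0 = 0" "coeff C (Suc i) = - (w $ 1 * coeff A i + w $ 2 * coeff B i)"
proof -
  have "C = [:0, -1:] * (smult (w $ 1) A + smult (w $ 2) B)"
  proof (intro poly_eq_poly_eq_iff[THEN iffD1] ext)
    fix t
    have "\<omega> (p + t *s W) \<star> p + t * (w $ 1 * (\<omega> (p + t *s W) \<star> e) + w $ 2 * (\<omega> (p + t *s W) \<star> f)) = 0"
      using euler[of "p + t *s W"] unfolding W by (simp only: star_simps)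
    then show "poly C t = poly ([:0, -1:] * (smult (w $ 1) A + smult (w $ 2) B)) t"
      unfolding A B C by (simp add: algebra_simps eq_neg_iff_add_eq_0)
  qed
  then show "coeff C 0 = 0" "coeff C (Suc i) = - (w $ 1 * coeff A i + w $ 2 * coeff B i)"
    by (simp_all add: coeff_pCons)
qed

text \<open>The determinant with the radial field is the combination \<open>w1 A + w2 B\<close>,
  which the Euler relation identifies with \<open>- C\<close> shifted by one degree. Tangency is
  thus read off from the contraction with \<open>p\<close> alone.\<close>

lemma det_jet: "det (vector [jet k (chart_field \<omega> p e f) w, w]) = - (\<Sum>i\<le>k. coeff C (Suc i))"
proof -
  have "(\<Sum>i\<le>k. coeff C (Suc i)) = - (w $ 1 * (\<Sum>i\<le>k. coeff A i) + w $ 2 * (\<Sum>i\<le>k. coeff B i))"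
    by (simp only: euler_polys sum_negf sum.distrib sum_distrib_left)
  then show ?thesis by (simp add: det_2 jet_chart_field)
qed

lemma coeffs_low: "coeff A 0 = \<omega> p \<star> e" "coeff B 0 = \<omega> p \<star> f"
    "coeff A 1 = lin p W e" "coeff B 1 = lin p W f"
proof -
  show "coeff A 0 = \<omega> p \<star> e" "coeff B 0 = \<omega> p \<star> f"
    using A[of 0] B[of 0] by (simp_all add: poly_0_coeff_0)
  have "lin p W e = poly (pderiv A) 0" by (rule lin_eqI) (simp add: A poly_DERIV)
  then show "coeff A 1 = lin p W e" by (simp add: poly_0_coeff_0 coeff_pderiv)
  have "lin p W f = poly (pderiv B) 0" by (rule lin_eqI) (simp add: B poly_DERIV)
  then show "coeff B 1 = lin p W f" by (simp add: poly_0_coeff_0 coeff_pderiv)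
qed

end

text \<open>\<open>LEAST\<close> carries no information if every jet is zero, so this case has to be
  excluded: the form would vanish on the whole chart, against the finiteness of the singular
  set.\<close>

lemma field_multiplicity_one_imp:
  assumes "frame p e f" "\<omega> p = 0" "field_multiplicity (chart_field \<omega> p e f) = 1"
  shows "\<exists>w. jet 1 (chart_field \<omega> p e f) w \<noteq> 0"
proof (rule ccontr)
  let ?X = "chart_field \<omega> p e f"
  assume none: "\<not> ?thesis"
  have all: "jet k ?X w = 0" for k w
  proof (rule ccontr)
    assume "jet k ?X w \<noteq> 0"
    then have "\<exists>w. jet (LEAST k. \<exists>w. jet k ?X w \<noteq> 0) ?X w \<noteq> 0"
      by (intro LeastI[of "\<lambda>k. \<exists>w. jet k ?X w \<noteq> 0" k]) blast
    then show False using assms(3) none unfolding field_multiplicity_def by simp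
  qed
  have zero: "\<omega> (p + W) = 0" if "W = u *s e + v *s f" for W u v
  proof -
    let ?w = "vector [u, v] :: complex ^ 2"
    have W: "W = ?w $ 1 *s e + ?w $ 2 *s f" using that by simp
    obtain A B C where abc: "\<And>t. \<omega> (p + t *s W) \<star> e = poly A t" "\<And>t. \<omega> (p + t *s W) \<star> f = poly B t"
      "\<And>t. \<omega> (p + t *s W) \<star> p = poly C t" "degree A \<le> Suc d" "degree B \<le> Suc d"
      by (rule chart_polys[of p W e f]) blast
    note j = jet_chart_field[OF W abc(1-3)]
    \<comment> \<open>The value at \<open>t = 1\<close> is the sum of all coefficients, hence a jet
      of order \<open>d + 1\<close>.\<close>
    have "\<omega> (p + W) \<star> e = (\<Sum>i\<le>Suc d. coeff A i)" "\<omega> (p + W) \<star> f = (\<Sum>i\<le>Suc d. coeff B i)"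
      using abc(1)[of 1] abc(2)[of 1] poly_at_one[OF abc(4)] poly_at_one[OF abc(5)] by simp_all
    then have *: "\<omega> (p + W) \<star> e = 0" "\<omega> (p + W) \<star> f = 0"
      using j[of "Suc d"] all by (simp_all del: sum.atMost_Suc)
    then have "\<omega> (p + W) \<star> p = 0" using euler[of "p + W"] that by (simp add: star_simps)
    then show ?thesis using form_frame_zero[OF assms(1)] * by blast
  qed
  have "\<omega> (0 *s f + u *s e + p) = 0" for u
    using zero[of "u *s e + 0 *s f" u 0] by (simp add: add.commute)
  then show False using infinite_singularD[of f e p "\<lambda>_. 0"] frame_rotate frame_swap assms(1) by metis
qed

text \<open>Vanishing determinants below order \<open>d\<close> remove the coefficients of
  \<open>C\<close> one after the other up to degree \<open>d\<close>. The remaining monomial gives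
  \<open>\<omega> (p + t W) \<star> p = t ^ (d + 1) (\<omega> W \<star> p)\<close>, and rescaling
  turns this into invariance along \<open>p\<close>.\<close>

lemma radial_singularity_imp:
  assumes "radial_singularity \<omega> s (d - 1)"
  obtains p where "p \<noteq> 0" "s = vec.span {p}" "radial_at p"
proof -
  from assms obtain p e f where pt: "singular_point \<omega> s" "affine_frame s p e f"
    and X: "field_multiplicity (chart_field \<omega> p e f) = 1"
      "field_tangency_order (chart_field \<omega> p e f) = d - 1 + 1"
    unfolding radial_singularity_def defining_field_def by blast
  let ?X = "chart_field \<omega> p e f"
  have fr: "frame p e f" and s: "s = vec.span {p}" using pt(2) unfolding affine_frame_def frame_def by auto
  have p: "p \<noteq> 0" using fr unfolding frame_iff by blast
  have wp: "\<omega> p = 0" using pt(1) s singular_point_iff[OF p] by simp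
  have low: "det (vector [jet k ?X w, w]) = 0" if "k < d" "1 \<le> k" for k w
  proof -
    have "k < field_tangency_order ?X" using that X d2 by simp
    from not_less_Least[OF this[unfolded field_tangency_order_def]] X(1) that(2) show ?thesis by auto
  qed
  have hom_W: "\<omega> (x *s p + W) \<star> p = \<omega> W \<star> p" if "W = u *s e + v *s f" for x W u v
  proof -
    let ?w = "vector [u, v] :: complex ^ 2"
    have W: "W = ?w $ 1 *s e + ?w $ 2 *s f" using that by simp
    obtain A B C where abc: "\<And>t. \<omega> (p + t *s W) \<star> e = poly A t" "\<And>t. \<omega> (p + t *s W) \<star> f = poly B t"
      "\<And>t. \<omega> (p + t *s W) \<star> p = poly C t" and C: "degree C \<le> Suc d" "coeff C (Suc d) = \<omega> W \<star> p"
      by (rule chart_polys[of p W e f]) blast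
    \<comment> \<open>Minimality of the tangency order covers only \<open>1 \<le> k < d\<close>; for
      \<open>k = 0\<close> the coefficient vanishes because \<open>p\<close> is singular.\<close>
    have S: "(\<Sum>i\<le>k. coeff C (Suc i)) = 0" if "k < d" for k
    proof (cases "k = 0")
      case True
      then show ?thesis using euler_polys(2)[OF W abc(1-3)] coeffs_low[OF W abc(1-3)] wp
        by (simp add: star_simps)
    next
      case False
      then show ?thesis using low[of k ?w] det_jet[OF W abc(1-3), of k] that by simp
    qed
    have Z: "coeff C i = 0" if "i \<le> d" for i
    proof (cases i)
      case 0
      then show ?thesis using euler_polys(1)[OF W abc(1-3)] by simp
    next
      case (Suc k)
      show ?thesis
      proof (cases k)
        case 0
        then show ?thesis using S[of 0] Suc d2 by simp
      next
        case (Suc k')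
        then show ?thesis using S[of k] S[of k'] \<open>i = Suc k\<close> that by simp
      qed
    qed
    have "C = monom (\<omega> W \<star> p) (Suc d)"
    proof (rule poly_eqI)
      fix i
      consider "i \<le> d" | "i = Suc d" | "i > Suc d" by linarith
      then show "coeff C i = coeff (monom (\<omega> W \<star> p) (Suc d)) i"
        using Z C by cases (auto simp: coeff_eq_0)
    qed
    then have *: "\<omega> (p + t *s W) \<star> p = t ^ Suc d * (\<omega> W \<star> p)" for t
      by (simp add: abc poly_monom)
    show ?thesis
    proof (cases "x = 0")
      case False
      then have "x *s p + W = x *s (p + (1 / x) *s W)" by (simp add: vec_eq_iff field_simps)
      then show ?thesis using False by (simp only: scale star_simps *) (simp add: power_one_over)
    qed simp
  qed
  have "\<omega> (v + x *s p) \<star> p = \<omega> v \<star> p" for v x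
  proof -
    obtain y u z where v: "v = y *s p + u *s e + z *s f" by (rule frame_coords[OF fr])
    have v: "v = y *s p + (u *s e + z *s f)" "v + x *s p = (x + y) *s p + (u *s e + z *s f)"
      unfolding v by (simp_all add: vec_eq_iff algebra_simps)
    show ?thesis unfolding v(2) using hom_W[OF refl] v(1) by metis
  qed
  moreover have "\<exists>w w'. lin p w w' \<noteq> 0"
  proof -
    obtain w where w: "jet 1 ?X w \<noteq> 0" using field_multiplicity_one_imp[OF fr wp X(1)] by blast
    define W where W: "W = w $ 1 *s e + w $ 2 *s f"
    obtain A B C where abc: "\<And>t. \<omega> (p + t *s W) \<star> e = poly A t" "\<And>t. \<omega> (p + t *s W) \<star> f = poly B t"
      "\<And>t. \<omega> (p + t *s W) \<star> p = poly C t"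
      by (rule chart_polys[of p W e f]) blast
    have "jet 1 ?X w = vector [lin p W f, - lin p W e]"
      using jet_chart_field[OF W abc(1-3), of 1] coeffs_low[OF W abc(1-3)] wp
      by (simp add: vec_eq_iff forall_2 star_simps)
    then show ?thesis using w by (auto simp: vec_eq_iff forall_2)
  qed
  ultimately have "radial_at p" unfolding radial_at_def using wp by blast
  then show ?thesis using that p s by blast
qed

text \<open>Invariance along \<open>p\<close> makes \<open>C\<close> a monomial of degree
  \<open>d + 1\<close>, so the determinants vanish below order \<open>d\<close>;
  \<open>form_star_nonzero\<close> keeps the one of order \<open>d\<close> from vanishing
  identically.\<close>

lemma radial_at_imp:
  assumes p: "p \<noteq> 0" and r: "radial_at p"
  shows "radial_singularity \<omega> (vec.span {p}) (d - 1)"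
proof -
  obtain e f where fr: "frame p e f" by (rule frame_extend_point[OF p])
  let ?X = "chart_field \<omega> p e f"
  have wp: "\<omega> p = 0" and inv: "\<And>v x. \<omega> (v + x *s p) \<star> p = \<omega> v \<star> p"
    using r unfolding radial_at_def by auto
  have X: "defining_field \<omega> (vec.span {p}) ?X"
    unfolding defining_field_def affine_frame_def using fr unfolding frame_def by blast
  have jet0: "jet 0 ?X w = 0" and jet1: "jet 1 ?X w = vector [lin p (w $ 1 *s e + w $ 2 *s f) f, - lin p (w $ 1 *s e + w $ 2 *s f) e]"
    and det: "det (vector [jet k ?X w, w]) = (if k < d then 0 else - (\<omega> (w $ 1 *s e + w $ 2 *s f) \<star> p))" for k w
  proof -
    define W where W: "W = w $ 1 *s e + w $ 2 *s f"
    obtain A B C where abc: "\<And>t. \<omega> (p + t *s W) \<star> e = poly A t" "\<And>t. \<omega> (p + t *s W) \<star> f = poly B t"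
      "\<And>t. \<omega> (p + t *s W) \<star> p = poly C t"
      by (rule chart_polys[of p W e f]) blast
    note j = jet_chart_field[OF W abc(1-3)] coeffs_low[OF W abc(1-3)]
    show "jet 0 ?X w = 0" using j(1,2)[of 0] j(3,4) wp by (simp add: vec_eq_iff forall_2 star_simps)
    show "jet 1 ?X w = vector [lin p (w $ 1 *s e + w $ 2 *s f) f, - lin p (w $ 1 *s e + w $ 2 *s f) e]"
      using j(1,2)[of 1] j(3-) wp by (simp add: vec_eq_iff forall_2 star_simps W)
    have "poly C t = t ^ Suc d * (\<omega> W \<star> p)" for t
      using inv[of "t *s W" 1] by (simp add: abc(3)[symmetric] add.commute scale star_simps)
    then have "C = monom (\<omega> W \<star> p) (Suc d)"
      by (intro poly_eq_poly_eq_iff[THEN iffD1] ext) (simp add: poly_monom)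
    then have "(\<Sum>i\<le>k. coeff C (Suc i)) = (\<Sum>i\<le>k. if i = d then \<omega> W \<star> p else 0)"
      by (intro sum.cong) auto
    then show "det (vector [jet k ?X w, w]) = (if k < d then 0 else - (\<omega> (w $ 1 *s e + w $ 2 *s f) \<star> p))"
      using det_jet[OF W abc(1-3), of k] by (auto simp: W)
  qed
  have mult: "field_multiplicity ?X = 1"
    unfolding field_multiplicity_def
  proof (rule Least_equality)
    obtain v v' where vv: "lin p v v' \<noteq> 0" using r unfolding radial_at_def by blast
    obtain x u z where v: "v = x *s p + u *s e + z *s f" by (rule frame_coords[OF fr])
    obtain x' u' z' where v': "v' = x' *s p + u' *s e + z' *s f" by (rule frame_coords[OF fr])
    let ?w = "vector [u, z] :: complex ^ 2"
    have "jet 1 ?X ?w \<noteq> 0"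
    proof
      assume "jet 1 ?X ?w = 0"
      then have "lin p (u *s e + z *s f) f = 0" "lin p (u *s e + z *s f) e = 0"
        unfolding jet1 by (simp_all add: vec_eq_iff forall_2 del: lin_simps)
      then have "lin p v v' = 0" unfolding v v'
        using lin_base_left[OF wp] lin_base_right[of p] wp
        by (simp add: star_simps)
      then show False using vv by simp
    qed
    then show "\<exists>w. jet 1 ?X w \<noteq> 0" ..
    fix k assume "\<exists>w. jet k ?X w \<noteq> 0"
    then show "1 \<le> k" using jet0 by (cases k) auto
  qed
  have "field_tangency_order ?X = d"
    unfolding field_tangency_order_def mult
  proof (rule Least_equality)
    obtain v where v: "\<omega> v \<star> p \<noteq> 0" by (rule form_star_nonzero[OF p])
    obtain x u z where c: "v = x *s p + u *s e + z *s f" by (rule frame_coords[OF fr])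
    have "v = (u *s e + z *s f) + x *s p" unfolding c by (simp add: add_ac)
    then have "\<omega> (u *s e + z *s f) \<star> p \<noteq> 0" using v inv by metis
    then have "det (vector [jet d ?X (vector [u, z]), vector [u, z]]) \<noteq> 0"
      unfolding det by simp
    then show "1 \<le> d \<and> (\<exists>w. det (vector [jet d ?X w, w]) \<noteq> 0)" using d2 by auto
    show "d \<le> k" if "1 \<le> k \<and> (\<exists>w. det (vector [jet k ?X w, w]) \<noteq> 0)" for k
      using that unfolding det by (auto simp: not_less split: if_splits)
  qed
  then show ?thesis unfolding radial_singularity_def
    using X mult d2 singular_point_iff[OF p] wp by auto
qed

end

section \<open>Counting roots with a Wronskian\<close>

lemma sum_order_eq_degree:
  fixes p :: "complex poly"
  assumes "p \<noteq> 0"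
  shows "(\<Sum>x | poly p x = 0. order x p) = degree p"
proof -
  have "degree p = sum (count (proots p)) (set_mset (proots p))"
    by (simp only: size_proots_complex[symmetric] size_multiset_overloaded_eq)
  also have "\<dots> = (\<Sum>x | poly p x = 0. order x p)"
    using assms by simp
  finally show ?thesis ..
qed

definition wronskian :: "complex poly \<Rightarrow> complex poly \<Rightarrow> complex poly" where
  "wronskian h q = h * pderiv q - q * pderiv h"

text \<open>All members \<open>h + k q\<close> of the pencil have the same Wronskian with
  \<open>q\<close>, so a single polynomial records the multiple roots of each of them.\<close>

lemma wronskian_add_smult: "wronskian (h + smult k q) q = wronskian h q"
  by (simp add: wronskian_def pderiv_add pderiv_smult algebra_simps)

lemma reduce_degree:
  fixes h q :: "complex poly"
  assumes "degree h \<le> d" "degree q = d" "0 < d"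
  obtains k where "degree (h - smult k q) < d"
proof -
  let ?r = "h - smult (coeff h d / coeff q d) q"
  have "q \<noteq> 0" using assms by auto
  then have "coeff ?r d = 0" using assms(2) by auto
  moreover have "degree ?r \<le> d" using assms by (intro degree_diff_le) auto
  ultimately have "degree ?r < d"
    using assms(3) by (metis degree_0 le_neq_implies_less leading_coeff_0_iff)
  then show ?thesis by (rule that)
qed

text \<open>Replacing \<open>h\<close> by a member of degree below \<open>d\<close> leaves the
  Wronskian unchanged and saves one degree over the obvious bound \<open>2 d - 1\<close>.\<close>

lemma wronskian_degree:
  assumes "degree h \<le> d" "degree q = d" "0 < d"
  shows "degree (wronskian h q) \<le> 2 * d - 2"
proof -
  obtain k where k: "degree (h - smult k q) < d" by (rule reduce_degree[OF assms])
  let ?r = "h - smult k q"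
  have "wronskian h q = wronskian ?r q" using wronskian_add_smult[of ?r k q] by simp
  moreover have "degree (wronskian ?r q) \<le> 2 * d - 2"
  \<comment> \<open>For a constant the subtraction in \<open>degree ?r - 1\<close> is truncated, so
    the degree estimate has to be made separately.\<close>
  proof (cases "degree ?r = 0")
    case True
    then have "pderiv ?r = 0" by (metis pderiv_eq_0_iff)
    then have "degree (wronskian ?r q) \<le> degree ?r + degree (pderiv q)"
      unfolding wronskian_def by (simp add: degree_mult_le)
    then show ?thesis using True assms by (simp add: degree_pderiv)
  next
    case False
    have "degree (?r * pderiv q) \<le> degree ?r + degree (pderiv q)"
      "degree (q * pderiv ?r) \<le> degree q + degree (pderiv ?r)" by (rule degree_mult_le)+
    then show ?thesis unfolding wronskian_def using k False assms
      by (intro degree_diff_le) (auto simp: degree_pderiv)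
  qed
  ultimately show ?thesis by simp
qed

text \<open>If the reduced member \<open>?r\<close> were non-zero, the leading coefficients of
  \<open>?r q'\<close> and \<open>q ?r'\<close> would give \<open>d = degree ?r\<close>.\<close>

lemma wronskian_eq_0:
  assumes "degree h \<le> d" "degree q = d" "0 < d" "wronskian h q = 0"
  obtains k where "h = smult k q"
proof -
  obtain k where k: "degree (h - smult k q) < d" by (rule reduce_degree[OF assms(1-3)])
  let ?r = "h - smult k q"
  have w: "wronskian ?r q = 0" using wronskian_add_smult[of ?r k q] assms(4) by simp
  have "?r = 0"
  proof (rule ccontr)
    assume r: "?r \<noteq> 0"
    have lc: "lead_coeff (pderiv p) = of_nat (degree p) * lead_coeff p" for p :: "complex poly"
    proof (cases "degree p")
      case 0
      then have "pderiv p = 0" by (simp add: pderiv_eq_0_iff)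
      then show ?thesis using 0 by simp
    next
      case (Suc n)
      then show ?thesis by (simp add: degree_pderiv coeff_pderiv)
    qed
    have "lead_coeff (?r * pderiv q) = lead_coeff (q * pderiv ?r)" using w unfolding wronskian_def by simp
    then have "lead_coeff ?r * (of_nat d * lead_coeff q) = lead_coeff q * (of_nat (degree ?r) * lead_coeff ?r)"
      unfolding lead_coeff_mult lc assms(2) .
    moreover have "lead_coeff q \<noteq> 0" "lead_coeff ?r \<noteq> 0" using assms r
      by (auto simp del: coeff_diff)
    ultimately have "(of_nat d :: complex) = of_nat (degree ?r)" by (simp only: mult.commute mult.left_commute mult_cancel_left) simp
    then show False using k by (simp only: of_nat_eq_iff)
  qed
  then show ?thesis using that by simp
qed

lemma power_dvd_wronskian:
  assumes "[:- c, 1:] ^ r dvd h + smult k q"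
  shows "[:- c, 1:] ^ (r - 1) dvd wronskian h q"
proof (cases r)
  case (Suc n)
  let ?H = "h + smult k q" and ?l = "[:- c, 1:]"
  obtain G where G: "?H = ?l ^ Suc n * G" using assms Suc by (auto elim: dvdE)
  have "pderiv ?H = ?l ^ n * (?l * pderiv G + smult (of_nat (Suc n)) G)"
    unfolding G pderiv_mult pderiv_power_Suc by (simp add: pderiv_pCons algebra_simps)
  then have "?l ^ n dvd pderiv ?H" by simp
  moreover have "?l ^ n dvd ?H" unfolding G power_Suc2 by (simp only: mult.assoc dvd_triv_left)
  ultimately have "?l ^ n dvd wronskian ?H q" unfolding wronskian_def by auto
  then show ?thesis using Suc wronskian_add_smult by simp
qed simp

text \<open>Lagrange interpolation of \<open>q\<close> at the simple roots of \<open>P\<close>,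
  compared in degree \<open>n\<close>.\<close>

lemma sum_lagrange:
  fixes P q :: "complex poly"
  assumes "degree P = Suc n" "card {c. poly P c = 0} = Suc n" "degree q \<le> n"
  shows "(\<Sum>c | poly P c = 0. poly q c / poly (pderiv P) c) * lead_coeff P = coeff q n"
proof -
  define R where "R = {c. poly P c = 0}"
  define a where "a = lead_coeff P"
  have P0: "P \<noteq> 0" using assms(1) by auto
  have fin: "finite R" unfolding R_def using P0 by (rule poly_roots_finite)
  have P: "P = smult a (\<Prod>c\<in>R. [:- c, 1:])"
  proof (rule poly_eqI_degree_lead_coeff[where A = R and n = "Suc n"])
    have deg: "degree (\<Prod>c\<in>R. [:- c, 1:]) = Suc n"
      using assms(2) by (subst degree_prod_eq_sum_degree) (auto simp: R_def)
    moreover have "lead_coeff (\<Prod>c\<in>R. [:- c, 1:]) = 1"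
      by (simp add: lead_coeff_prod)
    ultimately show "coeff P (Suc n) = coeff (smult a (\<Prod>c\<in>R. [:- c, 1:])) (Suc n)"
      by (simp add: a_def assms(1))
    show "degree (smult a (\<Prod>c\<in>R. [:- c, 1:])) \<le> Suc n"
      using deg degree_smult_le by metis
    show "poly P z = poly (smult a (\<Prod>c\<in>R. [:- c, 1:])) z" if "z \<in> R" for z
      using that fin by (auto simp: R_def poly_prod)
  qed (use assms in \<open>auto simp: R_def\<close>)
  have dP: "poly (pderiv P) c = a * (\<Prod>c'\<in>R - {c}. c - c')" if "c \<in> R" for c
  proof -
    have "poly (pderiv P) c = a * (\<Sum>b\<in>R. (\<Prod>c'\<in>R - {b}. c - c'))"
      by (subst P) (simp add: pderiv_smult pderiv_prod poly_sum poly_prod pderiv_pCons)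
    also have "(\<Sum>b\<in>R. (\<Prod>c'\<in>R - {b}. c - c')) = (\<Sum>b\<in>R. if b = c then (\<Prod>c'\<in>R - {c}. c - c') else 0)"
      using that fin by (intro sum.cong refl) auto
    finally show ?thesis using that fin by simp
  qed
  have dnz: "poly (pderiv P) c \<noteq> 0" if "c \<in> R" for c
    using dP[OF that] fin P0 by (auto simp: a_def)
  \<comment> \<open>The interpolation basis: \<open>B c\<close> vanishes at the other roots, and
    \<open>a\<close> times its value at \<open>c\<close> is the derivative of \<open>P\<close>
    there.\<close>
  define B where "B c = (\<Prod>c'\<in>R - {c}. [:- c', 1:])" for c
  define L where "L = (\<Sum>c\<in>R. smult (poly q c / poly (pderiv P) c * a) (B c))"
  have degB: "degree (B c) = n" if "c \<in> R" for c
    unfolding B_def using that assms(2) fin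
    by (subst degree_prod_eq_sum_degree) (auto simp: R_def)
  have qL: "q = L"
  proof (rule poly_eqI_degree[where A = R])
    show "poly q c = poly L c" if "c \<in> R" for c
    proof -
      have "poly L c = (\<Sum>b\<in>R. poly q b / poly (pderiv P) b * a * poly (B b) c)"
        by (simp add: L_def poly_sum)
      also have "\<dots> = (\<Sum>b\<in>R. if b = c then poly q c else 0)"
      proof (intro sum.cong refl)
        fix b assume "b \<in> R"
        show "poly q b / poly (pderiv P) b * a * poly (B b) c = (if b = c then poly q c else 0)"
        proof (cases "b = c")
          case True
          have "a * poly (B c) c = poly (pderiv P) c" using dP[OF that] by (simp add: B_def poly_prod)
          then show ?thesis using True dnz[OF that] by (simp add: mult.assoc)
        next
          case False
          then have "poly (B b) c = 0" using that fin by (auto simp: B_def poly_prod)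
          then show ?thesis using False by simp
        qed
      qed
      finally show ?thesis using that fin by simp
    qed
    have "degree L \<le> n" unfolding L_def
      using degB by (intro degree_sum_le fin) (auto intro: order_trans[OF degree_smult_le])
    then show "degree L < card R" "degree q < card R" using assms by (auto simp: R_def)
  qed
  have "coeff q n = (\<Sum>c\<in>R. poly q c / poly (pderiv P) c * a * coeff (B c) n)"
    by (subst qL) (simp add: L_def coeff_sum)
  also have "\<dots> = (\<Sum>c\<in>R. poly q c / poly (pderiv P) c * a)"
  proof (intro sum.cong refl)
    fix c assume "c \<in> R"
    have "lead_coeff (B c) = 1" by (simp add: B_def lead_coeff_prod)
    then show "poly q c / poly (pderiv P) c * a * coeff (B c) n = poly q c / poly (pderiv P) c * a"
      using degB[OF \<open>c \<in> R\<close>] by simp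
  qed
  finally show ?thesis by (simp add: sum_distrib_right R_def a_def)
qed

text \<open>For the points of an invariant line with parameter \<open>c\<close>, \<open>r c\<close> will be the number of further
  invariant lines through the point.\<close>

locale pencil_count =
  fixes d :: nat and q h :: "complex poly" and r :: "complex \<Rightarrow> nat" and P
  assumes d2: "2 \<le> d" and deg_q: "degree q = d" and deg_h: "degree h \<le> d"
    and P_def: "P = [:0, 1:] * q + h"
    and r_dvd: "\<And>c. [:- c, 1:] ^ r c dvd h + smult c q"
    and r_le: "\<And>c. r c \<le> d"
begin

lemma P_shift: "P = [:- c, 1:] * q + (h + smult c q)"
  by (simp add: P_def)

lemma q_nz: "q \<noteq> 0" using deg_q d2 by auto

lemma degree_P: "degree P = Suc d" and lead_coeff_P: "lead_coeff P = coeff q d"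
proof -
  have "degree (pCons 0 q) = Suc d" using q_nz deg_q by simp
  then show "degree P = Suc d" unfolding P_def using deg_h by (simp add: degree_add_eq_left)
  then show "lead_coeff P = coeff q d" using deg_h by (simp add: P_def coeff_eq_0)
qed

lemma P_nz: "P \<noteq> 0" using degree_P by auto

abbreviation "W \<equiv> wronskian h q"

text \<open>One factor \<open>x - c\<close> comes from \<open>P\<close>, the other
  \<open>r c - 1\<close> from the Wronskian.\<close>

lemma dvd_mult_W:
  assumes "poly P c = 0"
  shows "[:- c, 1:] ^ r c dvd P * W"
proof (cases "r c")
  case (Suc n)
  have "[:- c, 1:] dvd P" using assms by (simp add: poly_eq_0_iff_dvd)
  moreover have "[:- c, 1:] ^ n dvd W" using power_dvd_wronskian[OF r_dvd[of c]] Suc by simp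
  ultimately show ?thesis using Suc by (simp add: mult_dvd_mono del: mult_pCons_left)
qed simp

text \<open>Here \<open>h = k q\<close>, so the pencil member is \<open>(k + c) q\<close>. For
  \<open>c \<noteq> - k\<close> the count is at most the order of a root of \<open>q\<close>, in
  total at most \<open>d\<close>; the exceptional value adds at most \<open>d\<close>.\<close>

lemma sum_bound_degenerate:
  assumes "W = 0"
  shows "(\<Sum>c | poly P c = 0. r c) \<le> 2 * d"
proof -
  obtain k where k: "h = smult k q" using wronskian_eq_0[OF deg_h deg_q _ assms] d2 by auto
  let ?R = "{c. poly P c = 0}"
  have fin: "finite ?R" using P_nz by (rule poly_roots_finite)
  have *: "r c \<le> order c q" if "c \<noteq> - k" for c
  proof -
    have "k + c \<noteq> 0" using that by (metis add_eq_0_iff2 add.commute)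
    moreover have "[:- c, 1:] ^ r c dvd smult (k + c) q" using r_dvd[of c] k by (simp add: smult_add_left)
    ultimately have "[:- c, 1:] ^ r c dvd q" by (simp add: dvd_smult_iff)
    then show ?thesis using q_nz order_divides by blast
  qed
  have "(\<Sum>c\<in>?R. r c) \<le> (\<Sum>c\<in>insert (- k) ?R. r c)" using fin by (intro sum_mono2) auto
  also have "\<dots> = r (- k) + (\<Sum>c\<in>?R - {- k}. r c)" using fin by (simp add: sum.insert_remove)
  also have "(\<Sum>c\<in>?R - {- k}. r c) \<le> (\<Sum>c\<in>?R - {- k}. order c q)" using * by (intro sum_mono) auto
  also have "(\<Sum>c\<in>?R - {- k}. order c q) \<le> (\<Sum>c | poly q c = 0. order c q)"
  proof (rule sum_le_included[where i = id])
    show "\<forall>c\<in>?R - {- k}. \<exists>b\<in>{c. poly q c = 0}. id b = c \<and> order c q \<le> order b q"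
    proof
      fix c assume c: "c \<in> ?R - {- k}"
      then have "(c + k) * poly q c = 0" by (simp add: P_def k algebra_simps)
      then show "\<exists>b\<in>{c. poly q c = 0}. id b = c \<and> order c q \<le> order b q"
        using c by (auto simp: add_eq_0_iff2)
    qed
  qed (use fin q_nz poly_roots_finite in auto)
  also have "\<dots> \<le> degree q" using sum_order_le_degree[OF q_nz] .
  finally show ?thesis using r_le[of "- k"] deg_q by simp
qed

lemma sum_order_bound:
  assumes "W \<noteq> 0"
  shows "(\<Sum>c | poly P c = 0. order c (P * W)) \<le> 3 * d - 1"
proof -
  have nz: "P * W \<noteq> 0" using assms P_nz by simp
  have "(\<Sum>c | poly P c = 0. order c (P * W)) \<le> (\<Sum>c | poly (P * W) c = 0. order c (P * W))"
    using poly_roots_finite[OF nz] by (intro sum_mono2) auto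
  also have "\<dots> \<le> degree (P * W)" by (rule sum_order_le_degree[OF nz])
  also have "\<dots> \<le> Suc d + (2 * d - 2)"
    using degree_mult_le[of P W] degree_P wronskian_degree[OF deg_h deg_q] d2 by simp
  finally show ?thesis using d2 by simp
qed

lemma r_le_order:
  assumes "W \<noteq> 0" "poly P c = 0"
  shows "r c \<le> order c (P * W)"
  using dvd_mult_W[OF assms(2)] assms(1) P_nz order_divides[of c "r c" "P * W"] by auto

text \<open>With the carrying line added, this becomes the bound \<open>3 d\<close> on the number of
  invariant lines.\<close>

theorem sum_bound: "(\<Sum>c | poly P c = 0. r c) \<le> 3 * d - 1"
proof (cases "W = 0")
  case True
  then show ?thesis using sum_bound_degenerate d2 by simp
next
  case False
  have "(\<Sum>c | poly P c = 0. r c) \<le> (\<Sum>c | poly P c = 0. order c (P * W))"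
    using r_le_order[OF False] by (intro sum_mono) auto
  then show ?thesis using sum_order_bound[OF False] by simp
qed

section \<open>The case of equality\<close>

context
  assumes extremal: "(\<Sum>c | poly P c = 0. r c) = 3 * d - 1"
begin

lemma W_nz: "W \<noteq> 0"
  using sum_bound_degenerate extremal d2 by auto

lemma r_eq_order:
  assumes "poly P c = 0"
  shows "r c = order c (P * W)"
proof (rule ccontr)
  assume "r c \<noteq> order c (P * W)"
  then have "r c < order c (P * W)" using r_le_order[OF W_nz assms] by simp
  then have "(\<Sum>c | poly P c = 0. r c) < (\<Sum>c | poly P c = 0. order c (P * W))"
    using r_le_order[OF W_nz] assms poly_roots_finite[OF P_nz] by (intro sum_strict_mono_ex1) auto
  then show False using sum_order_bound[OF W_nz] extremal by simp
qed

text \<open>Equality gives \<open>r c = order c P + order c W\<close>; the first summand is at least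
  \<open>1\<close> and the second at least \<open>r c - 1\<close>, so both bounds are sharp.\<close>

lemma extremal_orders:
  assumes "poly P c = 0"
  shows "order c P = 1" "r c = Suc (order c W)"
proof -
  have "r c = order c P + order c W"
    using r_eq_order[OF assms] order_mult[of P W c] P_nz W_nz by simp
  moreover have "order c P \<noteq> 0" using assms P_nz order_root by metis
  moreover have "r c - 1 \<le> order c W"
    using power_dvd_wronskian[OF r_dvd[of c]] W_nz order_divides by blast
  ultimately show "order c P = 1" "r c = Suc (order c W)" by linarith+
qed

lemma card_roots: "card {c. poly P c = 0} = Suc d"
proof -
  have "(\<Sum>c | poly P c = 0. order c P) = (\<Sum>c | poly P c = 0. 1)"
    using extremal_orders(1) by (intro sum.cong) auto
  then show ?thesis using sum_order_eq_degree[OF P_nz] degree_P by simp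
qed

lemma pderiv_P_nz:
  assumes "poly P c = 0"
  shows "poly (pderiv P) c \<noteq> 0"
proof
  assume *: "poly (pderiv P) c = 0"
  have "[:- c, 1:] dvd P" using assms by (simp only: poly_eq_0_iff_dvd)
  then obtain G where G: "P = [:- c, 1:] * G" by (rule dvdE)
  have "poly G c = 0" using * unfolding G pderiv_mult by (simp add: pderiv_pCons)
  then have "[:- c, 1:] dvd G" by (simp only: poly_eq_0_iff_dvd)
  then obtain G' where G': "G = [:- c, 1:] * G'" by (rule dvdE)
  have "[:- c, 1:] ^ 2 dvd P"
    unfolding G G' power2_eq_square mult.assoc[symmetric] by (rule dvd_triv_left)
  then show False using order_divides[of c 2 P] P_nz extremal_orders(1)[OF assms] by simp
qed

text \<open>Modulo the square of \<open>x - c\<close>, \<open>P\<close> equals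
  \<open>(x - c) q\<close>. This yields index 1 at points on at least two further lines.\<close>

lemma r_ge_2_imp:
  assumes "2 \<le> r c"
  shows "poly (pderiv P) c = poly q c"
proof -
  have "[:- c, 1:] ^ 2 dvd h + smult c q" using r_dvd[of c] assms by (rule power_le_dvd)
  then obtain G where "h + smult c q = [:- c, 1:] ^ 2 * G" by (rule dvdE)
  then have P: "P = [:- c, 1:] * q + [:- c, 1:] ^ 2 * G" using P_shift[of c] by simp
  show ?thesis unfolding P pderiv_add pderiv_mult power2_eq_square by (simp add: pderiv_pCons)
qed

text \<open>If \<open>r c = 1\<close>, the Wronskian is non-zero at \<open>c\<close>, whereas a
  common root of \<open>q\<close> and \<open>P\<close> would be a root of \<open>h\<close> and hence
  of the Wronskian.\<close>

lemma q_root_nz: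
  assumes "poly P c = 0"
  shows "poly q c \<noteq> 0"
proof (cases "2 \<le> r c")
  case True
  then show ?thesis using r_ge_2_imp pderiv_P_nz[OF assms] by simp
next
  case False
  then have "order c W = 0" using extremal_orders(2)[OF assms] by simp
  then have "poly W c \<noteq> 0" using order_root W_nz by blast
  then show ?thesis using assms by (auto simp: wronskian_def P_def)
qed

text \<open>The Camacho-Sad formula for a line, whose self-intersection is 1. It is
  \<open>sum_lagrange\<close>, as \<open>P\<close> and \<open>q\<close> have the same leading
  coefficient.\<close>

lemma sum_index: "(\<Sum>c | poly P c = 0. poly q c / poly (pderiv P) c) = 1"
proof -
  have "coeff q d \<noteq> 0" using q_nz deg_q by auto
  moreover have "(\<Sum>c | poly P c = 0. poly q c / poly (pderiv P) c) * coeff q d = coeff q d"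
    using sum_lagrange[OF degree_P card_roots, of q] deg_q unfolding lead_coeff_P by simp
  ultimately show ?thesis by simp
qed

end

end

section \<open>Invariant lines meeting a given invariant line\<close>

text \<open>Only terms linear in \<open>v\<close> survive. The factor \<open>1 ^ i\<close> matches
  the instance \<open>x = 1\<close> of \<open>hom_poly_expand\<close>.\<close>

lemma expansion_normal_derivative:
  "((\<lambda>v. \<Sum>i\<le>n. \<Sum>j\<le>n - i. c i j * 1 ^ i * u ^ j * v ^ (n - i - j)) has_field_derivative
    poly (\<Sum>i\<le>n. \<Sum>j\<le>n - i. monom (c i j * (if n - i - j = 1 then 1 else 0)) j) u) (at (0::complex))"
proof -
  have pw: "((\<lambda>v. v ^ k) has_field_derivative (if k = 1 then 1 else 0)) (at (0::complex))" for k
    by (rule derivative_eq_intros refl)+ (auto simp: power_0_left)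
  have "((\<lambda>v. \<Sum>i\<le>n. \<Sum>j\<le>n - i. c i j * 1 ^ i * u ^ j * v ^ (n - i - j)) has_field_derivative
      (\<Sum>i\<le>n. \<Sum>j\<le>n - i. c i j * 1 ^ i * u ^ j * (if n - i - j = 1 then 1 else 0))) (at 0)"
    by (intro DERIV_sum DERIV_cmult pw)
  then show ?thesis by (simp add: poly_sum poly_monom mult_ac)
qed

context foliation_form
begin

lemma normal_derivative_poly:
  obtains N where "degree N \<le> d" "\<And>u. lin (p + u *s e) f w = poly N u"
proof -
  let ?n = "Suc d"
  obtain c where c: "\<And>x u v. \<omega> (x *s p + u *s e + v *s f) \<star> w =
    (\<Sum>i\<le>?n. \<Sum>j\<le>?n - i. c i j * x ^ i * u ^ j * v ^ (?n - i - j))"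
    using hom_poly_expand[OF hom_star] by blast
  define K where "K i j = c i j * (if ?n - i - j = 1 then 1 else 0)" for i j
  define N where "N = (\<Sum>i\<le>?n. \<Sum>j\<le>?n - i. monom (K i j) j)"
  have "degree N \<le> d" unfolding N_def
  proof (intro degree_sum_le)
    fix i j assume "i \<in> {..?n}" "j \<in> {..?n - i}"
    show "degree (monom (K i j) j) \<le> d"
      by (cases "?n - i - j = 1") (auto simp: K_def intro: order_trans[OF degree_monom_le])
  qed auto
  moreover have "lin (p + u *s e) f w = poly N u" for u
    using expansion_normal_derivative[of c u ?n] c[of 1 u]
    by (intro lin_eqI) (simp add: N_def K_def)
  ultimately show ?thesis by (rule that)
qed

text \<open>Sort \<open>\<omega> \<star> p\<close> by powers of \<open>x\<close>: the coefficient of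
  \<open>x ^ i\<close> is homogeneous of degree \<open>d + 1 - i\<close> in \<open>(u, v)\<close>,
  and \<open>g i\<close> is its value at \<open>v = 1\<close>. Invariance of the line through
  \<open>[p]\<close> and \<open>[e]\<close> removes the top power of \<open>u\<close>, and each
  slope in \<open>T\<close> is a root, so \<open>g i = 0\<close> once
  \<open>d + 1 - i \<le> card T\<close>. The three claims read off what is left.\<close>

lemma lines_through_point:
  assumes fr: "frame p e f" and inv: "invariant_line \<omega> (vec.span {p, e})" and T: "finite T"
    and invT: "\<And>t. t \<in> T \<Longrightarrow> invariant_line \<omega> (vec.span {p, f + t *s e})"
  shows "card T \<le> d"
    and "card T = d \<Longrightarrow> \<omega> (v + x *s p) \<star> p = \<omega> v \<star> p"
    and "(\<And>u. lin (p + u *s e) f p = poly N u) \<Longrightarrow> [:0, 1:] ^ card T dvd N"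
proof -
  let ?n = "Suc d"
  obtain c where c: "\<And>x u v. \<omega> (x *s p + u *s e + v *s f) \<star> p =
    (\<Sum>i\<le>?n. \<Sum>j\<le>?n - i. c i j * x ^ i * u ^ j * v ^ (?n - i - j))"
    using hom_poly_expand[OF hom_star] by blast
  define g where "g i = (\<Sum>j\<le>?n - i. monom (c i j) j)" for i
  have coeff_g: "coeff (g i) j = (if j \<le> ?n - i then c i j else 0)" for i j
    by (simp add: g_def coeff_sum)
  have top: "c i (?n - i) = 0" if "i \<le> ?n" for i
  proof (rule zero_polynom_imp_zero_coeffs[OF _ that])
    fix x
    have "\<omega> (x *s p + 1 *s e) \<star> p = 0"
      using inv invariant_line_span_iff[OF fr] by blast
    then have "0 = \<omega> (x *s p + 1 *s e + 0 *s f) \<star> p" by simp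
    also have "\<dots> = (\<Sum>i\<le>?n. \<Sum>j\<le>?n - i. if j = ?n - i then c i j * x ^ i else 0)"
      unfolding c by (intro sum.cong) (auto simp: power_0_left)
    finally show "(\<Sum>i\<le>?n. c i (?n - i) * x ^ i) = 0" by simp
  qed
  have root: "poly (g i) t = 0" if "t \<in> T" "i \<le> ?n" for t i
  proof (rule zero_polynom_imp_zero_coeffs[OF _ that(2)])
    fix x
    have "x *s p + 1 *s (f + t *s e) \<in> vec.span {p, f + t *s e}" unfolding vec_span_2 by blast
    then have "x *s p + t *s e + 1 *s f \<in> vec.span {p, f + t *s e}" by (simp add: add_ac)
    moreover have "p \<in> vec.span {p, f + t *s e}" by (simp add: vec.span_base)
    ultimately have "\<omega> (x *s p + t *s e + 1 *s f) \<star> p = 0"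
      using invT[OF that(1)] unfolding invariant_line_def by simp
    then show "(\<Sum>i\<le>?n. poly (g i) t * x ^ i) = 0"
      unfolding c by (simp add: g_def poly_sum poly_monom sum_distrib_left mult_ac)
  qed
  have vanish: "c i j = 0" if "i \<le> ?n" "j \<le> ?n - i" "?n - i \<le> card T" for i j
  proof -
    have "g i = 0"
    proof (rule ccontr)
      assume nz: "g i \<noteq> 0"
      have "degree (g i) \<le> ?n - i" by (rule degree_le) (simp add: coeff_g)
      moreover have "coeff (g i) (?n - i) = 0" using top[OF that(1)] coeff_g by simp
      ultimately have "degree (g i) < ?n - i" using nz by (metis le_neq_implies_less leading_coeff_0_iff)
      moreover have "card T \<le> card {t. poly (g i) t = 0}"
        using root that(1) nz by (intro card_mono poly_roots_finite) auto
      ultimately show False using card_poly_roots_bound[OF nz] that(3) by simp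
    qed
    then show ?thesis using coeff_g[of i j] that(2) by simp
  qed
  show "card T \<le> d"
  proof (rule ccontr)
    assume "\<not> ?thesis"
    then have all0: "\<omega> (x *s p + u *s e + v *s f) \<star> p = 0" for x u v
      unfolding c by (intro sum.neutral ballI) (simp add: vanish)
    have "p \<noteq> 0" using fr frame_iff by blast
    then obtain v where "\<omega> v \<star> p \<noteq> 0" by (rule form_star_nonzero)
    moreover obtain x u w where "v = x *s p + u *s e + w *s f" by (rule frame_coords[OF fr])
    ultimately show False using all0 by simp
  qed
  show "\<omega> (v + x *s p) \<star> p = \<omega> v \<star> p" if "card T = d"
  proof -
    obtain y u w where v: "v = y *s p + u *s e + w *s f" by (rule frame_coords[OF fr])
    have *: "\<omega> (x *s p + u *s e + w *s f) \<star> p = (\<Sum>j\<le>?n. c 0 j * u ^ j * w ^ (?n - j))" for x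
    proof -
      have "\<omega> (x *s p + u *s e + w *s f) \<star> p =
          (\<Sum>i\<le>?n. if i = 0 then \<Sum>j\<le>?n. c 0 j * u ^ j * w ^ (?n - j) else 0)"
        unfolding c
      proof (intro sum.cong refl)
        fix i assume "i \<in> {..?n}"
        then show "(\<Sum>j\<le>?n - i. c i j * x ^ i * u ^ j * w ^ (?n - i - j)) =
            (if i = 0 then \<Sum>j\<le>?n. c 0 j * u ^ j * w ^ (?n - j) else 0)"
          using vanish[of i] that by (cases "i = 0") (auto intro!: sum.neutral)
      qed
      then show ?thesis by simp
    qed
    have "v + x *s p = (y + x) *s p + u *s e + w *s f" by (simp add: v vec_eq_iff algebra_simps)
    then show ?thesis using * v by metis
  qed
  show "[:0, 1:] ^ card T dvd N" if N: "\<And>u. lin (p + u *s e) f p = poly N u"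
  proof -
    define M where "M = (\<Sum>i\<le>?n. \<Sum>j\<le>?n - i. monom (c i j * (if ?n - i - j = 1 then 1 else 0)) j)"
    have "poly N u = poly M u" for u
      using lin_eqI[of "p + u *s e" f p] expansion_normal_derivative[of c u ?n] c[of 1 u]
      by (simp add: N[symmetric] M_def)
    then have "N = M" using poly_eq_poly_eq_iff by blast
    moreover have "[:0, 1:] ^ card T dvd M"
      unfolding M_def
    proof (intro dvd_sum)
      fix i j assume ij: "i \<in> {..?n}" "j \<in> {..?n - i}"
      show "[:0, 1:] ^ card T dvd monom (c i j * (if ?n - i - j = 1 then 1 else 0)) j"
      proof (cases "?n - i - j = 1 \<and> card T < ?n - i")
        case True
        \<comment> \<open>A surviving term that is linear in \<open>v\<close> has
          \<open>j = d - i\<close>, and survival means \<open>card T < d + 1 - i\<close>.\<close>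
        then have "card T \<le> j" by arith
        then have "[:0, 1::complex:] ^ card T dvd [:0, 1:] ^ j" by (rule le_imp_power_dvd)
        moreover have "monom a j = smult a ([:0, 1:] ^ j)" for a :: complex
          by (simp add: monom_altdef)
        ultimately show ?thesis by (simp add: dvd_smult)
      next
        case False
        then show ?thesis using vanish[of i j] ij by (auto simp: not_less)
      qed
    qed
    ultimately show ?thesis by simp
  qed
qed

end

lemma pcompose_power: "pcompose (p ^ n) q = pcompose p q ^ n"
  by (induction n) (simp_all add: pcompose_mult pcompose_1)

section \<open>Parametrising an invariant line and the pencils through its points\<close>

context foliation_form
begin

definition lines_through :: "(complex ^ 3) set \<Rightarrow> (complex ^ 3) set set" where
  "lines_through s = {l. invariant_line \<omega> l \<and> s \<subseteq> l}"

text \<open>A non-singular \<open>[e]\<close> is placed at the infinite parameter, so that all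
  singularities of the line, and all its intersections with other invariant lines, have finite
  parameters.\<close>

lemma nonsingular_point_on_line:
  assumes "proj_line l"
  obtains p e f where "frame p e f" "l = vec.span {p, e}" "\<omega> e \<noteq> 0"
proof -
  obtain p0 e0 where l: "p0 \<noteq> 0" "e0 \<notin> vec.span {p0}" "l = vec.span {p0, e0}"
    using assms proj_line_iff by blast
  obtain f0 where fr0: "frame p0 e0 f0" using frame_extend[OF l(1,2)] .
  have fr0': "frame f0 p0 e0" using fr0 frame_rotate by blast
  obtain \<tau> where "\<omega> (\<tau> *s p0 + e0) \<noteq> 0"
    using infinite_singularD[OF fr0', of "\<lambda>_. 0"] by auto
  moreover have "\<tau> *s p0 + e0 \<in> l" unfolding l vec_span_2 by (intro exI[of _ \<tau>] exI[of _ 1]) simp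
  moreover have "\<tau> *s p0 + e0 \<noteq> 0" using frame_indep(2)[OF fr0, of \<tau> 1 0] by auto
  ultimately obtain p f where "frame (\<tau> *s p0 + e0) p f" "l = vec.span {\<tau> *s p0 + e0, p}"
    using line_frame[OF assms] by metis
  then show ?thesis using that \<open>\<omega> (\<tau> *s p0 + e0) \<noteq> 0\<close>
    by (metis frame_rotate frame_swap insert_commute)
qed

context
  fixes p e f l
  assumes fr: "frame p e f" and l: "l = vec.span {p, e}" and inv: "invariant_line \<omega> l"
    and we: "\<omega> e \<noteq> 0"
begin

abbreviation (input) pt where "pt c \<equiv> p + c *s e"
abbreviation (input) ln where "ln c t \<equiv> vec.span {pt c, f + t *s e}"

lemma shifted_frame: "frame (pt c) e f"
proof (rule frameI)
  fix x u w assume "x *s pt c + u *s e + w *s f = 0"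
  then have "x *s p + (x * c + u) *s e + w *s f = 0" by (simp add: vec_eq_iff algebra_simps)
  from frame_indep[OF fr this] show "x = 0 \<and> u = 0 \<and> w = 0" by auto
qed

lemma pt_nz: "pt c \<noteq> 0" using shifted_frame frame_iff by blast

lemma l_shift: "l = vec.span {pt c, e}"
proof (rule line_eq_span)
  show "proj_line l" using inv unfolding invariant_line_def by blast
  show "pt c \<in> l" unfolding l vec_span_2 by (intro exI[of _ 1] exI[of _ c]) simp
  show "e \<in> l" unfolding l by (simp add: vec.span_base)
  show "pt c \<noteq> 0" by (rule pt_nz)
  show "e \<notin> vec.span {pt c}" using shifted_frame[of c] unfolding frame_iff by blast
qed

lemma pt_mem_ln: "pt c' \<in> ln c t \<longleftrightarrow> c' = c"
proof
  assume "pt c' \<in> ln c t"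
  then obtain x y where "pt c' = x *s pt c + y *s (f + t *s e)" unfolding vec_span_2 by blast
  then have "1 *s p + c' *s e + 0 *s f = x *s p + (x * c + y * t) *s e + y *s f"
    by (simp add: vec_eq_iff algebra_simps)
  from frame_unique[OF fr this] show "c' = c" by auto
qed (simp add: vec.span_base)

lemma ln_inject: "ln c t = ln c' t' \<longleftrightarrow> c = c' \<and> t = t'"
proof
  assume eq: "ln c t = ln c' t'"
  have c: "c = c'" using pt_mem_ln[of c c t] eq pt_mem_ln[of c c' t'] by simp
  have "f + t' *s e \<in> ln c t" unfolding eq by (simp add: vec.span_base)
  then obtain x y where "f + t' *s e = x *s pt c + y *s (f + t *s e)" unfolding vec_span_2 by blast
  then have "0 *s p + t' *s e + 1 *s f = x *s p + (x * c + y * t) *s e + y *s f"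
    by (simp add: vec_eq_iff algebra_simps)
  from frame_unique[OF fr this] show "c = c' \<and> t = t'" using c by auto
qed simp

lemma ln_neq_l: "ln c t \<noteq> l"
proof
  assume "ln c t = l"
  moreover have "pt (c + 1) \<in> l" unfolding l vec_span_2 by (intro exI[of _ 1] exI[of _ "c + 1"]) simp
  ultimately show False using pt_mem_ln[of "c + 1" c t] by simp
qed

text \<open>\<open>t\<close> is an affine coordinate on the pencil of lines through
  \<open>pt c\<close>, with \<open>l\<close> itself at infinity.\<close>

definition slopes where "slopes c = {t. invariant_line \<omega> (ln c t)}"

lemma finite_slopes: "finite (slopes c)"
proof (rule ccontr)
  assume "infinite (slopes c)"
  then obtain T where T: "T \<subseteq> slopes c" "finite T" "card T = Suc d"
    using infinite_arbitrarily_large by blast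
  then have "card T \<le> d"
    using inv l_shift[of c] by (intro lines_through_point(1)[OF shifted_frame]) (auto simp: slopes_def)
  then show False using T by simp
qed

lemma slopes_point:
  shows "card (slopes c) \<le> d"
    and "card (slopes c) = d \<Longrightarrow> \<omega> (v + x *s pt c) \<star> pt c = \<omega> v \<star> pt c"
    and "(\<And>u. lin (pt c + u *s e) f (pt c) = poly N u) \<Longrightarrow> [:0, 1:] ^ card (slopes c) dvd N"
  using lines_through_point[OF shifted_frame[of c] _ finite_slopes[of c]] inv l_shift[of c]
  by (auto simp: slopes_def)

text \<open>No second invariant line passes through the non-singular point \<open>[e]\<close>, so
  \<open>line_cases\<close> applies.\<close>

lemma other_line_cases:
  assumes "invariant_line \<omega> l'" "l' \<noteq> l"
  obtains c t where "l' = ln c t" "t \<in> slopes c" "\<omega> (pt c) = 0"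
proof -
  have "e \<notin> l'"
  proof
    assume "e \<in> l'"
    moreover have "e \<in> l" unfolding l by (simp add: vec.span_base)
    ultimately show False using invariant_lines_meet[OF inv assms(1)] assms(2) we by blast
  qed
  then obtain c t where ct: "l' = ln c t"
    using line_cases[OF fr, of l'] assms l unfolding invariant_line_def by metis
  moreover have "\<omega> (pt c) = 0"
  proof (rule invariant_lines_meet[OF inv assms(1)])
    show "pt c \<in> l" by (subst l_shift[of c]) (simp add: vec.span_base)
    show "pt c \<in> l'" unfolding ct by (simp add: vec.span_base)
  qed (use assms in simp)
  ultimately show ?thesis using that assms(1) unfolding slopes_def by blast
qed

lemma lines_through_pt: "lines_through (vec.span {pt c}) - {l} = ln c ` slopes c"
proof (intro equalityI subsetI)
  fix l' assume "l' \<in> lines_through (vec.span {pt c}) - {l}"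
  then have l': "invariant_line \<omega> l'" "l' \<noteq> l" "pt c \<in> l'"
    unfolding lines_through_def using vec.span_base[of "pt c" "{pt c}"] by auto
  obtain c' t where "l' = ln c' t" "t \<in> slopes c'" using other_line_cases[OF l'(1,2)] .
  then show "l' \<in> ln c ` slopes c" using pt_mem_ln l'(3) by auto
next
  fix l' assume "l' \<in> ln c ` slopes c"
  then obtain t where "l' = ln c t" "invariant_line \<omega> (ln c t)" unfolding slopes_def by blast
  then show "l' \<in> lines_through (vec.span {pt c}) - {l}"
    unfolding lines_through_def using ln_neq_l vec.span_mono[of "{pt c}" "{pt c, f + t *s e}"] by auto
qed

lemma card_lines_through_pt: "card (lines_through (vec.span {pt c}) - {l}) = card (slopes c)"
  unfolding lines_through_pt by (rule card_image) (auto intro: inj_onI simp: ln_inject)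

text \<open>On \<open>l\<close> only the contraction with \<open>f\<close> can be non-zero, and
  \<open>P\<close> is this contraction. Up to sign, \<open>q\<close> and \<open>h\<close> are the
  normal derivatives of the contractions with \<open>e\<close> and \<open>p\<close>;
  \<open>lin_base_right\<close> at \<open>pt u\<close> gives \<open>P = u q + h\<close>. The member
  \<open>h + c q\<close> belongs to the point \<open>pt c\<close>.\<close>

lemma pencil:
  obtains P q h where "pencil_count d q h (\<lambda>c. card (slopes c)) P"
    "\<And>c. poly P c = \<omega> (pt c) \<star> f" "\<And>c. poly P c = 0 \<longleftrightarrow> \<omega> (pt c) = 0"
    "\<And>c. poly (pderiv P) c = lin (pt c) e f" "\<And>c. poly q c = - lin (pt c) f e"
proof -
  obtain P where P: "coeff P (Suc d) = \<omega> e \<star> f" "\<And>u. \<omega> (u *s e + p) \<star> f = poly P u"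
    using hom_poly_line[OF hom_star] by blast
  have P': "poly P u = \<omega> (pt u) \<star> f" for u using P(2)[of u] by (simp add: add.commute)
  obtain q' where q': "degree q' \<le> d" "\<And>u. lin (pt u) f e = poly q' u" by (rule normal_derivative_poly) blast
  obtain h' where h': "degree h' \<le> d" "\<And>u. lin (pt u) f p = poly h' u" by (rule normal_derivative_poly) blast
  have e0: "\<omega> v \<star> e = 0" "\<omega> v \<star> p = 0" if "v \<in> l" for v
    using inv that unfolding invariant_line_def l by (auto simp: vec.span_base)
  have mem: "pt c \<in> l" "e \<in> l" for c
    by (subst l_shift[of c], simp add: vec.span_base) (simp add: l vec.span_base)
  have zero: "poly P c = 0 \<longleftrightarrow> \<omega> (pt c) = 0" for c
    using form_frame_zero[OF fr, of "pt c"] e0 mem by (auto simp: P' star_simps)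
  have PQ: "P = [:0, 1:] * (- q') + (- h')"
  proof (intro poly_eq_poly_eq_iff[THEN iffD1] ext)
    fix u
    have "- poly P u = lin (pt u) f (pt u)" using lin_base_right[of "pt u" f] P' by simp
    also have "\<dots> = poly h' u + u * poly q' u" using q'(2)[of u] h'(2)[of u] by simp
    finally have "poly P u = - (poly h' u + u * poly q' u)" by (metis add.inverse_inverse)
    then show "poly P u = poly ([:0, 1:] * (- q') + (- h')) u" by simp
  qed
  \<comment> \<open>That \<open>[e]\<close> is non-singular makes the degree of \<open>q\<close>
    exactly \<open>d\<close>.\<close>
  have "\<omega> e \<star> f \<noteq> 0" using form_frame_zero[OF fr, of e] e0 mem we by auto
  moreover have "coeff P (Suc d) = - coeff q' d"
    using h'(1) by (subst PQ) (simp add: coeff_eq_0)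
  ultimately have deg: "degree (- q') = d" using q'(1) P(1) le_degree[of q' d] by simp
  have "pencil_count d (- q') (- h') (\<lambda>c. card (slopes c)) P"
  proof
    show "[:- c, 1:] ^ card (slopes c) dvd - h' + smult c (- q')" for c
    proof -
      \<comment> \<open>\<open>slopes_point\<close> measures the parameter from \<open>pt c\<close>,
        so the polynomial is translated by \<open>c\<close> and back.\<close>
      let ?N = "pcompose (h' + smult c q') [:c, 1:]"
      have "lin (pt c + u *s e) f (pt c) = poly ?N u" for u
      proof -
        have *: "pt c + u *s e = pt (c + u)" by (simp add: vec_eq_iff algebra_simps)
        show ?thesis unfolding * lin_simps q'(2) h'(2) by (simp add: poly_pcompose)
      qed
      then have "[:0, 1:] ^ card (slopes c) dvd ?N" by (rule slopes_point(3))
      then obtain G where G: "?N = [:0, 1:] ^ card (slopes c) * G" by (rule dvdE)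
      have "h' + smult c q' = pcompose ?N [:- c, 1:]"
        by (simp add: pcompose_assoc[symmetric] pcompose_pCons)
      also have "\<dots> = [:- c, 1:] ^ card (slopes c) * pcompose G [:- c, 1:]"
        unfolding G by (simp add: pcompose_mult pcompose_power pcompose_pCons)
      finally have "[:- c, 1:] ^ card (slopes c) dvd - (h' + smult c q')" by simp
      then show ?thesis by simp
    qed
    show "P = [:0, 1:] * (- q') + (- h')" by (rule PQ)
  qed (use d2 deg h'(1) slopes_point(1) in simp_all)
  moreover have "poly (pderiv P) c = lin (pt c) e f" for c
  proof (rule lin_eqI[symmetric])
    have "(poly P has_field_derivative poly (pderiv P) c) (at (0 + c))" by (simp add: poly_DERIV)
    then have "((\<lambda>t. poly P (t + c)) has_field_derivative poly (pderiv P) c) (at 0)"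
      by (simp only: DERIV_shift)
    moreover have "\<omega> (pt c + t *s e) \<star> f = poly P (t + c)" for t
      unfolding P' by (rule arg_cong[of _ _ "\<lambda>v. \<omega> v \<star> f"]) (simp add: vec_eq_iff algebra_simps)
    ultimately show "((\<lambda>t. \<omega> (pt c + t *s e) \<star> f) has_field_derivative poly (pderiv P) c) (at 0)"
      by simp
  qed
  ultimately show ?thesis using that[of "- q'" "- h'" P] P' zero q'(2) by simp
qed

lemma other_lines: "{l'. invariant_line \<omega> l'} - {l} =
    (\<lambda>(c, t). ln c t) ` (SIGMA c : {c. \<omega> (pt c) = 0}. slopes c)"
proof (intro equalityI subsetI)
  fix l' assume "l' \<in> {l'. invariant_line \<omega> l'} - {l}"
  then have "invariant_line \<omega> l'" "l' \<noteq> l" by auto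
  then obtain c t where "l' = ln c t" "t \<in> slopes c" "\<omega> (pt c) = 0" by (rule other_line_cases)
  then show "l' \<in> (\<lambda>(c, t). ln c t) ` (SIGMA c : {c. \<omega> (pt c) = 0}. slopes c)" by force
next
  fix l' assume "l' \<in> (\<lambda>(c, t). ln c t) ` (SIGMA c : {c. \<omega> (pt c) = 0}. slopes c)"
  then show "l' \<in> {l'. invariant_line \<omega> l'} - {l}" using ln_neq_l by (auto simp: slopes_def)
qed

lemma inj_pt: "inj (\<lambda>c. vec.span {pt c})"
proof (rule injI)
  fix c c' assume "vec.span {pt c} = vec.span {pt c'}"
  then obtain k where k: "pt c = k *s pt c'" using span_eq_scale pt_nz by metis
  then have "1 *s p + c *s e + 0 *s f = k *s p + (k * c') *s e + 0 *s f"
    by (simp add: vec_eq_iff algebra_simps)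
  from frame_unique[OF fr this] show "c = c'" by auto
qed

lemma singular_points_on_line:
  "{s. singular_point \<omega> s \<and> s \<subseteq> l} = (\<lambda>c. vec.span {pt c}) ` {c. \<omega> (pt c) = 0}"
proof (intro equalityI subsetI)
  fix s assume "s \<in> {s. singular_point \<omega> s \<and> s \<subseteq> l}"
  then have s: "singular_point \<omega> s" "s \<subseteq> l" by auto
  then obtain v where v: "v \<noteq> 0" "s = vec.span {v}" unfolding singular_point_def proj_point_iff by blast
  have "v \<in> l" using s v vec.span_base[of v "{v}"] by auto
  then obtain x y where xy: "v = x *s p + y *s e" unfolding l vec_span_2 by blast
  have wv: "\<omega> v = 0" using s v singular_point_iff by blast
  have "x \<noteq> 0"
  proof
    assume "x = 0"
    then have "y \<noteq> 0" "v = y *s e" using v xy by auto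
    then have "e = (1 / y) *s v" by (simp add: vec_eq_iff)
    then show False using scale[of "1 / y" v] wv we by simp
  qed
  then have v': "v = x *s pt (y / x)" unfolding xy by (simp add: vec_eq_iff algebra_simps)
  have "s = vec.span {pt (y / x)}" unfolding v(2) v' by (rule span_scale[OF \<open>x \<noteq> 0\<close>])
  moreover from this have "\<omega> (pt (y / x)) = 0" using s(1) singular_point_iff[OF pt_nz] by simp
  ultimately show "s \<in> (\<lambda>c. vec.span {pt c}) ` {c. \<omega> (pt c) = 0}" by blast
next
  fix s assume "s \<in> (\<lambda>c. vec.span {pt c}) ` {c. \<omega> (pt c) = 0}"
  then obtain c where c: "s = vec.span {pt c}" "\<omega> (pt c) = 0" by blast
  have "pt c \<in> l" by (subst l_shift[of c]) (simp add: vec.span_base)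
  then have "s \<subseteq> l" unfolding c using inv span_point_subset_line unfolding invariant_line_def by blast
  then show "s \<in> {s. singular_point \<omega> s \<and> s \<subseteq> l}" using c singular_point_iff[OF pt_nz] by simp
qed

text \<open>Every further invariant line meets \<open>l\<close> in exactly one point, which is
  singular; so adding up slopes over the singularities counts these lines, and
  \<open>sum_bound\<close> applies.\<close>

lemma invariant_lines_bound:
  "finite {l'. invariant_line \<omega> l'}" "card {l'. invariant_line \<omega> l'} \<le> 3 * d"
  "card ({l'. invariant_line \<omega> l'} - {l}) = (\<Sum>c | \<omega> (pt c) = 0. card (slopes c))"
proof -
  obtain P q h where P: "pencil_count d q h (\<lambda>c. card (slopes c)) P" "\<And>c. poly P c = 0 \<longleftrightarrow> \<omega> (pt c) = 0"
    by (rule pencil) blast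
  interpret pencil_count d q h "\<lambda>c. card (slopes c)" P by (rule P)
  have R: "{c. \<omega> (pt c) = 0} = {c. poly P c = 0}" using P(2) by auto
  have fin: "finite {c. \<omega> (pt c) = 0}" unfolding R using P_nz by (rule poly_roots_finite)
  have fs: "finite (SIGMA c : {c. \<omega> (pt c) = 0}. slopes c)" using fin finite_slopes by blast
  then have "finite ({l'. invariant_line \<omega> l'} - {l})" unfolding other_lines by (rule finite_imageI)
  then show f: "finite {l'. invariant_line \<omega> l'}" by simp
  have "card ({l'. invariant_line \<omega> l'} - {l}) = card (SIGMA c : {c. \<omega> (pt c) = 0}. slopes c)"
    unfolding other_lines by (rule card_image) (auto intro!: inj_onI simp: ln_inject)
  then show eq: "card ({l'. invariant_line \<omega> l'} - {l}) = (\<Sum>c | \<omega> (pt c) = 0. card (slopes c))"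
    using fin finite_slopes by (simp add: card_SigmaI)
  have "card ({l'. invariant_line \<omega> l'} - {l}) \<le> 3 * d - 1" unfolding eq R by (rule sum_bound)
  moreover have "card ({l'. invariant_line \<omega> l'} - {l}) = card {l'. invariant_line \<omega> l'} - 1"
    using inv by (intro card_Diff_singleton) simp
  ultimately show "card {l'. invariant_line \<omega> l'} \<le> 3 * d" using d2 by linarith
qed

end

text \<open>For a singularity with non-zero eigenvalue along \<open>l\<close>, the residue defining the Camacho-Sad
  index reduces to this quotient of entries of the linear part.\<close>

definition index_at where
  "index_at l s z \<longleftrightarrow> (\<exists>p e f. frame p e f \<and> s = vec.span {p} \<and> l = vec.span {p, e} \<and>
     lin p e f \<noteq> 0 \<and> z = - lin p f e / lin p e f)"

lemma finite_invariant_lines: "finite {l. invariant_line \<omega> l}"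
  and card_invariant_lines: "card {l. invariant_line \<omega> l} \<le> 3 * d"
proof -
  have "finite {l. invariant_line \<omega> l} \<and> card {l. invariant_line \<omega> l} \<le> 3 * d"
  proof (cases "\<exists>l. invariant_line \<omega> l")
    case True
    then obtain l where l: "invariant_line \<omega> l" ..
    then have "proj_line l" unfolding invariant_line_def by blast
    from nonsingular_point_on_line[OF this] obtain p e f where
      "frame p e f" "l = vec.span {p, e}" "\<omega> e \<noteq> 0" .
    from invariant_lines_bound(1,2)[OF this(1,2) l this(3)] show ?thesis by blast
  next
    case False
    then have "{l. invariant_line \<omega> l} = {}" by simp
    then show ?thesis by simp
  qed
  then show "finite {l. invariant_line \<omega> l}" "card {l. invariant_line \<omega> l} \<le> 3 * d" by auto
qed

text \<open>The equality case of \<open>pencil_count\<close>, transferred from parameters to points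
  of the line; \<open>z\<close> collects the indices along it.\<close>

lemma reduced_convex_line:
  assumes "card {l. invariant_line \<omega> l} = 3 * d" and inv: "invariant_line \<omega> l"
  defines "S \<equiv> {s. singular_point \<omega> s \<and> s \<subseteq> l}"
  obtains z where "card S = Suc d" "finite S"
    "(\<Sum>s\<in>S. card (lines_through s - {l})) = 3 * d - 1" "(\<Sum>s\<in>S. z s) = 1"
    "\<And>s. s \<in> S \<Longrightarrow> 1 \<le> card (lines_through s - {l})"
    "\<And>s. s \<in> S \<Longrightarrow> card (lines_through s - {l}) \<le> d"
    "\<And>s. s \<in> S \<Longrightarrow> 2 \<le> card (lines_through s - {l}) \<Longrightarrow> z s = 1"
    "\<And>s. s \<in> S \<Longrightarrow> card (lines_through s - {l}) = d \<Longrightarrow> radial_singularity \<omega> s (d - 1)"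
    "\<And>s. s \<in> S \<Longrightarrow> index_at l s (z s)" "\<And>s. s \<in> S \<Longrightarrow> z s \<noteq> 0"
proof -
  have "proj_line l" using inv unfolding invariant_line_def by blast
  from nonsingular_point_on_line[OF this] obtain p e f where
    fr: "frame p e f" and l: "l = vec.span {p, e}" and we: "\<omega> e \<noteq> 0" .
  note ctx = fr l inv we
  let ?pt = "\<lambda>c. p + c *s e" and ?r = "\<lambda>c. card (slopes p e f c)"
  obtain P q h where P: "pencil_count d q h ?r P"
    "\<And>c. poly P c = 0 \<longleftrightarrow> \<omega> (?pt c) = 0"
    "\<And>c. poly (pderiv P) c = lin (?pt c) e f" "\<And>c. poly q c = - lin (?pt c) f e"
    by (rule pencil[OF ctx]) blast
  interpret pencil_count d q h ?r P by (rule P)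
  have R: "{c. \<omega> (?pt c) = 0} = {c. poly P c = 0}" using P(2) by auto
  have ext: "(\<Sum>c | poly P c = 0. ?r c) = 3 * d - 1"
    using invariant_lines_bound(3)[OF ctx] R assms(1) inv by simp
  define s where "s c = vec.span {?pt c}" for c
  have inj: "inj s" unfolding s_def by (rule inj_pt[OF ctx])
  have S: "S = s ` {c. poly P c = 0}"
    unfolding S_def s_def R[symmetric] by (rule singular_points_on_line[OF ctx])
  have cr: "card (lines_through (s c) - {l}) = ?r c" for c
    unfolding s_def by (rule card_lines_through_pt[OF ctx])
  define z where "z t = poly q (inv s t) / poly (pderiv P) (inv s t)" for t
  have z: "z (s c) = poly q c / poly (pderiv P) c" for c
    unfolding z_def by (simp add: inv_f_f[OF inj])
  have inj': "inj_on s A" for A using inj inj_on_subset by blast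
  show ?thesis
  proof
    show "card S = Suc d" unfolding S using card_image[OF inj'] card_roots[OF ext] by simp
    then show "finite S" using card.infinite by fastforce
    show "(\<Sum>s\<in>S. card (lines_through s - {l})) = 3 * d - 1"
      unfolding S sum.reindex[OF inj'] using ext by (simp add: cr)
    show "(\<Sum>s\<in>S. z s) = 1"
      unfolding S sum.reindex[OF inj'] using sum_index[OF ext] by (simp add: z)
    fix t assume "t \<in> S"
    then obtain c where c: "t = s c" "poly P c = 0" unfolding S by blast
    show "1 \<le> card (lines_through t - {l})" unfolding c cr using extremal_orders(2)[OF ext c(2)] by simp
    show "card (lines_through t - {l}) \<le> d" unfolding c cr by (rule r_le)
    show "z t = 1" if "2 \<le> card (lines_through t - {l})"
    proof -
      have "poly (pderiv P) c = poly q c"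
        by (rule r_ge_2_imp) (use ext that in \<open>auto simp: c cr\<close>)
      then show ?thesis unfolding c z using pderiv_P_nz[OF ext c(2)] by simp
    qed
    show "z t \<noteq> 0" unfolding c z using pderiv_P_nz[OF ext c(2)] q_root_nz[OF ext c(2)] by simp
    show "index_at l t (z t)" unfolding index_at_def
    proof (intro exI conjI)
      show "frame (?pt c) e f" by (rule shifted_frame[OF ctx])
      show "t = vec.span {?pt c}" unfolding c s_def ..
      show "l = vec.span {?pt c, e}" by (rule l_shift[OF ctx])
      show "lin (?pt c) e f \<noteq> 0" using pderiv_P_nz[OF ext c(2)] P(3) by simp
      show "z t = - lin (?pt c) f e / lin (?pt c) e f" unfolding c z P(3,4) ..
    qed
    show "radial_singularity \<omega> t (d - 1)" if "card (lines_through t - {l}) = d"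
    proof -
      have "radial_at (?pt c)" unfolding radial_at_def
        using slopes_point(2)[OF ctx, of c] that P(2)[of c] c(2) pderiv_P_nz[OF ext c(2)] P(3)[of c]
        unfolding c cr by metis
      then show ?thesis unfolding c s_def using radial_at_imp pt_nz[OF ctx] by blast
    qed
  qed
qed

end

section \<open>Camacho-Sad indices\<close>

lemma two_points_one_line:
  assumes "proj_line l" "proj_line l'" "l \<noteq> l'" "proj_point s" "proj_point t"
    "s \<subseteq> l" "s \<subseteq> l'" "t \<subseteq> l" "t \<subseteq> l'"
  shows "s = t"
proof (rule ccontr)
  assume "s \<noteq> t"
  obtain a b where ab: "a \<noteq> 0" "s = vec.span {a}" "b \<noteq> 0" "t = vec.span {b}"
    using assms(4,5) unfolding proj_point_iff by auto
  have "b \<notin> vec.span {a}"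
  proof
    assume "b \<in> vec.span {a}"
    then obtain k where k: "b = k *s a" unfolding vec_span_1 by blast
    then have "k \<noteq> 0" using ab by auto
    then show False using \<open>s \<noteq> t\<close> ab k span_scale by metis
  qed
  moreover have "a \<in> s" "b \<in> t" using ab by (auto simp: vec.span_base)
  ultimately have "l = vec.span {a, b}" "l' = vec.span {a, b}"
    using line_eq_span assms ab by (meson in_mono)+
  then show False using assms(3) by simp
qed

context foliation_form
begin

lemma lin_scale_base:
  assumes "k \<noteq> 0"
  shows "lin (k *s p) v w = k ^ d * lin p v w"
proof (rule lin_eqI)
  have *: "\<omega> (k *s p + t *s v) \<star> w = k ^ Suc d * (\<omega> (p + (t / k) *s v) \<star> w)" for t
  proof -
    have "k *s p + t *s v = k *s (p + (t / k) *s v)" using assms by (simp add: vec_eq_iff algebra_simps)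
    then show ?thesis by (simp only: scale star_simps)
  qed
  have "((\<lambda>t. t / k) has_field_derivative 1 / k) (at 0)"
    using assms by (auto intro!: derivative_eq_intros)
  from DERIV_chain2[OF _ this, of "\<lambda>t. \<omega> (p + t *s v) \<star> w" "lin p v w"]
  have "((\<lambda>t. \<omega> (p + (t / k) *s v) \<star> w) has_field_derivative lin p v w * (1 / k)) (at 0)"
    using has_field_derivative_lin[of p v w] by simp
  then have "((\<lambda>t. k ^ Suc d * (\<omega> (p + (t / k) *s v) \<star> w)) has_field_derivative
      k ^ Suc d * (lin p v w * (1 / k))) (at 0)" by (rule DERIV_cmult)
  then show "((\<lambda>t. \<omega> (k *s p + t *s v) \<star> w) has_field_derivative k ^ d * lin p v w) (at 0)"
    unfolding * using assms by (simp add: field_simps)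
qed

text \<open>Entries of \<open>lin p\<close> involving \<open>p\<close> vanish, and so does
  \<open>lin p e e\<close>; what remains compares \<open>lin p\<close> with its transpose. The
  resulting relation no longer mentions a frame, and it yields both uniqueness and the product
  rule.\<close>

lemma index_at_rel:
  assumes inv: "invariant_line \<omega> l" and p: "p \<noteq> 0" "\<omega> p = 0" and z: "index_at l (vec.span {p}) z"
  obtains e f where "frame p e f" "l = vec.span {p, e}" "lin p e f \<noteq> 0"
    "z = - lin p f e / lin p e f"
    "\<And>v w. v \<in> l \<Longrightarrow> z * lin p v w = - lin p w v"
proof -
  obtain p' e f where fr': "frame p' e f" "vec.span {p} = vec.span {p'}" "l = vec.span {p', e}"
    and nz': "lin p' e f \<noteq> 0" and z': "z = - lin p' f e / lin p' e f"
    using z unfolding index_at_def by blast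
  have "p' \<noteq> 0" using fr' frame_iff by blast
  then obtain k where k: "k \<noteq> 0" "p' = k *s p" using span_eq_scale[OF fr'(2)[symmetric]] by blast
  have pl: "proj_line l" using inv unfolding invariant_line_def by blast
  have fr: "frame p e f"
  proof (rule frameI)
    fix x u w assume "x *s p + u *s e + w *s f = 0"
    then have "(x / k) *s p' + u *s e + w *s f = 0" using k by (simp add: vec_eq_iff)
    from frame_indep[OF fr'(1) this] show "x = 0 \<and> u = 0 \<and> w = 0" using k(1) by simp
  qed
  have mem: "p \<in> l" "e \<in> l"
  proof -
    have "p' \<in> l" "e \<in> l" unfolding fr'(3) by (auto simp: vec.span_base)
    moreover have "p = (1 / k) *s p'" using k by (simp add: vec_eq_iff)
    ultimately show "p \<in> l" "e \<in> l" using proj_line_closed(2)[OF pl \<open>p' \<in> l\<close> \<open>p' \<in> l\<close>, of "1 / k"] by auto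
  qed
  have l: "l = vec.span {p, e}" using line_eq_span[OF pl mem p(1)] fr frame_iff by blast
  have nz: "lin p e f \<noteq> 0" and zz: "z = - lin p f e / lin p e f"
    using nz' z' k lin_scale_base by simp_all
  have "z * lin p v w = - lin p w v" if v: "v \<in> l" for v w
  proof -
    obtain x y where v: "v = x *s p + y *s e" using v unfolding l vec_span_2 by blast
    obtain a b c where w: "w = a *s p + b *s e + c *s f" by (rule frame_coords[OF fr])
    have "lin p e e = 0" using invariant_lin_zero[OF inv] mem by blast
    then have "lin p v w = y * c * lin p e f" "lin p w v = c * y * lin p f e"
      unfolding v w using lin_base_left[OF p(2)] lin_base_right[of p] p(2)
      by (simp_all add: star_zero_left)
    then show ?thesis using nz unfolding zz by simp
  qed
  then show ?thesis using that fr l nz zz by blast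
qed

text \<open>Using \<open>index_at_rel\<close> for \<open>e\<close> in \<open>l\<close> and then for
  \<open>e'\<close> in \<open>l'\<close> exchanges the arguments of \<open>lin p\<close> twice, and
  \<open>lin p e e'\<close> is non-zero.\<close>

lemma index_at_product:
  assumes "invariant_line \<omega> l" "invariant_line \<omega> l'" "l \<noteq> l'" "singular_point \<omega> s"
    "index_at l s z" "index_at l' s z'"
  shows "z * z' = 1"
proof -
  obtain p where p: "p \<noteq> 0" "s = vec.span {p}"
    using assms(4) unfolding singular_point_def proj_point_iff by blast
  have wp: "\<omega> p = 0" using assms(4) p singular_point_iff by blast
  obtain e f where e: "frame p e f" "l = vec.span {p, e}" "lin p e f \<noteq> 0"
    and z: "\<And>v w. v \<in> l \<Longrightarrow> z * lin p v w = - lin p w v"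
    using index_at_rel[OF assms(1) p(1) wp assms(5)[unfolded p(2)]] by metis
  obtain e' f' where e': "frame p e' f'" "l' = vec.span {p, e'}"
    and z': "\<And>v w. v \<in> l' \<Longrightarrow> z' * lin p v w = - lin p w v"
    using index_at_rel[OF assms(2) p(1) wp assms(6)[unfolded p(2)]] by metis
  have mem: "p \<in> l" "e \<in> l" "e' \<in> l'" unfolding e e' by (auto simp: vec.span_base)
  have pl: "proj_line l" using assms(1) unfolding invariant_line_def by blast
  have "e' \<notin> l"
  proof
    assume "e' \<in> l"
    then have "l = l'" using line_eq_span[OF pl mem(1) _ p(1), of e'] e' frame_iff by blast
    then show False using assms(3) by simp
  qed
  then have "frame p e e'" using e unfolding frame_iff by simp
  then obtain a b c where f: "f = a *s p + b *s e + c *s e'" by (rule frame_coords)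
  have "lin p e e = 0" using invariant_lin_zero[OF assms(1)] mem by blast
  then have "lin p e f = c * lin p e e'" unfolding f using lin_base_right[of p e] wp
    by (simp add: star_zero_left)
  then have nz: "lin p e e' \<noteq> 0" using e(3) by auto
  have "z' * (z * lin p e e') = lin p e e'" using z[OF mem(2), of e'] z'[OF mem(3), of e] by simp
  then show ?thesis using nz by (simp add: mult.commute)
qed

lemma index_at_unique:
  assumes "invariant_line \<omega> l" "singular_point \<omega> s" "index_at l s z" "index_at l s z'"
  shows "z = z'"
proof -
  obtain p where p: "p \<noteq> 0" "s = vec.span {p}"
    using assms(2) unfolding singular_point_def proj_point_iff by blast
  have wp: "\<omega> p = 0" using assms(2) p singular_point_iff by blast
  obtain e f where e: "l = vec.span {p, e}" "lin p e f \<noteq> 0" "z = - lin p f e / lin p e f"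
    using index_at_rel[OF assms(1) p(1) wp assms(3)[unfolded p(2)]] by metis
  have "\<And>v w. v \<in> l \<Longrightarrow> z' * lin p v w = - lin p w v"
    using index_at_rel[OF assms(1) p(1) wp assms(4)[unfolded p(2)]] by metis
  from this[of e f] have "z' * lin p e f = z * lin p e f" using e by (simp add: vec.span_base)
  then show ?thesis using e(2) by simp
qed

section \<open>Linear parts in charts, non-degeneracy and residues\<close>

definition linear_part :: "complex ^ 3 \<Rightarrow> complex ^ 3 \<Rightarrow> complex ^ 3 \<Rightarrow> complex ^ 2 ^ 2" where
  "linear_part p e f = vector [vector [lin p e f, lin p f f], vector [- lin p e e, - lin p f e]]"

lemma chart_field_derivative: "(chart_field \<omega> p e f has_derivative (*v) (linear_part p e f)) (at 0)"
proof -
  have comp: "((\<lambda>w :: complex ^ 2. \<omega> (p + w $ 1 *s e + w $ 2 *s f) \<star> a) has_derivative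
      (\<lambda>w. lin p (w $ 1 *s e + w $ 2 *s f) a)) (at 0)" for a
  proof -
    have l1: "bounded_linear (\<lambda>w :: complex ^ 2. w $ 1 *s e + w $ 2 *s f)"
      unfolding linear_conv_bounded_linear[symmetric]
      by (rule linearI) (simp_all add: vec_eq_iff algebra_simps)
    have "((\<lambda>w :: complex ^ 2. p + (w $ 1 *s e + w $ 2 *s f)) has_derivative (\<lambda>w. w $ 1 *s e + w $ 2 *s f)) (at 0)"
      using has_derivative_add[OF has_derivative_const[of p] bounded_linear_imp_has_derivative[OF l1]]
      by simp
    from has_derivative_compose[OF this, of \<omega> "\<lambda>w. jacobian p *v w"]
    have "((\<lambda>w :: complex ^ 2. \<omega> (p + (w $ 1 *s e + w $ 2 *s f))) has_derivative
        (\<lambda>w. jacobian p *v (w $ 1 *s e + w $ 2 *s f))) (at 0)"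
      using has_derivative_form[of p] by simp
    from bounded_linear.has_derivative[OF bounded_linear_star this]
    show ?thesis unfolding lin_def by (simp add: add.assoc)
  qed
  have comp1: "((\<lambda>w. chart_field \<omega> p e f w $ i) has_derivative (\<lambda>w. (linear_part p e f *v w) $ i)) (at 0)" for i
  proof (cases "i = 1")
    case True
    have "(\<lambda>w. (linear_part p e f *v w) $ 1) = (\<lambda>w. lin p (w $ 1 *s e + w $ 2 *s f) f)"
      by (simp add: linear_part_def matrix_vector_mult_def sum_2 mult.commute)
    then show ?thesis using comp[of f] True by (simp add: chart_field_def Let_def)
  next
    case False
    then have i: "i = 2" using exhaust_2 by blast
    have "(\<lambda>w. (linear_part p e f *v w) $ 2) = (\<lambda>w. - lin p (w $ 1 *s e + w $ 2 *s f) e)"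
      by (simp add: linear_part_def matrix_vector_mult_def sum_2 mult.commute)
    then show ?thesis using has_derivative_minus[OF comp[of e]] i by (simp add: chart_field_def Let_def)
  qed
  show ?thesis by (rule has_derivative_vec) (rule comp1)
qed

lemma det_linear_part: "det (linear_part p e f) = lin p f f * lin p e e - lin p e f * lin p f e"
  by (simp add: det_2 linear_part_def)

text \<open>Independence of the chart: a change of \<open>e\<close> and \<open>f\<close> multiplies
  the determinant by a square, rescaling \<open>p\<close> by \<open>(k ^ d)\<^sup>2\<close>, and
  components along \<open>p\<close> do not matter.\<close>

lemma nondegenerate_imp:
  assumes "nondegenerate_singularity \<omega> s" "frame p e f" "s = vec.span {p}"
  shows "lin p f f * lin p e e - lin p e f * lin p f e \<noteq> 0"
proof -
  obtain p' e' f' A where a: "singular_point \<omega> s" "affine_frame s p' e' f'"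
    "(chart_field \<omega> p' e' f' has_derivative (*v) A) (at 0)" "invertible (A :: complex ^ 2 ^ 2)"
    using assms(1) unfolding nondegenerate_singularity_def defining_field_def by blast
  have fr': "frame p' e' f'" "s = vec.span {p'}" using a(2) unfolding affine_frame_def frame_def by auto
  have p': "p' \<noteq> 0" and p: "p \<noteq> 0" using fr' assms(2) frame_iff by blast+
  have wp: "\<omega> p = 0" using a(1) assms(3) singular_point_iff[OF p] by simp
  have "(*v) A = (*v) (linear_part p' e' f')"
    by (rule has_derivative_unique[OF a(3) chart_field_derivative])
  then have "A = linear_part p' e' f'" by (simp add: matrix_eq fun_eq_iff)
  then have det': "lin p' f' f' * lin p' e' e' - lin p' e' f' * lin p' f' e' \<noteq> 0"
    using a(4) invertible_det_nz det_linear_part by metis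
  obtain k where k: "k \<noteq> 0" "p = k *s p'" using span_eq_scale[of p p'] assms(3) fr' p by blast
  have wp': "\<omega> p' = 0" using a(1) fr'(2) singular_point_iff[OF p'] by simp
  have lin_scale: "lin p v w = k ^ d * lin p' v w" for v w
    unfolding k(2) by (rule lin_scale_base[OF k(1)])
  obtain x1 y1 z1 where e': "e' = x1 *s p + y1 *s e + z1 *s f" by (rule frame_coords[OF assms(2)])
  obtain x2 y2 z2 where f': "f' = x2 *s p + y2 *s e + z2 *s f" by (rule frame_coords[OF assms(2)])
  have b: "lin p p v = 0" "lin p v p = 0" for v
    using lin_base_left[OF wp] lin_base_right[of p] wp by (simp_all add: star_zero_left)
  have "lin p f' f' * lin p e' e' - lin p e' f' * lin p f' e' =
      (y1 * z2 - z1 * y2)\<^sup>2 * (lin p f f * lin p e e - lin p e f * lin p f e)"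
    unfolding e' f' by (simp add: b power2_eq_square algebra_simps)
  moreover have "lin p f' f' * lin p e' e' - lin p e' f' * lin p f' e' =
      (k ^ d)\<^sup>2 * (lin p' f' f' * lin p' e' e' - lin p' e' f' * lin p' f' e')"
    unfolding lin_scale by (simp add: power2_eq_square algebra_simps)
  ultimately show ?thesis using det' k(1) by auto
qed

lemma residue_chart:
  assumes "\<omega> p = 0" "lin p e f \<noteq> 0" "Q holomorphic_on UNIV" "Q 0 \<noteq> 0"
  shows "residue (\<lambda>u. Q u / (\<omega> (p + u *s e) \<star> f)) 0 = Q 0 / lin p e f"
proof (rule residue_simple_pole_deriv[where s = UNIV])
  obtain R where "\<And>x. \<omega> (x *s e + p) \<star> f = poly R x" using hom_poly_line[OF hom_star] by blast
  then have R: "\<omega> (p + u *s e) \<star> f = poly R u" for u by (simp add: add.commute)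
  show "(\<lambda>u. \<omega> (p + u *s e) \<star> f) holomorphic_on UNIV" unfolding R by (intro holomorphic_intros)
qed (use assms has_field_derivative_lin in \<open>auto simp: star_zero_left\<close>)

text \<open>As \<open>lin p e e = 0\<close>, non-degeneracy makes \<open>lin p e f\<close> and
  \<open>lin p f e\<close> non-zero. The pole is therefore simple, and \<open>Q 0 0\<close> is
  obtained by differentiating \<open>v * Q 0 v\<close> at \<open>v = 0\<close>.\<close>

lemma camacho_sad_imp_index_at:
  assumes inv: "invariant_line \<omega> l" and nd: "nondegenerate_singularity \<omega> s"
    and cs: "camacho_sad_index \<omega> l s z"
  shows "index_at l s z"
proof -
  obtain p e f P Q where a: "affine_frame s p e f" "l = vec.span {p, e}"
    "\<And>u v. chart_field \<omega> p e f (vector [u, v]) = vector [P u v, v * Q u v]"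
    "\<And>u. (\<lambda>v. Q u v) holomorphic_on UNIV" "\<And>v. (\<lambda>u. Q u v) holomorphic_on UNIV"
    "z = residue (\<lambda>u. Q u 0 / P u 0) 0"
    using cs unfolding camacho_sad_index_def by blast
  have fr: "frame p e f" "s = vec.span {p}" using a(1) unfolding affine_frame_def frame_def by auto
  have p: "p \<noteq> 0" using fr frame_iff by blast
  have wp: "\<omega> p = 0" using nd fr(2) singular_point_iff[OF p] unfolding nondegenerate_singularity_def by simp
  have P: "P u v = \<omega> (p + u *s e + v *s f) \<star> f" and Q: "v * Q u v = - (\<omega> (p + u *s e + v *s f) \<star> e)" for u v
    using a(3)[of u v] by (simp_all add: chart_field_def Let_def vec_eq_iff forall_2)
  have "lin p e e = 0" using invariant_lin_zero[OF inv] unfolding a(2) by (simp add: vec.span_base)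
  then have nz: "lin p e f \<noteq> 0" "lin p f e \<noteq> 0" using nondegenerate_imp[OF nd fr] by auto
  have "- lin p f e = Q 0 0"
  proof -
    have "(Q 0) field_differentiable (at 0)"
      using a(4)[of 0] holomorphic_on_imp_differentiable_at by blast
    then obtain D where "(Q 0 has_field_derivative D) (at 0)" unfolding field_differentiable_def by blast
    from DERIV_mult[OF DERIV_ident this]
    have "((\<lambda>v. v * Q 0 v) has_field_derivative Q 0 0) (at 0)" by simp
    moreover have "(\<lambda>v. v * Q 0 v) = (\<lambda>v. - (\<omega> (p + v *s f) \<star> e))" using Q[of _ 0] by simp
    ultimately have "((\<lambda>v. - (\<omega> (p + v *s f) \<star> e)) has_field_derivative Q 0 0) (at 0)" by simp
    from DERIV_minus[OF this] have "lin p f e = - Q 0 0" by (intro lin_eqI) simp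
    then show ?thesis by simp
  qed
  moreover have "residue (\<lambda>u. Q u 0 / P u 0) 0 = Q 0 0 / lin p e f"
    unfolding P using residue_chart[OF wp nz(1) a(5)[of 0]] by (simp add: calculation[symmetric] nz(2))
  ultimately have "z = - lin p f e / lin p e f" using a(6) by simp
  then show ?thesis unfolding index_at_def using fr a(2) nz by blast
qed

text \<open>The entry \<open>lin p e e\<close> is zero and both mixed entries are non-zero, the
  second one because \<open>z \<noteq> 0\<close>. It remains to extend \<open>Q\<close>
  holomorphically across the line.\<close>

lemma index_at_imp_camacho_sad:
  assumes inv: "invariant_line \<omega> l" and sing: "singular_point \<omega> s" and z: "index_at l s z" "z \<noteq> 0"
  shows "nondegenerate_singularity \<omega> s" "camacho_sad_index \<omega> l s z"
proof -
  obtain p e f where fr: "frame p e f" "s = vec.span {p}" and l: "l = vec.span {p, e}"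
    and nz: "lin p e f \<noteq> 0" and zz: "z = - lin p f e / lin p e f"
    using z(1) unfolding index_at_def by blast
  have p: "p \<noteq> 0" using fr frame_iff by blast
  have wp: "\<omega> p = 0" using sing fr(2) singular_point_iff[OF p] by simp
  have nz': "lin p f e \<noteq> 0" using z(2) zz by auto
  have af: "affine_frame s p e f" using fr unfolding affine_frame_def frame_def by blast
  have "lin p e e = 0" using invariant_lin_zero[OF inv] unfolding l by (simp add: vec.span_base)
  then have "det (linear_part p e f) \<noteq> 0" using nz nz' det_linear_part by simp
  then have "invertible (linear_part p e f)" using invertible_det_nz by blast
  then show "nondegenerate_singularity \<omega> s"
    unfolding nondegenerate_singularity_def defining_field_def
    using sing af chart_field_derivative by blast
  define P where "P u v = \<omega> (p + u *s e + v *s f) \<star> f" for u v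
  \<comment> \<open>On the line the quotient is replaced by its limit, the normal
    derivative.\<close>
  define Q where "Q u v = (if v = 0 then - lin (p + u *s e) f e else - (\<omega> (p + u *s e + v *s f) \<star> e) / v)"
    for u v
  have e0: "\<omega> (p + u *s e) \<star> e = 0" for u
    using inv invariant_line_span_iff[OF fr(1)] unfolding l[symmetric] by (metis vector_smult_lid)
  have hu: "(\<lambda>u. Q u v) holomorphic_on UNIV" for v
  proof (cases "v = 0")
    case True
    obtain N where "\<And>u. lin (p + u *s e) f e = poly N u" by (rule normal_derivative_poly) blast
    then have "(\<lambda>u. Q u v) = (\<lambda>u. - poly N u)" using True by (simp add: Q_def)
    then show ?thesis by (simp only:) (intro holomorphic_intros)
  next
    case False
    obtain R where "\<And>x. \<omega> (x *s e + (p + v *s f)) \<star> e = poly R x" using hom_poly_line[OF hom_star] by blast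
    then have "(\<lambda>u. Q u v) = (\<lambda>u. - poly R u / v)" using False by (simp add: Q_def fun_eq_iff add_ac)
    then show ?thesis using False by (simp only:) (intro holomorphic_intros, auto)
  qed
  have hv: "(\<lambda>v. Q u v) holomorphic_on UNIV" for u
  proof -
    obtain R where R': "\<And>x. \<omega> (x *s f + (p + u *s e)) \<star> e = poly R x"
      using hom_poly_line[OF hom_star] by blast
    have R: "\<omega> (p + u *s e + x *s f) \<star> e = poly R x" for x
      unfolding add.commute[of "p + u *s e"] by (rule R')
    have "poly R 0 = 0" using R[of 0] e0[of u] by simp
    then have "[:- 0, 1:] dvd R" by (simp only: poly_eq_0_iff_dvd)
    then obtain R' where R': "R = [:- 0, 1:] * R'" by (rule dvdE)
    have "lin (p + u *s e) f e = poly (pderiv R) 0" by (rule lin_eqI) (simp add: R poly_DERIV)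
    also have "\<dots> = poly R' 0" unfolding R' pderiv_mult by (simp add: pderiv_pCons)
    finally have "(\<lambda>v. Q u v) = (\<lambda>v. - poly R' v)" by (auto simp: Q_def R R' fun_eq_iff)
    then show ?thesis by (simp only:) (intro holomorphic_intros)
  qed
  have X: "chart_field \<omega> p e f (vector [u, v]) = vector [P u v, v * Q u v]" for u v
    using e0[of u] by (simp add: chart_field_def Let_def P_def Q_def)
  have "residue (\<lambda>u. Q u 0 / P u 0) 0 = Q 0 0 / lin p e f"
    unfolding P_def using residue_chart[OF wp nz hu[of 0]] nz' by (simp add: Q_def)
  then have "z = residue (\<lambda>u. Q u 0 / P u 0) 0" unfolding zz by (simp add: Q_def)
  then show "camacho_sad_index \<omega> l s z"
    unfolding camacho_sad_index_def using af l X hu hv by blast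
qed

lemma CS_iff:
  "z \<in> CS \<omega> \<longleftrightarrow> z \<notin> {0, 1} \<and>
    (\<exists>l s. invariant_line \<omega> l \<and> s \<subseteq> l \<and> singular_point \<omega> s \<and> nondegenerate_singularity \<omega> s \<and> index_at l s z)"
proof
  assume "z \<in> CS \<omega>"
  then obtain l s where "z \<notin> {0, 1}" and ls: "invariant_line \<omega> l" "s \<subseteq> l"
    "nondegenerate_singularity \<omega> s" "camacho_sad_index \<omega> l s z"
    unfolding CS_def by blast
  moreover have "singular_point \<omega> s" using ls(3) unfolding nondegenerate_singularity_def by blast
  ultimately show "z \<notin> {0, 1} \<and> (\<exists>l s. invariant_line \<omega> l \<and> s \<subseteq> l \<and> singular_point \<omega> s \<and>
      nondegenerate_singularity \<omega> s \<and> index_at l s z)"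
    using camacho_sad_imp_index_at[OF ls(1,3,4)] by blast
next
  assume "z \<notin> {0, 1} \<and> (\<exists>l s. invariant_line \<omega> l \<and> s \<subseteq> l \<and> singular_point \<omega> s \<and>
      nondegenerate_singularity \<omega> s \<and> index_at l s z)"
  then obtain l s where z: "z \<notin> {0, 1}" and ls: "invariant_line \<omega> l" "s \<subseteq> l" "singular_point \<omega> s"
    "index_at l s z" by blast
  then have "z \<noteq> 0" by auto
  show "z \<in> CS \<omega>" unfolding CS_def
    using z ls index_at_imp_camacho_sad[OF ls(1,3,4) \<open>z \<noteq> 0\<close>] by blast
qed

end

section \<open>From reduced convexity to radial singularities\<close>

context foliation_form
begin

lemma finite_lines_through: "finite (lines_through s)"
  using finite_invariant_lines unfolding lines_through_def by (rule rev_finite_subset) auto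

text \<open>The lines with two radial singularities. Two different ones share at most one point and
  so supply three radial singularities.\<close>

definition base_line where
  "base_line l \<longleftrightarrow> (\<exists>s1 s2. s1 \<noteq> s2 \<and> s1 \<subseteq> l \<and> s2 \<subseteq> l \<and>
     card (lines_through s1 - {l}) = d \<and>
     radial_singularity \<omega> s1 (d - 1) \<and> radial_singularity \<omega> s2 (d - 1))"

context
  assumes extremal: "card {l. invariant_line \<omega> l} = 3 * d"
    and CS_sub: "CS \<omega> \<subseteq> {1 - of_nat d, 1 / (1 - of_nat d)}"
begin

text \<open>The sum of \<open>1 - z s\<close> over the \<open>d + 1\<close> singularities of the line is \<open>d\<close>, while a term is
  \<open>0\<close>, \<open>d\<close> or \<open>d / (d - 1)\<close>.\<close>

lemma line_types:
  assumes inv: "invariant_line \<omega> l"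
  shows "base_line l \<or> (\<exists>s. singular_point \<omega> s \<and> s \<subseteq> l \<and> card (lines_through s - {l}) = 1 \<and>
    index_at l s (1 - of_nat d) \<and> (\<forall>t. singular_point \<omega> t \<and> t \<subseteq> l \<longrightarrow> \<not> index_at l t (1 / (1 - of_nat d))))"
proof -
  define S where "S = {s. singular_point \<omega> s \<and> s \<subseteq> l}"
  let ?r = "\<lambda>s. card (lines_through s - {l})"
  obtain z where S: "card S = Suc d" "finite S"
    and sr: "(\<Sum>s\<in>S. ?r s) = 3 * d - 1" and sz: "(\<Sum>s\<in>S. z s) = 1"
    and r1: "\<And>s. s \<in> S \<Longrightarrow> 1 \<le> ?r s" and rd: "\<And>s. s \<in> S \<Longrightarrow> ?r s \<le> d"
    and r2: "\<And>s. s \<in> S \<Longrightarrow> 2 \<le> ?r s \<Longrightarrow> z s = 1"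
    and rad: "\<And>s. s \<in> S \<Longrightarrow> ?r s = d \<Longrightarrow> radial_singularity \<omega> s (d - 1)"
    and ind: "\<And>s. s \<in> S \<Longrightarrow> index_at l s (z s)" and z0: "\<And>s. s \<in> S \<Longrightarrow> z s \<noteq> 0"
    using reduced_convex_line[OF extremal inv, folded S_def] by blast
  let ?D = "of_nat d :: complex"
  have D: "?D \<noteq> 0" "1 - ?D \<noteq> 0" "?D - 1 \<noteq> 0" and D1: "of_nat (d - 1) = ?D - 1"
    using d2 by (auto simp: of_nat_diff)
  have zvals: "z s = 1 \<or> z s = 1 - ?D \<or> z s = 1 / (1 - ?D)" if "s \<in> S" for s
  proof (cases "z s = 1")
    case False
    have "z s \<in> CS \<omega>" unfolding CS_iff
      using False that z0[OF that] ind[OF that] inv index_at_imp_camacho_sad(1)[OF inv _ ind[OF that] z0[OF that]]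
      unfolding S_def by blast
    then show ?thesis using CS_sub by blast
  qed simp
  \<comment> \<open>\<open>n s\<close> is \<open>(d - 1) (1 - z s) / d\<close>, a natural number in
    all cases, so the index formula becomes an identity of natural numbers. For \<open>d = 2\<close>
    the two exceptional indices coincide, and so do the weights \<open>1\<close> and
    \<open>d - 1\<close>.\<close>
  define n where "n s = (if z s = 1 then 0 else if z s = 1 / (1 - ?D) then 1 else d - 1)" for s
  have n: "(?D - 1) * (1 - z s) = ?D * of_nat (n s)" if s: "s \<in> S" for s
  proof -
    consider "z s = 1" | "z s \<noteq> 1" "z s = 1 / (1 - ?D)" | "z s \<noteq> 1" "z s \<noteq> 1 / (1 - ?D)" "z s = 1 - ?D"
      using zvals[OF s] by blast
    then show ?thesis
    proof cases
      case 2
      have "(?D - 1) * (1 - 1 / (1 - ?D)) = ?D" using D by (simp add: field_simps)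
      then show ?thesis using 2 by (simp add: n_def)
    qed (simp_all add: n_def D1 mult.commute)
  qed
  have "(\<Sum>s\<in>S. ?D * of_nat (n s)) = (?D - 1) * (\<Sum>s\<in>S. 1 - z s)"
    unfolding sum_distrib_left using n by (intro sum.cong) auto
  also have "(\<Sum>s\<in>S. 1 - z s) = ?D" using S sz by (simp add: sum_subtractf)
  also have "(?D - 1) * ?D = ?D * of_nat (d - 1)" unfolding D1 by (rule mult.commute)
  finally have "of_nat (\<Sum>s\<in>S. n s) = (of_nat (d - 1) :: complex)"
    using D by (simp add: sum_distrib_left[symmetric])
  then have sn: "(\<Sum>s\<in>S. n s) = d - 1" by (simp only: of_nat_eq_iff)
  define N where "N = {s \<in> S. z s \<noteq> 1}"
  have fN: "finite N" "N \<subseteq> S" unfolding N_def using S by auto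
  have rN: "?r s = 1" if "s \<in> N" for s
    using that r1[of s] r2[of s] unfolding N_def by fastforce
  show ?thesis
  proof (cases "\<forall>s\<in>N. z s = 1 / (1 - ?D)")
    case True
    \<comment> \<open>\<open>N\<close> consists of \<open>d - 1\<close> points with one further line
      each, so the two other points share \<open>2 d\<close> further lines, at most \<open>d\<close>
      each.\<close>
    have "(\<Sum>s\<in>S. n s) = (\<Sum>s\<in>N. 1)"
      using True S(2) fN by (intro sum.mono_neutral_cong_right) (auto simp: n_def N_def)
    then have cN: "card N = d - 1" using sn by simp
    then have "card (S - N) = 2" using S card_Diff_subset[OF fN] d2 by simp
    then obtain s1 s2 where s12: "S - N = {s1, s2}" "s1 \<noteq> s2" unfolding card_2_iff by blast
    have "(\<Sum>s\<in>S. ?r s) = (\<Sum>s\<in>N. ?r s) + (\<Sum>s\<in>S - N. ?r s)"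
      using sum.subset_diff[OF fN(2) S(2), of ?r] by simp
    also have "(\<Sum>s\<in>N. ?r s) = d - 1" using rN cN by simp
    also have "(\<Sum>s\<in>S - N. ?r s) = ?r s1 + ?r s2" unfolding s12(1) using s12(2) by simp
    finally have sum2: "?r s1 + ?r s2 = 2 * d" using sr d2 by linarith
    have mem: "s1 \<in> S" "s2 \<in> S" using s12(1) by auto
    then have r12: "?r s1 = d" "?r s2 = d" using sum2 rd[OF mem(1)] rd[OF mem(2)] by linarith+
    have "s1 \<subseteq> l" "s2 \<subseteq> l" using mem unfolding S_def by auto
    then have "base_line l" unfolding base_line_def
      using s12(2) r12 rad[OF mem(1) r12(1)] rad[OF mem(2) r12(2)] by blast
    then show ?thesis ..
  next
    case False
    then obtain s0 where s0: "s0 \<in> N" "z s0 \<noteq> 1 / (1 - ?D)" by blast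
    then have s0S: "s0 \<in> S" and z0: "z s0 = 1 - ?D" using zvals unfolding N_def by auto
    \<comment> \<open>One point of weight \<open>d - 1\<close> exhausts the sum, so all other
      indices are 1.\<close>
    have "n s0 = d - 1" using s0 by (simp add: n_def N_def)
    then have "(\<Sum>s\<in>S - {s0}. n s) = 0" using sn sum.remove[OF S(2) s0S, of n] by simp
    then have others: "z s = 1" if "s \<in> S" "s \<noteq> s0" for s
      using that S(2) d2 by (auto simp: n_def split: if_splits)
    have "\<not> index_at l t (1 / (1 - ?D))" if t: "singular_point \<omega> t" "t \<subseteq> l" for t
    proof
      assume i: "index_at l t (1 / (1 - ?D))"
      have tS: "t \<in> S" using t unfolding S_def by blast
      have zt: "z t = 1 / (1 - ?D)" using index_at_unique[OF inv t(1) ind[OF tS] i] .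
      then have "z t \<noteq> 1" using D by simp
      then show False using others[OF tS] zt s0(2) by metis
    qed
    then show ?thesis using ind[OF s0S] rN[OF s0(1)] s0S z0 unfolding S_def by auto
  qed
qed

text \<open>At the point of index \<open>1 - d\<close> the only other invariant line has the inverse
  index, which \<open>line_types\<close> forbids unless it is a base line.\<close>

lemma partner_line:
  assumes inv: "invariant_line \<omega> l" and nb: "\<not> base_line l"
  obtains s l' where "singular_point \<omega> s" "s \<subseteq> l" "s \<subseteq> l'" "invariant_line \<omega> l'" "l' \<noteq> l"
    "card (lines_through s - {l}) = 1" "base_line l'"
proof -
  obtain s where s: "singular_point \<omega> s" "s \<subseteq> l" "card (lines_through s - {l}) = 1"
    "index_at l s (1 - of_nat d)"
    using line_types[OF inv] nb by blast
  then obtain l' where "lines_through s - {l} = {l'}" by (rule_tac card_1_singletonE)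
  then have l': "invariant_line \<omega> l'" "s \<subseteq> l'" "l' \<noteq> l" unfolding lines_through_def by auto
  obtain z where z: "index_at l' s (z s)"
    using reduced_convex_line[OF extremal l'(1)] s(1) l'(2) by (smt (verit, ccfv_threshold) mem_Collect_eq)
  have "(1 - of_nat d) * z s = 1"
    using index_at_product[OF inv l'(1) l'(3)[symmetric] s(1,4) z] .
  then have "z s = 1 / (1 - of_nat d)" by (metis mult_zero_left nonzero_mult_div_cancel_left zero_neq_one)
  then have "base_line l'" using line_types[OF l'(1)] z s(1) l'(2) by metis
  then show ?thesis using that s l' by blast
qed

text \<open>\<open>partner_line\<close> supplies a first base line \<open>l0\<close>. A further line
  \<open>L\<close> through its point \<open>s1\<close> is a base line different from
  \<open>l0\<close>, or else its partner is one.\<close>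

theorem three_radial_singularities:
  "\<exists>s1 s2 s3. s1 \<noteq> s2 \<and> s1 \<noteq> s3 \<and> s2 \<noteq> s3 \<and> radial_singularity \<omega> s1 (d - 1) \<and>
     radial_singularity \<omega> s2 (d - 1) \<and> radial_singularity \<omega> s3 (d - 1)"
proof -
  have pl: "proj_line l" if "invariant_line \<omega> l" for l using that unfolding invariant_line_def by blast
  have pp: "proj_point s" if "singular_point \<omega> s" for s using that unfolding singular_point_def by blast
  have rs: "singular_point \<omega> s" if "radial_singularity \<omega> s (d - 1)" for s
    using that unfolding radial_singularity_def by blast
  have "{l. invariant_line \<omega> l} \<noteq> {}" using extremal d2 by (intro notI) simp
  then obtain l where "invariant_line \<omega> l" by blast
  then obtain l0 where l0: "invariant_line \<omega> l0" "base_line l0" using partner_line by metis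
  then obtain s1 s2 where s: "s1 \<noteq> s2" "s1 \<subseteq> l0" "s2 \<subseteq> l0" "card (lines_through s1 - {l0}) = d"
    "radial_singularity \<omega> s1 (d - 1)" "radial_singularity \<omega> s2 (d - 1)"
    unfolding base_line_def by blast
  have "lines_through s1 - {l0} \<noteq> {}" using s(4) d2 by (intro notI) simp
  then obtain L where L: "L \<in> lines_through s1" "L \<noteq> l0" by blast
  then have Li: "invariant_line \<omega> L" "s1 \<subseteq> L" unfolding lines_through_def by auto
  have "\<exists>l1. invariant_line \<omega> l1 \<and> base_line l1 \<and> l1 \<noteq> l0"
  proof (cases "base_line L")
    case True
    then show ?thesis using Li L by blast
  next
    case False
    obtain s0 l1 where l1: "singular_point \<omega> s0" "s0 \<subseteq> L" "s0 \<subseteq> l1" "invariant_line \<omega> l1"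
      "card (lines_through s0 - {L}) = 1" "base_line l1"
      by (rule partner_line[OF Li(1) False])
    \<comment> \<open>If the partner were \<open>l0\<close>, it would meet \<open>L\<close> in
      \<open>s1\<close>, through which \<open>d \<ge> 2\<close> lines pass besides \<open>L\<close>,
      not one.\<close>
    have "l1 \<noteq> l0"
    proof
      assume "l1 = l0"
      then have "s0 = s1"
        using two_points_one_line[OF pl[OF Li(1)] pl[OF l0(1)] L(2) pp[OF l1(1)] pp[OF rs[OF s(5)]]]
          l1 s Li by blast
      moreover have "l0 \<in> lines_through s1" using l0 s unfolding lines_through_def by blast
      then have "card (lines_through s1 - {l0}) = card (lines_through s1 - {L})"
        using L(1) finite_lines_through by simp
      ultimately show False using l1(5) s(4) d2 by simp
    qed
    then show ?thesis using l1 by blast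
  qed
  then obtain l1 where l1: "invariant_line \<omega> l1" "base_line l1" "l1 \<noteq> l0" by blast
  then obtain t1 t2 where t: "t1 \<noteq> t2" "t1 \<subseteq> l1" "t2 \<subseteq> l1"
    "radial_singularity \<omega> t1 (d - 1)" "radial_singularity \<omega> t2 (d - 1)"
    unfolding base_line_def by blast
  have "\<not> (s1 \<subseteq> l1 \<and> s2 \<subseteq> l1)"
    using two_points_one_line[OF pl[OF l1(1)] pl[OF l0(1)] l1(3) pp[OF rs[OF s(5)]] pp[OF rs[OF s(6)]]] s
    by blast
  then have "t1 \<notin> {s1, s2} \<or> t2 \<notin> {s1, s2}" using t by blast
  then show ?thesis using s t by blast
qed

end

end

section \<open>Three radial singularities\<close>

context foliation_form
begin

text \<open>Invariance along \<open>p\<close> and the Euler relation give \<open>\<omega> (p + t w)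
  \<star> w = - t ^ d (\<omega> w \<star> p)\<close>, with zero derivative at \<open>t = 0\<close>
  since \<open>d \<ge> 2\<close>. So \<open>lin p\<close> is alternating and determined by a single
  value.\<close>

lemma radial_at_lin:
  assumes r: "radial_at p" and fr: "frame p e f"
  shows "lin p e f \<noteq> 0"
proof
  assume ef: "lin p e f = 0"
  have wp: "\<omega> p = 0" using r unfolding radial_at_def by blast
  have ww: "lin p w w = 0" for w
  proof (rule lin_eqI)
    have "\<omega> (p + t *s w) \<star> w = - (t ^ d * (\<omega> w \<star> p))" for t
    proof (cases "t = 0")
      case False
      have "\<omega> (t *s w + 1 *s p) \<star> p = \<omega> (t *s w) \<star> p" using r unfolding radial_at_def by blast
      then have "\<omega> (p + t *s w) \<star> p = t ^ Suc d * (\<omega> w \<star> p)"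
        by (simp add: add.commute scale star_simps)
      moreover have "\<omega> (p + t *s w) \<star> p + t * (\<omega> (p + t *s w) \<star> w) = 0"
        using euler[of "p + t *s w"] by (simp add: star_simps)
      ultimately have "t * (t ^ d * (\<omega> w \<star> p) + \<omega> (p + t *s w) \<star> w) = 0"
        by (simp add: algebra_simps)
      then have "t ^ d * (\<omega> w \<star> p) + \<omega> (p + t *s w) \<star> w = 0" using False by simp
      then show ?thesis by (simp add: add_eq_0_iff)
    qed (use wp d2 in \<open>simp add: star_simps\<close>)
    moreover have "((\<lambda>t. - (t ^ d * (\<omega> w \<star> p))) has_field_derivative 0) (at 0)"
      by (rule derivative_eq_intros refl)+ (use d2 in auto)
    ultimately show "((\<lambda>t. \<omega> (p + t *s w) \<star> w) has_field_derivative 0) (at 0)" by simp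
  qed
  have anti: "lin p v w = - lin p w v" for v w
    using ww[of "v + w"] ww[of v] ww[of w] by (simp add: eq_neg_iff_add_eq_0 add.commute)
  have "lin p v w = 0" for v w
  proof -
    obtain x y z where v: "v = x *s p + y *s e + z *s f" by (rule frame_coords[OF fr])
    obtain x' y' z' where w: "w = x' *s p + y' *s e + z' *s f" by (rule frame_coords[OF fr])
    have "lin p f e = 0" using anti[of f e] ef by simp
    then show ?thesis unfolding v w
      using ww ef lin_base_left[OF wp] lin_base_right[of p] wp by (simp add: star_zero_left)
  qed
  then show False using r unfolding radial_at_def by blast
qed

lemma radial_at_shift: "radial_at p \<Longrightarrow> \<omega> (x *s p + v) \<star> p = \<omega> v \<star> p"
  unfolding radial_at_def by (metis add.commute)

lemma additive_poly:
  fixes g :: "complex poly"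
  assumes "\<And>x s. poly g (x + s) = poly g x + poly g s - poly g 0"
  obtains a b where "g = [:a, b:]"
proof -
  have "poly (pderiv g) x = poly (pderiv g) 0" for x
  proof -
    have "((\<lambda>s. poly g (s + x)) has_field_derivative poly (pderiv g) x) (at 0)"
      using poly_DERIV[of g x] DERIV_shift[of "poly g" "poly (pderiv g) x" 0 x] by (simp only: add_0)
    moreover have "((\<lambda>s. poly g x + poly g s - poly g 0) has_field_derivative poly (pderiv g) 0) (at 0)"
      by (rule derivative_eq_intros poly_DERIV refl)+ simp
    ultimately show ?thesis using DERIV_unique by (simp add: assms add.commute)
  qed
  then have "pderiv g = [:poly (pderiv g) 0:]"
    by (intro poly_eq_poly_eq_iff[THEN iffD1] ext) simp
  then have "degree (pderiv g) = 0" by (metis degree_pCons_0)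
  then have "degree g \<le> 1" by (simp add: degree_pderiv)
  then show ?thesis using that degree1_coeffs degree_0_id
    by (metis One_nat_def le_SucE le_zero_eq pCons_0_0)
qed

text \<open>Invariance along \<open>p1\<close> and \<open>p2\<close> makes two contractions depend
  on one variable each, and invariance along \<open>p3\<close> makes \<open>g\<close> affine.
  Homogenised, \<open>g\<close> gives \<open>t ^ (d + 1) g0 + t ^ d g1\<close>, whose derivative at
  0 vanishes as \<open>d \<ge> 2\<close>; this contradicts \<open>radial_at_lin\<close>.\<close>

lemma radial_points_not_aligned:
  assumes r: "radial_at p1" "radial_at p2" "radial_at p3"
    and fr: "frame p1 p2 f" and p3: "p3 = a *s p1 + b *s p2" and ab: "a \<noteq> 0" "b \<noteq> 0"
  shows False
proof -
  obtain g where g: "\<And>x. \<omega> (x *s p1 + f) \<star> p2 = poly g x" using hom_poly_line[OF hom_star] by blast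
  obtain h where h: "\<And>y. \<omega> (y *s p2 + f) \<star> p1 = poly h y" using hom_poly_line[OF hom_star] by blast
  have C: "\<omega> (x *s p1 + y *s p2 + f) \<star> p3 = a * poly h y + b * poly g x" for x y
  proof -
    have "\<omega> (x *s p1 + y *s p2 + f) \<star> p1 = poly h y"
      using radial_at_shift[OF r(1), of x "y *s p2 + f"] by (simp add: h add.assoc)
    moreover have "\<omega> (x *s p1 + y *s p2 + f) \<star> p2 = poly g x"
      using radial_at_shift[OF r(2), of y "x *s p1 + f"] g[of x] by (simp add: add_ac)
    ultimately show ?thesis by (simp add: p3 star_simps)
  qed
  have inv: "a * poly h (b * t) + b * poly g (x + a * t) = a * poly h 0 + b * poly g x" for x t
  proof -
    have "t *s p3 + (x *s p1 + 0 *s p2 + f) = (x + a * t) *s p1 + (b * t) *s p2 + f"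
      unfolding p3 by (simp add: vec_eq_iff algebra_simps)
    then have "\<omega> ((x + a * t) *s p1 + (b * t) *s p2 + f) \<star> p3 = \<omega> (x *s p1 + 0 *s p2 + f) \<star> p3"
      using radial_at_shift[OF r(3), of t "x *s p1 + 0 *s p2 + f"] by metis
    then show ?thesis unfolding C .
  qed
  have "poly g (x + s) = poly g x + poly g s - poly g 0" for x s
  proof -
    \<comment> \<open>Between the instances of \<open>inv\<close> at \<open>x\<close> and at
      \<open>0\<close> the terms with \<open>h\<close> cancel.\<close>
    have "b * (poly g (x + s) - poly g x) = b * (poly g s - poly g 0)"
      using inv[of "s / a" x] inv[of "s / a" 0] ab(1) by (simp add: algebra_simps) algebra
    then have "poly g (x + s) - poly g x = poly g s - poly g 0" using ab(2) by simp
    then show ?thesis by (simp add: algebra_simps)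
  qed
  then obtain g0 g1 where gg: "g = [:g0, g1:]" by (rule additive_poly)
  have w1: "\<omega> p1 = 0" using r(1) unfolding radial_at_def by blast
  have "lin p1 f p2 = 0"
  proof (rule lin_eqI)
    have "\<omega> (p1 + t *s f) \<star> p2 = t ^ Suc d * g0 + t ^ d * g1" for t
    proof (cases "t = 0")
      case False
      then have "p1 + t *s f = t *s ((1 / t) *s p1 + f)" by (simp add: vec_eq_iff algebra_simps)
      then have "\<omega> (p1 + t *s f) \<star> p2 = t ^ Suc d * poly g (1 / t)"
        by (simp only: scale star_simps g)
      then show ?thesis using False by (simp add: gg distrib_left)
    qed (use w1 d2 in \<open>simp add: star_simps\<close>)
    moreover have "((\<lambda>t. t ^ Suc d * g0 + t ^ d * g1) has_field_derivative 0) (at 0)"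
      by (rule derivative_eq_intros refl)+ (use d2 in \<open>auto simp: power_0_left\<close>)
    ultimately show "((\<lambda>t. \<omega> (p1 + t *s f) \<star> p2) has_field_derivative 0) (at 0)" by simp
  qed
  then show False using radial_at_lin[OF r(1), of f p2] fr frame_swap by blast
qed

text \<open>The matrix with columns \<open>p\<close>, \<open>q\<close>, \<open>r\<close> pulls
  \<open>\<omega>\<close> back to \<open>k\<close> times the Fermat form, written in a cyclically
  symmetric way.\<close>

definition fermat_frame where
  "fermat_frame p q r k \<longleftrightarrow> frame p q r \<and> k \<noteq> 0 \<and> (\<forall>x y z.
     \<omega> (x *s p + y *s q + z *s r) \<star> p = k * (y * z ^ d - z * y ^ d) \<and>
     \<omega> (x *s p + y *s q + z *s r) \<star> q = k * (z * x ^ d - x * z ^ d) \<and>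
     \<omega> (x *s p + y *s q + z *s r) \<star> r = k * (x * y ^ d - y * x ^ d))"

text \<open>Each contraction is independent of its own coordinate. The Euler relation at
  \<open>z = 1\<close> expresses the third through \<open>f\<close> and \<open>g\<close>, and its
  homogeneity in \<open>(x, y)\<close> leaves these only the degrees \<open>1\<close> and
  \<open>d\<close>.\<close>

lemma radial_normal_form:
  assumes r: "radial_at p1" "radial_at p2" "radial_at p3" and fr: "frame p1 p2 p3"
  obtains a b c where "a \<noteq> 0" "b \<noteq> 0" "c \<noteq> 0"
    "\<And>x y z. \<omega> (x *s p1 + y *s p2 + z *s p3) \<star> p1 = a * y * z ^ d + b * y ^ d * z"
    "\<And>x y z. \<omega> (x *s p1 + y *s p2 + z *s p3) \<star> p2 = c * x ^ d * z - a * x * z ^ d"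
    "\<And>x y z. \<omega> (x *s p1 + y *s p2 + z *s p3) \<star> p3 = - b * x * y ^ d - c * x ^ d * y"
proof -
  have w: "\<omega> p1 = 0" "\<omega> p2 = 0" "\<omega> p3 = 0" using r unfolding radial_at_def by auto
  obtain f where f: "\<And>y. \<omega> (y *s p2 + p3) \<star> p1 = poly f y" using hom_poly_line[OF hom_star] by blast
  obtain g where g: "\<And>x. \<omega> (x *s p1 + p3) \<star> p2 = poly g x" using hom_poly_line[OF hom_star] by blast
  let ?v = "\<lambda>x y z. x *s p1 + y *s p2 + z *s p3"
  have 1: "\<omega> (?v x y z) \<star> p1 = \<omega> (y *s p2 + z *s p3) \<star> p1" for x y z
    using radial_at_shift[OF r(1), of x "y *s p2 + z *s p3"] by (simp add: add.assoc)
  have 2: "\<omega> (?v x y z) \<star> p2 = \<omega> (x *s p1 + z *s p3) \<star> p2" for x y z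
    using radial_at_shift[OF r(2), of y "x *s p1 + z *s p3"] by (simp add: add_ac)
  have 3: "\<omega> (?v x y z) \<star> p3 = \<omega> (?v x y 1) \<star> p3" for x y z
    using radial_at_shift[OF r(3), of z "x *s p1 + y *s p2"]
      radial_at_shift[OF r(3), of 1 "x *s p1 + y *s p2"] by (simp add: add_ac)
  have f0: "poly f 0 = 0" and g0: "poly g 0 = 0" using f[of 0] g[of 0] w by (simp_all add: star_simps)
  have K: "\<omega> (?v x y 1) \<star> p3 = - x * poly f y - y * poly g x" for x y
  proof -
    have "x * (\<omega> (?v x y 1) \<star> p1) + y * (\<omega> (?v x y 1) \<star> p2) + \<omega> (?v x y 1) \<star> p3 = 0"
      using euler[of "?v x y 1"] by (simp add: star_simps)
    then show ?thesis unfolding 1 2 by (simp add: f g) algebra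
  qed
  have hom_K: "t * x * poly f t + t * poly g (t * x) = t ^ Suc d * (x * poly f 1 + poly g x)" for t x
  proof -
    have e: "?v (t * x) t t = t *s ?v x 1 1" by (simp add: vec_eq_iff algebra_simps)
    have "\<omega> (?v (t * x) t 1) \<star> p3 = t ^ Suc d * (\<omega> (?v x 1 1) \<star> p3)"
      unfolding 3[of "t * x" t t, symmetric] e by (simp only: scale star_simps)
    then show ?thesis unfolding K by (simp add: algebra_simps)
  qed
  \<comment> \<open>The coefficient of \<open>x ^ k\<close> in \<open>hom_K\<close>. Below,
    \<open>t = 2\<close> is enough to separate the degrees, since its powers are distinct.\<close>
  have g_coeff: "t * poly f t * (if k = 1 then 1 else 0) + t ^ Suc k * coeff g k =
      t ^ Suc d * ((if k = 1 then poly f 1 else 0) + coeff g k)" for t k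
  proof -
    have "smult (t * poly f t) [:0, 1:] + smult t (pcompose g [:0, t:]) =
        smult (t ^ Suc d) (smult (poly f 1) [:0, 1:] + g)"
      by (intro poly_eq_poly_eq_iff[THEN iffD1] ext)
        (use hom_K[of t] in \<open>simp add: poly_pcompose algebra_simps\<close>)
    then have "coeff (smult (t * poly f t) [:0, 1:] + smult t (pcompose g [:0, t:])) k =
        coeff (smult (t ^ Suc d) (smult (poly f 1) [:0, 1:] + g)) k" by simp
    moreover have "coeff (pcompose g [:0, t:]) k = t ^ k * coeff g k" by (rule coeff_pcompose_linear)
    ultimately show ?thesis by (cases k; cases "k - 1") (auto simp: coeff_pCons algebra_simps)
  qed
  define a where "a = - coeff g 1"
  define b where "b = poly f 1 - a"
  define c where "c = coeff g d"
  have gk: "coeff g k = 0" if "k \<noteq> 1" "k \<noteq> d" for k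
  proof -
    have "(2::complex) ^ Suc k * coeff g k = 2 ^ Suc d * coeff g k"
      using g_coeff[of 2 k] that by simp
    moreover have "(2::complex) ^ Suc k \<noteq> 2 ^ Suc d"
    proof
      assume "(2::complex) ^ Suc k = 2 ^ Suc d"
      then have "of_nat (2 ^ Suc k) = (of_nat (2 ^ Suc d) :: complex)" by simp
      then have "(2::nat) ^ Suc k = 2 ^ Suc d" by (simp only: of_nat_eq_iff)
      then show False using that by simp
    qed
    ultimately show ?thesis by simp
  qed
  have "g = monom c d - monom a 1"
    by (rule poly_eqI) (use gk d2 in \<open>auto simp: a_def c_def\<close>)
  then have g': "poly g x = c * x ^ d - a * x" for x by (simp add: poly_monom)
  have f': "poly f t = b * t ^ d + a * t" for t
  proof (cases "t = 0")
    case False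
    have "t * poly f t + t * (t * coeff g 1) = t * (t ^ d * (poly f 1 + coeff g 1))"
      using g_coeff[of t 1] by (simp add: mult.assoc)
    then have "t * (poly f t + t * coeff g 1) = t * (t ^ d * (poly f 1 + coeff g 1))"
      by (simp add: algebra_simps)
    then have "poly f t + t * coeff g 1 = t ^ d * (poly f 1 + coeff g 1)"
      using False mult_left_cancel by blast
    then show ?thesis by (simp add: a_def b_def algebra_simps)
  qed (use f0 d2 in simp)
  \<comment> \<open>\<open>f\<close> and \<open>g\<close> describe the slice \<open>z = 1\<close>;
    homogeneity restores \<open>z\<close>, and for \<open>z = 0\<close> both sides vanish.\<close>
  have homogenize: "\<omega> (y *s u + z *s p3) \<star> w = b * y ^ d * z + a * y * z ^ d"
    if uw: "\<And>y. \<omega> (y *s u + p3) \<star> w = b * y ^ d + a * y" "\<omega> u = 0" for u w a b y z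
  proof (cases "z = 0")
    case True
    then show ?thesis using d2 uw(2) by (simp add: scale star_simps)
  next
    case False
    then have "y *s u + z *s p3 = z *s ((y / z) *s u + p3)" by (simp add: vec_eq_iff field_simps)
    then have "\<omega> (y *s u + z *s p3) \<star> w = z ^ Suc d * (b * (y / z) ^ d + a * (y / z))"
      by (simp only: scale star_simps uw(1))
    also have "\<dots> = b * y ^ d * z + a * y * z ^ d" using False by (simp add: field_simps power_divide)
    finally show ?thesis .
  qed
  have C1: "\<omega> (?v x y z) \<star> p1 = a * y * z ^ d + b * y ^ d * z" for x y z
    unfolding 1 using homogenize[of p2 p1 b a, OF _ w(2)] by (simp add: f f')
  have C2: "\<omega> (?v x y z) \<star> p2 = c * x ^ d * z - a * x * z ^ d" for x y z
    unfolding 2 using homogenize[of p1 p2 c "- a", OF _ w(1)] by (simp add: g g')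
  have C3: "\<omega> (?v x y z) \<star> p3 = - b * x * y ^ d - c * x ^ d * y" for x y z
    unfolding 3[of x y z] K f' g' by (simp add: algebra_simps)
  have der: "((\<lambda>t. u * t + u' * t ^ d) has_field_derivative u) (at 0)" for u u' :: complex
    by (rule derivative_eq_intros refl)+ (use d2 in auto)
  \<comment> \<open>Each of \<open>c\<close>, \<open>b\<close>, \<open>a\<close> is an entry of the
    linear part at one of the radial points, hence non-zero by \<open>radial_at_lin\<close>.\<close>
  have "lin p1 p3 p2 = c"
    by (rule lin_eqI) (use der[of c "- a"] C2[of 1 0] in simp)
  then have "c \<noteq> 0" using radial_at_lin[OF r(1), of p3 p2] fr frame_swap by blast
  moreover have "lin p2 p3 p1 = b"
    by (rule lin_eqI) (use der[of b a] C1[of 0 1] in \<open>simp add: add.commute\<close>)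
  then have "b \<noteq> 0" using radial_at_lin[OF r(2), of p3 p1] fr frame_rotate by blast
  moreover have "lin p3 p2 p1 = a"
    by (rule lin_eqI) (use der[of a b] C1[of 0 _ 1] in \<open>simp add: add.commute\<close>)
  then have "a \<noteq> 0" using radial_at_lin[OF r(3), of p2 p1] fr frame_rotate frame_swap by blast
  ultimately show ?thesis using that C1 C2 C3 by blast
qed

text \<open>Rescaling the frame by \<open>(d - 1)\<close>-th roots of \<open>1 / c\<close>,
  \<open>- 1 / b\<close> and \<open>1 / a\<close> turns every coefficient into \<open>l m n\<close>
  up to sign.\<close>

lemma radial_imp_fermat_frame:
  assumes r: "radial_at p1" "radial_at p2" "radial_at p3" and fr: "frame p1 p2 p3"
  obtains q1 q2 q3 k where "fermat_frame q1 q2 q3 k"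
proof -
  obtain a b c where abc: "a \<noteq> 0" "b \<noteq> 0" "c \<noteq> 0"
    and C: "\<And>x y z. \<omega> (x *s p1 + y *s p2 + z *s p3) \<star> p1 = a * y * z ^ d + b * y ^ d * z"
    "\<And>x y z. \<omega> (x *s p1 + y *s p2 + z *s p3) \<star> p2 = c * x ^ d * z - a * x * z ^ d"
    "\<And>x y z. \<omega> (x *s p1 + y *s p2 + z *s p3) \<star> p3 = - b * x * y ^ d - c * x ^ d * y"
    by (rule radial_normal_form[OF r fr]) blast
  have d1: "d - 1 \<noteq> 0" "d = Suc (d - 1)" using d2 by auto
  obtain l where l: "1 / c = l ^ (d - 1)" using exists_complex_root[OF d1(1)] by metis
  obtain m where m: "- 1 / b = m ^ (d - 1)" using exists_complex_root[OF d1(1)] by metis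
  obtain n where n: "1 / a = n ^ (d - 1)" using exists_complex_root[OF d1(1)] by metis
  have nz: "l \<noteq> 0" "m \<noteq> 0" "n \<noteq> 0" using l m n abc d1(1) by (auto simp: power_0_left)
  have pw: "c * l ^ d = l" "b * m ^ d = - m" "a * n ^ d = n"
  proof -
    have "l ^ d = l * l ^ (d - 1)" "m ^ d = m * m ^ (d - 1)" "n ^ d = n * n ^ (d - 1)"
      using d1(2) by (metis power_Suc)+
    then show "c * l ^ d = l" "b * m ^ d = - m" "a * n ^ d = n"
      unfolding l[symmetric] m[symmetric] n[symmetric] using abc by simp_all
  qed
  have "l * (a * (y * m) * (z ^ d * n ^ d) + b * (y ^ d * m ^ d) * (z * n)) =
        l * (y * m * z ^ d * (a * n ^ d) + y ^ d * z * n * (b * m ^ d))"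
      "m * (c * (x ^ d * l ^ d) * (z * n) - a * (x * l) * (z ^ d * n ^ d)) =
        m * (x ^ d * z * n * (c * l ^ d) - x * l * z ^ d * (a * n ^ d))"
      "n * (- b * (x * l) * (y ^ d * m ^ d) - c * (x ^ d * l ^ d) * (y * m)) =
        n * (- (x * l * y ^ d * (b * m ^ d)) - x ^ d * y * m * (c * l ^ d))"
    for x y z by algebra+
  note e = this[unfolded pw]
  have "frame (l *s p1) (m *s p2) (n *s p3)"
  proof (rule frameI)
    fix x u w assume "x *s (l *s p1) + u *s (m *s p2) + w *s (n *s p3) = 0"
    then have "(x * l) *s p1 + (u * m) *s p2 + (w * n) *s p3 = 0" by simp
    from frame_indep[OF fr this] show "x = 0 \<and> u = 0 \<and> w = 0" using nz by simp
  qed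
  moreover have "\<omega> (x *s (l *s p1) + y *s (m *s p2) + z *s (n *s p3)) \<star> (l *s p1) = (l * m * n) * (y * z ^ d - z * y ^ d)"
    "\<omega> (x *s (l *s p1) + y *s (m *s p2) + z *s (n *s p3)) \<star> (m *s p2) = (l * m * n) * (z * x ^ d - x * z ^ d)"
    "\<omega> (x *s (l *s p1) + y *s (m *s p2) + z *s (n *s p3)) \<star> (n *s p3) = (l * m * n) * (x * y ^ d - y * x ^ d)" for x y z
    unfolding vector_smult_assoc star_scale_right C power_mult_distrib e by (simp_all add: algebra_simps)
  ultimately have "fermat_frame (l *s p1) (m *s p2) (n *s p3) (l * m * n)"
    unfolding fermat_frame_def using nz by auto
  then show ?thesis by (rule that)
qed

text \<open>The entries of the pullback are the contractions of \<open>\<omega>\<close> with the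
  columns of the matrix, and any frame occurs as the columns of an invertible matrix.\<close>

lemma linearly_conjugated_iff:
  "linearly_conjugated \<omega> (fermat_form d) \<longleftrightarrow> (\<exists>p q r k. fermat_frame p q r k)"
proof -
  have d1: "d = Suc (d - 1)" using d2 by simp
  have ff: "fermat_form d v = vector [v $ 2 * v $ 3 ^ d - v $ 3 * v $ 2 ^ d,
      v $ 3 * v $ 1 ^ d - v $ 1 * v $ 3 ^ d, v $ 1 * v $ 2 ^ d - v $ 2 * v $ 1 ^ d]" for v
  proof -
    have "v $ 3 ^ d = v $ 3 * v $ 3 ^ (d - 1)" using d1 by (metis power_Suc)
    then show ?thesis by (simp add: fermat_form_def Let_def algebra_simps)
  qed
  have mv: "A *v v = v $ 1 *s column 1 A + v $ 2 *s column 2 A + v $ 3 *s column 3 A"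
    for A :: "complex ^ 3 ^ 3" and v
    by (simp add: vec_eq_iff matrix_vector_mult_def sum_3 column_def mult.commute)
  have pb: "pullback_form A \<omega> v $ i = \<omega> (A *v v) \<star> column i A" for A v i
  proof -
    have "A *v axis i 1 = column i A" using exhaust_3[of i] by (auto simp: mv axis_def)
    moreover have "pullback_form A \<omega> v \<star> axis i 1 = pullback_form A \<omega> v $ i"
      using exhaust_3[of i] by (auto simp: star_expand axis_def)
    ultimately show ?thesis using scalar_product_pullback_form[of A \<omega> v "axis i 1"] by simp
  qed
  have inv: "invertible A \<longleftrightarrow> frame (column 1 A) (column 2 A) (column 3 A)" for A :: "complex ^ 3 ^ 3"
  proof -
    have "columns A = (\<lambda>i. column i A) ` UNIV" unfolding columns_def by auto
    also have "\<dots> = {column 1 A, column 2 A, column 3 A}" unfolding UNIV_3 by simp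
    finally have "columns A = {column 1 A, column 2 A, column 3 A}" .
    then show ?thesis unfolding frame_def invertible_right_inverse matrix_right_invertible_span_columns
      by simp
  qed
  have main: "same_foliation (pullback_form A \<omega>) (fermat_form d) \<and> invertible A \<longleftrightarrow>
      (\<exists>k. fermat_frame (column 1 A) (column 2 A) (column 3 A) k)" for A
  proof -
    have "(\<forall>v. pullback_form A \<omega> v = k *s fermat_form d v) \<longleftrightarrow> (\<forall>x y z.
      \<omega> (x *s column 1 A + y *s column 2 A + z *s column 3 A) \<star> column 1 A = k * (y * z ^ d - z * y ^ d) \<and>
      \<omega> (x *s column 1 A + y *s column 2 A + z *s column 3 A) \<star> column 2 A = k * (z * x ^ d - x * z ^ d) \<and>
      \<omega> (x *s column 1 A + y *s column 2 A + z *s column 3 A) \<star> column 3 A = k * (x * y ^ d - y * x ^ d))" for k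
      unfolding vec_eq_iff forall_3 pb mv ff vector_smult_component vector_3
    proof (intro iffI allI, goal_cases)
      case (1 x y z)
      from spec[OF this, of "vector [x, y, z]"] show ?case by simp
    qed simp
    then show ?thesis unfolding same_foliation_def fermat_frame_def inv by blast
  qed
  have "\<exists>A :: complex ^ 3 ^ 3. column 1 A = p \<and> column 2 A = q \<and> column 3 A = r" for p q r :: "complex ^ 3"
    by (rule exI[of _ "\<chi> i j. vector [p $ i, q $ i, r $ i] $ j"]) (simp add: column_def vec_eq_iff)
  then show ?thesis unfolding linearly_conjugated_def using main by metis
qed

end

section \<open>The degree\<close>

lemma proj_line_kernel:
  assumes "a \<noteq> 0"
  shows "proj_line {v. a \<star> v = 0}"
proof -
  obtain c where c: "a \<star> c \<noteq> 0"
  proof -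
    have "a \<star> axis i 1 = a $ i" for i using exhaust_3[of i] by (auto simp: star_expand axis_def)
    then show ?thesis using that assms by (metis vec_eq_iff zero_index)
  qed
  then have "c \<noteq> 0" by (auto simp: star_zero_right)
  then obtain e f where fr: "frame c e f" by (rule frame_extend_point)
  define e' where "e' = e + (- (a \<star> e) / (a \<star> c)) *s c"
  define f' where "f' = f + (- (a \<star> f) / (a \<star> c)) *s c"
  have ef: "a \<star> e' = 0" "a \<star> f' = 0" using c by (simp_all add: e'_def f'_def star_simps)
  have fr': "frame e' f' c"
  proof (rule frameI)
    fix x u w assume "x *s e' + u *s f' + w *s c = 0"
    then have "(x * (- (a \<star> e) / (a \<star> c)) + u * (- (a \<star> f) / (a \<star> c)) + w) *s c + x *s e + u *s f = 0"
      by (simp add: e'_def f'_def vec_eq_iff algebra_simps)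
    from frame_indep[OF fr this] show "x = 0 \<and> u = 0 \<and> w = 0" by auto
  qed
  have "{v. a \<star> v = 0} = vec.span {e', f'}"
  proof (intro equalityI subsetI)
    fix v assume "v \<in> {v. a \<star> v = 0}"
    moreover obtain x u w where v: "v = x *s e' + u *s f' + w *s c" by (rule frame_coords[OF fr'])
    ultimately have "w = 0" using c ef by (simp add: star_simps)
    then show "v \<in> vec.span {e', f'}" using v unfolding vec_span_2 by auto
  next
    fix v assume "v \<in> vec.span {e', f'}"
    then show "v \<in> {v. a \<star> v = 0}" unfolding vec_span_2 using ef by (auto simp: star_simps)
  qed
  then show ?thesis using frame_span_line[OF fr'] by simp
qed

context homogeneous_form
begin

text \<open>The line is not invariant: \<open>[q]\<close> is a point of it without tangency and
  serves as infinity for the parameter of \<open>p + t q\<close>.\<close>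

context
  fixes l p q
  assumes l: "proj_line l" "p \<in> l" "q \<in> l" and qp: "\<omega> q \<star> p \<noteq> 0"
begin

lemma q_nz: "q \<noteq> 0" and p_notin: "p \<notin> vec.span {q}"
proof -
  show "p \<notin> vec.span {q}"
    using qp euler[of q] unfolding vec_span_1 by (auto simp: star_simps)
  show "q \<noteq> 0" using qp form_zero by (auto simp: star_zero_left)
qed

lemma l_span: "l = vec.span {q, p}"
  using line_eq_span[OF l(1,3,2) q_nz p_notin] .

lemma frame_qp: obtains f where "frame p q f"
proof -
  obtain f where "frame q p f" using frame_extend q_nz p_notin by blast
  then show ?thesis using that frame_rotate frame_swap by blast
qed

text \<open>By the Euler relation the contraction with \<open>p\<close> is \<open>- t R\<close>; its
  coefficient of \<open>t ^ m\<close> is \<open>\<omega> q \<star> p\<close>, which fixes the degree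
  of \<open>R\<close>.\<close>

lemma restriction_poly:
  obtains R where "degree R = m - 1" "R \<noteq> 0" "0 < m"
    "\<And>t. \<omega> (p + t *s q) \<star> q = poly R t" "\<And>t. \<omega> (p + t *s q) \<star> p = - t * poly R t"
proof -
  obtain R where R: "\<And>t. \<omega> (t *s q + p) \<star> q = poly R t" using hom_poly_line[OF hom_star] by blast
  obtain T where T: "degree T \<le> m" "coeff T m = \<omega> q \<star> p" "\<And>t. \<omega> (t *s q + p) \<star> p = poly T t"
    using hom_poly_line[OF hom_star] by blast
  have e: "poly T t = - t * poly R t" for t
  proof -
    have "t * (\<omega> (t *s q + p) \<star> q) + \<omega> (t *s q + p) \<star> p = 0"
      using euler[of "t *s q + p"] by (simp only: star_add_right star_scale_right)
    then show ?thesis unfolding R T(3) by (simp add: eq_neg_iff_add_eq_0 add.commute)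
  qed
  then have TR: "T = pCons 0 (- R)"
    by (intro poly_eq_poly_eq_iff[THEN iffD1] ext) simp
  then have nz: "coeff (pCons 0 (- R)) m \<noteq> 0" using T(2) qp by simp
  then have "0 < m" by (cases m) auto
  moreover have "R \<noteq> 0" using nz by auto
  moreover have "degree R = m - 1"
  proof (rule antisym)
    show "degree R \<le> m - 1" using T(1) \<open>R \<noteq> 0\<close> by (simp add: TR)
    show "m - 1 \<le> degree R" using nz \<open>0 < m\<close> by (intro le_degree) (cases m; simp)
  qed
  ultimately show ?thesis using that R e T(3) by (metis add.commute)
qed

text \<open>Another choice of \<open>p'\<close> and \<open>q'\<close> reparametrises the line by the
  Moebius map \<open>Y z / X z\<close>, which sends \<open>0\<close> to \<open>t\<close>, and
  introduces factors that do not vanish at \<open>0\<close>.\<close>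

lemma zorder_restriction:
  assumes R: "R \<noteq> 0" "0 < m" "\<And>t. \<omega> (p + t *s q) \<star> q = poly R t" "\<And>t. \<omega> (p + t *s q) \<star> p = - t * poly R t"
    and p': "p' = k *s (p + t *s q)" "k \<noteq> 0" and q': "q' = a *s p + b *s q" "b - a * t \<noteq> 0"
  shows "zorder (\<lambda>z. \<omega> (p' + z *s q') \<star> q') 0 = int (order t R)"
proof -
  let ?n = "order t R"
  obtain r where r: "R = [:- t, 1:] ^ ?n * r" "\<not> [:- t, 1:] dvd r" using order_decomp[OF R(1)] by blast
  have rt: "poly r t \<noteq> 0" using r(2) poly_eq_0_iff_dvd by blast
  define X where "X z = k + z * a" for z
  define Y where "Y z = k * t + z * b" for z
  define S where "S = {z. X z \<noteq> 0}"
  let ?g = "\<lambda>z. k * (b - a * t) * X z ^ (m - 1) * ((b - a * t) / X z) ^ ?n * poly r (Y z / X z)"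
  have "open S" unfolding S_def X_def by (intro open_Collect_neq continuous_intros)
  moreover have "0 \<in> S" using p' by (simp add: S_def X_def)
  moreover have "?g holomorphic_on S"
    unfolding X_def Y_def by (intro holomorphic_intros) (auto simp: S_def X_def)
  moreover have "?g 0 \<noteq> 0" using p'(2) q'(2) rt by (simp add: X_def Y_def)
  moreover have "\<omega> (p' + z *s q') \<star> q' = ?g z * (z - 0) powi int ?n" if "z \<in> S" "z \<noteq> 0" for z
  proof -
    have X: "X z \<noteq> 0" using that S_def by blast
    let ?u = "Y z / X z"
    have "p' + z *s q' = X z *s p + Y z *s q"
      by (simp add: p' q' X_def Y_def vec_eq_iff algebra_simps)
    also have "\<dots> = X z *s (p + ?u *s q)" using X by (simp add: vec_eq_iff algebra_simps)
    finally have "\<omega> (p' + z *s q') \<star> q' = X z ^ m * (\<omega> (p + ?u *s q) \<star> q')"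
      by (simp only: scale star_scale_left)
    also have "\<omega> (p + ?u *s q) \<star> q' = a * (- ?u * poly R ?u) + b * poly R ?u"
      by (simp only: q'(1) star_add_right star_scale_right R(3,4))
    also have "X z ^ m * (a * (- ?u * poly R ?u) + b * poly R ?u) = X z ^ (m - 1) * (b * X z - a * Y z) * poly R ?u"
    proof -
      have "X z ^ m = X z ^ (m - 1) * X z" using R(2) by (metis power_minus_mult)
      moreover have "X z * (a * (- ?u * poly R ?u) + b * poly R ?u) = (b * X z - a * Y z) * poly R ?u"
        using X by (simp add: field_simps)
      ultimately show ?thesis by (simp add: mult.assoc)
    qed
    also have "b * X z - a * Y z = k * (b - a * t)" by (simp add: X_def Y_def algebra_simps)
    also have "poly R ?u = (?u - t) ^ ?n * poly r ?u" by (subst r(1)) (simp add: poly_power)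
    also have "?u - t = z * ((b - a * t) / X z)" using X by (simp add: field_simps) (simp add: X_def Y_def algebra_simps)
    finally show ?thesis by (simp only: power_mult_distrib) (simp add: mult_ac)
  qed
  ultimately show ?thesis by (rule zorder_eqI)
qed

lemma sum_tangency_orders: "(\<Sum>s\<in>tangency_points \<omega> l. tangency_order_with_line \<omega> l s) = int m - 1"
proof -
  obtain R where deg: "degree R = m - 1" and R: "R \<noteq> 0" "0 < m"
    "\<And>t. \<omega> (p + t *s q) \<star> q = poly R t" "\<And>t. \<omega> (p + t *s q) \<star> p = - t * poly R t"
    by (rule restriction_poly) blast
  obtain f where fr: "frame p q f" by (rule frame_qp)
  define s where "s t = vec.span {p + t *s q}" for t
  have pt: "p + t *s q \<noteq> 0" for t using frame_indep(1)[OF fr, of 1 t 0] by auto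
  have mem: "p + t *s q \<in> l" for t using proj_line_closed(1)[OF l, of 1 t] by simp
  have inj: "inj s"
  proof (rule injI)
    fix t t' assume "s t = s t'"
    then obtain k where "p + t *s q = k *s (p + t' *s q)" unfolding s_def using span_eq_scale pt by metis
    then have "1 *s p + t *s q + 0 *s f = k *s p + (k * t') *s q + 0 *s f"
      by (simp add: vec_eq_iff algebra_simps)
    from frame_unique[OF fr this] show "t = t'" by auto
  qed
  have TP: "tangency_points \<omega> l = s ` {t. poly R t = 0}"
  proof (intro equalityI subsetI)
    fix s' assume "s' \<in> tangency_points \<omega> l"
    then have s': "proj_point s'" "s' \<subseteq> l" "\<forall>a\<in>s'. \<forall>b\<in>l. \<omega> a \<star> b = 0"
      unfolding tangency_points_def by auto
    then obtain v where v: "v \<noteq> 0" "s' = vec.span {v}" unfolding proj_point_iff by auto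
    then have vs: "v \<in> s'" by (simp add: vec.span_base)
    then have "v \<in> vec.span {q, p}" using s'(2) l_span by auto
    then obtain x y where xy: "v = y *s q + x *s p" unfolding vec_span_2 by blast
    have "x \<noteq> 0"
    proof
      assume "x = 0"
      then have "y \<noteq> 0" "v = y *s q" using v xy by auto
      moreover have "\<omega> v \<star> p = 0" using s'(3) vs l by blast
      ultimately show False using qp by (simp add: scale star_simps)
    qed
    then have vx: "v = x *s (p + (y / x) *s q)" by (simp add: xy vec_eq_iff algebra_simps)
    then have "s' = s (y / x)" unfolding s_def v(2) using span_scale[OF \<open>x \<noteq> 0\<close>, of "p + (y / x) *s q"] by simp
    moreover have "\<omega> v \<star> q = 0" using s'(3) vs l by blast
    then have "poly R (y / x) = 0" using \<open>x \<noteq> 0\<close> R(3) by (simp only: vx scale star_simps) simp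
    ultimately show "s' \<in> s ` {t. poly R t = 0}" by blast
  next
    fix s' assume "s' \<in> s ` {t. poly R t = 0}"
    then obtain t where t: "s' = s t" "poly R t = 0" by blast
    have "\<omega> a \<star> b = 0" if ab: "a \<in> s t" "b \<in> l" for a b
    proof -
      obtain k where "a = k *s (p + t *s q)" using ab(1) unfolding s_def vec_span_1 by blast
      then have "\<omega> a = k ^ m *s \<omega> (p + t *s q)" by (simp only: scale)
      moreover obtain x y where "b = y *s q + x *s p" using ab(2) unfolding l_span vec_span_2 by blast
      ultimately show ?thesis using R(3,4)[of t] t(2) by (simp add: star_simps)
    qed
    moreover have "proj_point (s t)" unfolding s_def proj_point_iff using pt by blast
    moreover have "s t \<subseteq> l" unfolding s_def by (rule span_point_subset_line[OF l(1) mem])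
    ultimately show "s' \<in> tangency_points \<omega> l" unfolding tangency_points_def t(1) by blast
  qed
  have ord: "tangency_order_with_line \<omega> l (s t) = int (order t R)" for t
  proof -
    have z: "zorder (\<lambda>z. \<omega> (p' + z *s q') \<star> q') 0 = int (order t R)"
      if pq: "p' \<in> s t - {0}" "q' \<in> l - s t" for p' q'
    proof -
      have "p' \<in> vec.span {p + t *s q}" using pq(1) unfolding s_def by blast
      then obtain k where k: "p' = k *s (p + t *s q)" unfolding vec_span_1 by blast
      then have "k \<noteq> 0" using pq(1) by auto
      have "q' \<in> vec.span {q, p}" using pq(2) l_span by blast
      then obtain a b where ab: "q' = b *s q + a *s p" unfolding vec_span_2 by blast
      have "b - a * t \<noteq> 0"
      proof
        assume "b - a * t = 0"
        then have "q' = a *s (p + t *s q)" by (simp add: ab vec_eq_iff algebra_simps)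
        then have "q' \<in> s t" unfolding s_def vec_span_1 by blast
        then show False using pq(2) by blast
      qed
      then show ?thesis using zorder_restriction[OF R k \<open>k \<noteq> 0\<close>, of q' a b] ab by (simp add: add.commute)
    qed
    \<comment> \<open>Uniqueness under \<open>THE\<close> needs an admissible pair; with none, every
      integer would satisfy the condition.\<close>
    have "p + t *s q \<in> s t - {0}" using pt by (simp add: s_def vec.span_base)
    moreover have "q \<in> l - s t"
    proof -
      have "q \<notin> s t"
      proof
        assume "q \<in> s t"
        then obtain k where "q = k *s (p + t *s q)" unfolding s_def vec_span_1 by blast
        then have "0 *s p + 1 *s q + 0 *s f = k *s p + (k * t) *s q + 0 *s f"
          by (simp add: vec_eq_iff algebra_simps)
        from frame_unique[OF fr this] show False by auto
      qed
      then show ?thesis using l by blast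
    qed
    ultimately show ?thesis unfolding tangency_order_with_line_def
      using z by (intro the_equality) auto
  qed
  have "(\<Sum>s\<in>tangency_points \<omega> l. tangency_order_with_line \<omega> l s) = (\<Sum>t | poly R t = 0. int (order t R))"
    unfolding TP using inj inj_on_subset by (subst sum.reindex) (auto simp: ord)
  also have "\<dots> = int (degree R)" unfolding sum_order_eq_degree[OF R(1), symmetric] by simp
  finally show ?thesis using deg R(2) by simp
qed

end

text \<open>A single line outside the exceptional set suffices, since the tangency orders on any
  non-invariant line add up to \<open>m - 1\<close>.\<close>

lemma foliation_degree_unique:
  assumes "foliation_degree \<omega> d"
  shows "m = Suc d"
proof -
  from assms obtain n G where G: "hom_poly n G" "\<exists>a. G a \<noteq> 0"
    and deg: "\<forall>a l. a \<noteq> 0 \<and> G a \<noteq> 0 \<and> l = {v. a \<star> v = 0} \<longrightarrow> \<not> invariant_line \<omega> l \<and>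
      (\<Sum>s\<in>tangency_points \<omega> l. tangency_order_with_line \<omega> l s) = int d"
    unfolding foliation_degree_def by auto
  then obtain b where b: "G b \<noteq> 0" by blast
  obtain a where a: "a \<noteq> 0" "G a \<noteq> 0"
  proof (cases "b = 0")
    case True
    \<comment> \<open>If \<open>G\<close> is non-zero at the origin, it is non-zero everywhere, so a
      non-zero vector can be taken instead.\<close>
    have "G 0 = 0 ^ n * G v" for v using hom_poly_scale[OF G(1), of 0 v] by simp
    from this[of "axis 1 1"] have "G (axis 1 1) \<noteq> 0" using b True by auto
    then show ?thesis using that[of "axis 1 1"] by simp
  qed (use that b in blast)
  let ?l = "{v. a \<star> v = 0}"
  have pl: "proj_line ?l" by (rule proj_line_kernel[OF a(1)])
  obtain q p where "q \<in> ?l" "p \<in> ?l" "\<omega> q \<star> p \<noteq> 0"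
    using deg[rule_format, of a ?l] a pl unfolding invariant_line_def by blast
  from sum_tangency_orders[OF pl this(2,1,3)] have "int m - 1 = int d"
    using deg[rule_format, of a ?l] a by simp
  then show ?thesis by simp
qed

end

section \<open>The Fermat foliation\<close>

context foliation_form
begin

lemma fermat_frame_rotate: "fermat_frame p q r k \<Longrightarrow> fermat_frame q r p k"
proof -
  assume ff: "fermat_frame p q r k"
  have "x *s q + y *s r + z *s p = z *s p + x *s q + y *s r" for x y z
    by (simp add: vec_eq_iff)
  then show "fermat_frame q r p k"
    using ff frame_rotate unfolding fermat_frame_def by (simp only:) blast
qed

text \<open>The line \<open>x = c y\<close> in the coordinates of the frame; rotating the frame
  gives the other two families.\<close>

definition fermat_line where "fermat_line p q r c = vec.span {c *s p + q, r}"

context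
  fixes p q r k
  assumes ff: "fermat_frame p q r k"
begin

lemma fermat_frame_facts: "frame p q r" "k \<noteq> 0"
  and fermat_p: "\<omega> (x *s p + y *s q + z *s r) \<star> p = k * (y * z ^ d - z * y ^ d)"
  and fermat_q: "\<omega> (x *s p + y *s q + z *s r) \<star> q = k * (z * x ^ d - x * z ^ d)"
  and fermat_r: "\<omega> (x *s p + y *s q + z *s r) \<star> r = k * (x * y ^ d - y * x ^ d)"
  using ff unfolding fermat_frame_def by auto

lemma monomial_derivatives:
  "((\<lambda>t. k * (t ^ d - t)) has_field_derivative - k) (at 0)"
  "((\<lambda>t. k * ((c + t) - (c + t) ^ d)) has_field_derivative k * (1 - of_nat d * c ^ (d - 1))) (at 0)"
  by (rule derivative_eq_intros refl | use d2 in \<open>simp add: power_0_left\<close>)+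

lemma fermat_line_frame: "frame (c *s p + q) r p"
proof (rule frameI)
  fix x u w assume "x *s (c *s p + q) + u *s r + w *s p = 0"
  then have "(x * c + w) *s p + x *s q + u *s r = 0" by (simp add: vec_eq_iff algebra_simps)
  from frame_indep[OF fermat_frame_facts(1) this] show "x = 0 \<and> u = 0 \<and> w = 0" by auto
qed

lemma mem_fermat_line: "x *s p + y *s q + z *s r \<in> fermat_line p q r c \<longleftrightarrow> x = c * y"
proof
  assume "x *s p + y *s q + z *s r \<in> fermat_line p q r c"
  then obtain a b where "x *s p + y *s q + z *s r = a *s (c *s p + q) + b *s r"
    unfolding fermat_line_def vec_span_2 by blast
  then have "x *s p + y *s q + z *s r = (a * c) *s p + a *s q + b *s r"
    by (simp add: vec_eq_iff algebra_simps)
  from frame_unique[OF fermat_frame_facts(1) this] show "x = c * y" by simp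
next
  assume "x = c * y"
  then have "x *s p + y *s q + z *s r = y *s (c *s p + q) + z *s r"
    by (simp add: vec_eq_iff algebra_simps)
  then show "x *s p + y *s q + z *s r \<in> fermat_line p q r c"
    unfolding fermat_line_def vec_span_2 by blast
qed

lemma mem_fermat_line_basis:
  "p \<notin> fermat_line p q r c" "q \<in> fermat_line p q r c \<longleftrightarrow> c = 0" "r \<in> fermat_line p q r c"
  using mem_fermat_line[of 1 0 0 c] mem_fermat_line[of 0 1 0 c] mem_fermat_line[of 0 0 1 c] by auto

lemma fermat_line_invariant:
  assumes "c ^ d = c"
  shows "invariant_line \<omega> (fermat_line p q r c)"
  unfolding fermat_line_def invariant_line_span_iff[OF fermat_line_frame]
proof (intro allI)
  fix x u
  have *: "x *s (c *s p + q) + u *s r = (x * c) *s p + x *s q + u *s r"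
    by (simp add: vec_eq_iff algebra_simps)
  show "\<omega> (x *s (c *s p + q) + u *s r) \<star> (c *s p + q) = 0 \<and> \<omega> (x *s (c *s p + q) + u *s r) \<star> r = 0"
    unfolding * star_add_right star_scale_right fermat_p fermat_q fermat_r power_mult_distrib assms
    by (simp add: algebra_simps)
qed

lemma inj_fermat_line: "inj (fermat_line p q r)"
proof (rule injI)
  fix c c' assume "fermat_line p q r c = fermat_line p q r c'"
  then show "c = c'" using mem_fermat_line[of c 1 0 c] mem_fermat_line[of c 1 0 c'] by simp
qed

text \<open>At \<open>[c : 1 : 0]\<close> the mixed entries of the linear part are
  \<open>- k\<close> and \<open>k (1 - d)\<close>; up to sign, the two indices are their two
  quotients.\<close>

lemma fermat_index:
  assumes "c ^ (d - 1) = 1"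
  shows "index_at (fermat_line p q r c) (vec.span {c *s p + q}) (1 - of_nat d)"
    "index_at (vec.span {p, q}) (vec.span {c *s p + q}) (1 / (1 - of_nat d))"
    "singular_point \<omega> (vec.span {c *s p + q})"
proof -
  let ?v = "c *s p + q"
  have D: "(1 - of_nat d :: complex) \<noteq> 0" using d2 by auto
  have cd: "c ^ d = c" using assms d2 by (metis One_nat_def Suc_pred less_le_trans mult.right_neutral pos2 power_Suc)
  have c0: "c \<noteq> 0" using assms d2 by (auto simp: power_0_left)
  have l1: "lin ?v r p = - k"
    by (rule lin_eqI) (use fermat_p[of c 1] monomial_derivatives(1) in simp)
  have l2: "lin ?v p r = k * (1 - of_nat d)"
  proof (rule lin_eqI)
    have e: "?v + t *s p = (c + t) *s p + 1 *s q + 0 *s r" for t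
      by (simp add: vec_eq_iff algebra_simps)
    show "((\<lambda>t. \<omega> (?v + t *s p) \<star> r) has_field_derivative k * (1 - of_nat d)) (at 0)"
      unfolding e fermat_r using monomial_derivatives(2)[of c] assms by simp
  qed
  have fr: "frame ?v r p" by (rule fermat_line_frame)
  show "index_at (fermat_line p q r c) (vec.span {?v}) (1 - of_nat d)"
    unfolding index_at_def
  proof (intro exI conjI)
    show "fermat_line p q r c = vec.span {?v, r}" unfolding fermat_line_def ..
  qed (use fr l1 l2 fermat_frame_facts(2) in auto)
  have "vec.span {p, q} = vec.span {?v, p}"
  proof (rule line_eq_span)
    show "proj_line (vec.span {p, q})" using frame_span_line[OF fermat_frame_facts(1)] .
    show "?v \<in> vec.span {p, q}" unfolding vec_span_2 by (intro exI[of _ c] exI[of _ 1]) simp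
    show "p \<in> vec.span {p, q}" by (simp add: vec.span_base)
    show "?v \<noteq> 0" "p \<notin> vec.span {?v}" using frame_swap[OF fr] unfolding frame_iff by auto
  qed
  then show "index_at (vec.span {p, q}) (vec.span {?v}) (1 / (1 - of_nat d))"
    unfolding index_at_def
  proof (intro exI conjI)
    show "frame ?v p r" using frame_swap[OF fr] .
    show "lin ?v p r \<noteq> 0" using l2 D fermat_frame_facts(2) by simp
    show "1 / (1 - of_nat d) = - lin ?v r p / lin ?v p r"
      using l1 l2 D fermat_frame_facts(2) by simp
  qed auto
  have "\<omega> ?v = 0"
    using form_frame_zero[OF fermat_frame_facts(1), of ?v] fermat_p[of c 1 0] fermat_q[of c 1 0] fermat_r[of c 1 0]
      d2 cd by simp
  moreover have "?v \<noteq> 0" using fr frame_iff by blast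
  ultimately show "singular_point \<omega> (vec.span {?v})" using singular_point_iff by blast
qed

end

section \<open>Invariant lines and indices of the Fermat foliation\<close>

definition fixed_roots :: "complex set" where "fixed_roots = {c. c ^ d = c}"

lemma fermat_line_zero: "fermat_line r p q 0 = vec.span {p, q}"
  unfolding fermat_line_def by (simp add: insert_commute)

context
  fixes p q r k
  assumes ff: "fermat_frame p q r k"
begin

lemma fermat_frame_rotate_2: "fermat_frame r p q k"
  using fermat_frame_rotate[OF fermat_frame_rotate[OF ff]] .

lemma card_fixed_roots: "finite fixed_roots" "card fixed_roots = d"
proof -
  have "fixed_roots = insert 0 {c. c ^ (d - 1) = 1}"
  proof -
    have "c ^ d = c * c ^ (d - 1)" for c :: complex using d2 by (cases d) auto
    then show ?thesis unfolding fixed_roots_def using d2 by auto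
  qed
  moreover have "finite {c :: complex. c ^ (d - 1) = 1}" "card {c :: complex. c ^ (d - 1) = 1} = d - 1"
    using finite_roots_unity[of "d - 1"] card_roots_unity_eq[of "d - 1"] d2 by auto
  moreover have "0 \<notin> {c :: complex. c ^ (d - 1) = 1}" using d2 by (auto simp: power_0_left)
  ultimately show "finite fixed_roots" "card fixed_roots = d" using d2 by auto
qed

lemma fermat_lines_distinct:
  "fermat_line p q r c \<noteq> fermat_line q r p c'" "fermat_line q r p c' \<noteq> fermat_line r p q c''"
  "fermat_line r p q c'' \<noteq> fermat_line p q r c"
proof -
  note ff1 = fermat_frame_rotate[OF ff] and ff2 = fermat_frame_rotate_2
  show "fermat_line p q r c \<noteq> fermat_line q r p c'"
    using mem_fermat_line_basis[OF ff, of c] mem_fermat_line_basis[OF ff1, of c'] by metis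
  show "fermat_line q r p c' \<noteq> fermat_line r p q c''"
    using mem_fermat_line_basis[OF ff1, of c'] mem_fermat_line_basis[OF ff2, of c''] by metis
  show "fermat_line r p q c'' \<noteq> fermat_line p q r c"
    using mem_fermat_line_basis[OF ff2, of c''] mem_fermat_line_basis[OF ff, of c] by metis
qed

text \<open>The three disjoint families of \<open>d\<close> lines already reach the general
  bound.\<close>

lemma fermat_card_lines: "card {l. invariant_line \<omega> l} = 3 * d"
proof (rule antisym[OF card_invariant_lines])
  note ff1 = fermat_frame_rotate[OF ff] and ff2 = fermat_frame_rotate_2
  let ?A = "fermat_line p q r ` fixed_roots" and ?B = "fermat_line q r p ` fixed_roots"
    and ?C = "fermat_line r p q ` fixed_roots"
  have c: "card ?A = d" "card ?B = d" "card ?C = d" "finite ?A" "finite ?B" "finite ?C"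
    using card_fixed_roots card_image[OF inj_on_subset[OF inj_fermat_line[OF ff] subset_UNIV]]
      card_image[OF inj_on_subset[OF inj_fermat_line[OF ff1] subset_UNIV]]
      card_image[OF inj_on_subset[OF inj_fermat_line[OF ff2] subset_UNIV]] by auto
  have "?A \<inter> ?B = {}" "(?A \<union> ?B) \<inter> ?C = {}" using fermat_lines_distinct by (auto dest: sym)
  then have "card ((?A \<union> ?B) \<union> ?C) = 3 * d" using c by (simp add: card_Un_disjoint)
  moreover have "(?A \<union> ?B) \<union> ?C \<subseteq> {l. invariant_line \<omega> l}"
    using fermat_line_invariant[OF ff] fermat_line_invariant[OF ff1] fermat_line_invariant[OF ff2]
    unfolding fixed_roots_def by blast
  ultimately show "3 * d \<le> card {l. invariant_line \<omega> l}"
    using card_mono[OF finite_invariant_lines] by metis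
qed

end

text \<open>As the bound \<open>3 d\<close> is attained, \<open>reduced_convex_line\<close> applies:
  a singularity with index other than 1 along \<open>l\<close> lies on at most one further invariant
  line.\<close>

lemma few_lines_through:
  assumes "fermat_frame p q r k" "invariant_line \<omega> l" "singular_point \<omega> s" "s \<subseteq> l"
    "index_at l s z" "z \<noteq> 1"
    "A \<in> lines_through s" "B \<in> lines_through s" "C \<in> lines_through s" "A \<noteq> B" "B \<noteq> C" "C \<noteq> A"
  shows False
proof -
  have "\<exists>z'. index_at l s z' \<and> (2 \<le> card (lines_through s - {l}) \<longrightarrow> z' = 1)"
  proof (rule reduced_convex_line[OF fermat_card_lines[OF assms(1)] assms(2)], goal_cases)
    case (1 z)
    then show ?case using 1(7)[of s] 1(9)[of s] assms(3,4) by (intro exI[of _ "z s"]) simp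
  qed
  then obtain z' where z': "index_at l s z'" "2 \<le> card (lines_through s - {l}) \<longrightarrow> z' = 1" by blast
  have "z' = z" by (rule index_at_unique[OF assms(2,3) z'(1) assms(5)])
  then have "card (lines_through s - {l}) < 2" using z'(2) assms(6) by (metis not_less)
  moreover have "l \<in> lines_through s" using assms unfolding lines_through_def by blast
  ultimately have "card (lines_through s) < 3" using finite_lines_through[of s] by simp
  moreover have "card {A, B, C} \<le> card (lines_through s)"
    using assms finite_lines_through by (intro card_mono) auto
  moreover have "card {A, B, C} = 3" using assms by auto
  ultimately show False by simp
qed

text \<open>Only one side of the coordinate triangle is treated; rotation of the frame covers the
  other two.\<close>

lemma fermat_index_values_plane:
  assumes ff: "fermat_frame p q r k" and l: "invariant_line \<omega> l" "vec.span {v} \<subseteq> l" "index_at l (vec.span {v}) z"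
    and z: "z \<notin> {0, 1}" and v: "v \<noteq> 0" "\<omega> v = 0" "v = x *s p + y *s q"
  shows "z \<in> {1 - of_nat d, 1 / (1 - of_nat d)}"
proof -
  note ff1 = fermat_frame_rotate[OF ff] and ff2 = fermat_frame_rotate_2[OF ff]
  let ?s = "vec.span {v}"
  have sing: "singular_point \<omega> ?s" using v singular_point_iff by blast
  have d1: "(0::complex) ^ d = 0" "(1::complex) ^ d = 1" using d2 by auto
  note few = few_lines_through[OF ff l(1) sing l(2,3)]
  have thr: "l' \<in> lines_through ?s" if "invariant_line \<omega> l'" "v \<in> l'" for l'
    unfolding lines_through_def using that span_point_subset_line unfolding invariant_line_def by auto
  note i0 = fermat_line_invariant[OF ff] and i1 = fermat_line_invariant[OF ff1]
    and i2 = fermat_line_invariant[OF ff2]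
  have v3: "v = x *s p + y *s q + 0 *s r" "v = y *s q + 0 *s r + x *s p" "v = 0 *s r + x *s p + y *s q"
    using v(3) by (simp_all add: add.commute)
  have m0: "v \<in> fermat_line p q r c \<longleftrightarrow> x = c * y" for c
    unfolding v3(1) by (rule mem_fermat_line[OF ff])
  have m1: "v \<in> fermat_line q r p c \<longleftrightarrow> y = 0" for c
    using mem_fermat_line[OF ff1, of y 0 x c] unfolding v3(2) by simp
  have m2: "v \<in> fermat_line r p q c \<longleftrightarrow> 0 = c * x" for c
    unfolding v3(3) by (rule mem_fermat_line[OF ff2])
  \<comment> \<open>A vertex of the triangle lies on at least three invariant lines, so an index
    other than 1 excludes it.\<close>
  have "x \<noteq> 0"
  proof
    assume x: "x = 0"
    show False
      by (rule few[of "fermat_line r p q 0" "fermat_line r p q 1" "fermat_line p q r 0"])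
        (use fermat_lines_distinct(3)[OF ff, of 0 0, symmetric] z x thr i0[OF d1(1)] i2[OF d1(1)] i2[OF d1(2)] m0[of 0] m2[of 0] m2[of 1]
          fermat_lines_distinct[OF ff] injD[OF inj_fermat_line[OF ff2], of 0 1] in auto)
  qed
  have "y \<noteq> 0"
  proof
    assume y: "y = 0"
    show False
      by (rule few[of "fermat_line q r p 0" "fermat_line q r p 1" "fermat_line r p q 0"])
        (use fermat_lines_distinct(2)[OF ff, of 0 0, symmetric] z y thr i1[OF d1(1)] i1[OF d1(2)] i2[OF d1(1)] m1[of 0] m1[of 1] m2[of 0]
          fermat_lines_distinct[OF ff] injD[OF inj_fermat_line[OF ff1], of 0 1] in auto)
  qed
  define c where "c = x / y"
  have vy: "v = y *s (c *s p + q)" using \<open>y \<noteq> 0\<close> by (simp add: c_def v(3) vec_eq_iff algebra_simps)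
  have s: "?s = vec.span {c *s p + q}" unfolding vy by (rule span_scale[OF \<open>y \<noteq> 0\<close>])
  have "k * (x * y ^ d - y * x ^ d) = 0"
    using fermat_r[OF ff, of x y 0] v(2) v3(1) by (simp add: star_zero_left)
  then have "x * y ^ d = y * x ^ d" using fermat_frame_facts(2)[OF ff] by simp
  moreover have "x ^ d = x * x ^ (d - 1)" "y ^ d = y * y ^ (d - 1)" using d2 by (cases d; simp)+
  ultimately have "x ^ (d - 1) = y ^ (d - 1)" using \<open>x \<noteq> 0\<close> \<open>y \<noteq> 0\<close> by simp
  then have c1: "c ^ (d - 1) = 1" using \<open>y \<noteq> 0\<close> by (simp add: c_def power_divide)
  have cd: "c ^ d = c" using c1 d2 by (cases d) auto
  have lines: "fermat_line p q r c \<in> lines_through ?s" "fermat_line r p q 0 \<in> lines_through ?s"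
    using thr i0[OF cd] i2[OF d1(1)] m0[of c] m2[of 0] \<open>y \<noteq> 0\<close> by (auto simp: c_def)
  have "l \<in> lines_through ?s" using l unfolding lines_through_def by blast
  then have "l = fermat_line p q r c \<or> l = fermat_line r p q 0"
    using few[of l "fermat_line p q r c" "fermat_line r p q 0"] lines fermat_lines_distinct(3)[OF ff, of 0 c] z by auto
  then show ?thesis
  proof
    assume "l = fermat_line p q r c"
    then have "z = 1 - of_nat d"
      using index_at_unique[OF l(1) sing l(3)] fermat_index(1)[OF ff c1] s by simp
    then show ?thesis by simp
  next
    assume "l = fermat_line r p q 0"
    then have "z = 1 / (1 - of_nat d)"
      using index_at_unique[OF l(1) sing l(3)] fermat_index(2)[OF ff c1] s
      by (simp add: fermat_line_zero)
    then show ?thesis by simp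
  qed
qed

lemma fermat_CS:
  assumes ff: "fermat_frame p q r k"
  shows "CS \<omega> = {1 - of_nat d, 1 / (1 - of_nat d)}"
proof (intro equalityI subsetI)
  note ff1 = fermat_frame_rotate[OF ff] and ff2 = fermat_frame_rotate_2[OF ff]
  fix z assume "z \<in> CS \<omega>"
  then obtain l s where z: "z \<notin> {0, 1}" and l: "invariant_line \<omega> l" "s \<subseteq> l" "singular_point \<omega> s" "index_at l s z"
    unfolding CS_iff by blast
  obtain v where v: "v \<noteq> 0" "s = vec.span {v}" using l(3) unfolding singular_point_def proj_point_iff by blast
  have wv: "\<omega> v = 0" using l(3) v singular_point_iff by blast
  obtain x y w where xyw: "v = x *s p + y *s q + w *s r" by (rule frame_coords[OF fermat_frame_facts(1)[OF ff]])
  note vals = fermat_index_values_plane[OF _ l(1,2)[unfolded v(2)] l(4)[unfolded v(2)] z v(1) wv]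
  consider "w = 0" | "x = 0" | "y = 0" | "x \<noteq> 0" "y \<noteq> 0" "w \<noteq> 0" by blast
  then show "z \<in> {1 - of_nat d, 1 / (1 - of_nat d)}"
  proof cases
    case 1
    then show ?thesis using vals[OF ff, of x y] xyw by simp
  next
    case 2
    then show ?thesis using vals[OF ff1, of y w] xyw by simp
  next
    case 3
    then show ?thesis using vals[OF ff2, of w x] xyw by (simp add: add.commute)
  next
    case 4
    \<comment> \<open>Off the sides of the triangle, a singularity lies on one line of each family,
      too many for an index other than 1.\<close>
    have thr: "l' \<in> lines_through s" if "invariant_line \<omega> l'" "v \<in> l'" for l'
      unfolding lines_through_def v(2) using that span_point_subset_line unfolding invariant_line_def by auto
    have root: "(a / b) ^ d = a / b" if "k * (a * b ^ d - b * a ^ d) = 0" "b \<noteq> 0" for a b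
    proof -
      have "a * b ^ d = b * a ^ d" using that(1) fermat_frame_facts(2)[OF ff] by simp
      then show ?thesis using that(2) by (simp add: power_divide field_simps)
    qed
    have "(x / y) ^ d = x / y" using root[of x y] 4 fermat_r[OF ff, of x y w] wv xyw by (simp add: star_zero_left)
    moreover have "(y / w) ^ d = y / w" using root[of y w] 4 fermat_p[OF ff, of x y w] wv xyw by (simp add: star_zero_left)
    moreover have "(w / x) ^ d = w / x" using root[of w x] 4 fermat_q[OF ff, of x y w] wv xyw by (simp add: star_zero_left)
    ultimately have inv: "invariant_line \<omega> (fermat_line p q r (x / y))" "invariant_line \<omega> (fermat_line q r p (y / w))"
      "invariant_line \<omega> (fermat_line r p q (w / x))"
      using fermat_line_invariant[OF ff] fermat_line_invariant[OF ff1] fermat_line_invariant[OF ff2] by auto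
    have v3: "v = y *s q + w *s r + x *s p" "v = w *s r + x *s p + y *s q" using xyw by (simp_all add: add_ac)
    have "v \<in> fermat_line p q r (x / y)" unfolding xyw using mem_fermat_line[OF ff] 4 by simp
    moreover have "v \<in> fermat_line q r p (y / w)" unfolding v3(1) using mem_fermat_line[OF ff1] 4 by simp
    moreover have "v \<in> fermat_line r p q (w / x)" unfolding v3(2) using mem_fermat_line[OF ff2] 4 by simp
    ultimately have mem: "v \<in> fermat_line p q r (x / y)" "v \<in> fermat_line q r p (y / w)" "v \<in> fermat_line r p q (w / x)" .
    have "z \<noteq> 1" using z by simp
    from few_lines_through[OF ff l(1,3,2,4) this thr[OF inv(1) mem(1)] thr[OF inv(2) mem(2)] thr[OF inv(3) mem(3)]
        fermat_lines_distinct[OF ff]] show ?thesis ..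
  qed
next
  note ff2 = fermat_frame_rotate_2[OF ff]
  \<comment> \<open>Both values are attained at \<open>[1 : 1 : 0]\<close>, along the two invariant
    lines that meet there.\<close>
  let ?s = "vec.span {1 *s p + q}"
  have one: "(1::complex) ^ (d - 1) = 1" "(1::complex) ^ d = 1" "(0::complex) ^ d = 0" using d2 by auto
  note fi = fermat_index[OF ff one(1)]
  have D: "(of_nat d :: complex) \<noteq> 0" "(of_nat d :: complex) \<noteq> 1" using d2 by auto
  have inv: "invariant_line \<omega> (fermat_line p q r 1)" "invariant_line \<omega> (vec.span {p, q})"
    using fermat_line_invariant[OF ff one(2)] fermat_line_invariant[OF ff2 one(3)]
    by (simp_all add: fermat_line_zero)
  have sub: "?s \<subseteq> fermat_line p q r 1" "?s \<subseteq> vec.span {p, q}"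
    unfolding fermat_line_def by (rule vec.span_mono, simp)
      (rule span_point_subset_line[OF frame_span_line[OF fermat_frame_facts(1)[OF ff]]],
        auto simp: vec.span_base vec.span_add)
  fix z :: complex assume "z \<in> {1 - of_nat d, 1 / (1 - of_nat d)}"
  then consider "z = 1 - of_nat d" | "z = 1 / (1 - of_nat d)" by blast
  then show "z \<in> CS \<omega>"
  proof cases
    case 1
    then have "z \<notin> {0, 1}" using D by auto
    then show ?thesis unfolding CS_iff
      using inv(1) sub(1) fi(1,3) index_at_imp_camacho_sad(1)[OF inv(1) fi(3,1)] 1 by blast
  next
    case 2
    then have "z \<notin> {0, 1}" using D by auto
    then show ?thesis unfolding CS_iff
      using inv(2) sub(2) fi(2,3) index_at_imp_camacho_sad(1)[OF inv(2) fi(3,2)] 2 by blast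
  qed
qed

end

context foliation_form
begin

text \<open>If \<open>p3\<close> were a combination of \<open>p1\<close> and \<open>p2\<close>, both
  coefficients would be non-zero because the points are distinct, which
  \<open>radial_points_not_aligned\<close> rules out.\<close>

lemma radial_singularities_frame:
  assumes "radial_singularity \<omega> s1 (d - 1)" "radial_singularity \<omega> s2 (d - 1)" "radial_singularity \<omega> s3 (d - 1)"
    and ne: "s1 \<noteq> s2" "s1 \<noteq> s3" "s2 \<noteq> s3"
  obtains p1 p2 p3 where "radial_at p1" "radial_at p2" "radial_at p3" "frame p1 p2 p3"
    "s1 = vec.span {p1}" "s2 = vec.span {p2}" "s3 = vec.span {p3}"
proof -
  obtain p1 where p1: "p1 \<noteq> 0" "s1 = vec.span {p1}" "radial_at p1" using radial_singularity_imp[OF assms(1)] .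
  obtain p2 where p2: "p2 \<noteq> 0" "s2 = vec.span {p2}" "radial_at p2" using radial_singularity_imp[OF assms(2)] .
  obtain p3 where p3: "p3 \<noteq> 0" "s3 = vec.span {p3}" "radial_at p3" using radial_singularity_imp[OF assms(3)] .
  have "p2 \<notin> vec.span {p1}"
  proof
    assume "p2 \<in> vec.span {p1}"
    then obtain k where "p2 = k *s p1" unfolding vec_span_1 by blast
    moreover from this have "k \<noteq> 0" using p2(1) by auto
    ultimately show False using span_scale[of k p1] ne(1) p1(2) p2(2) by simp
  qed
  moreover have "p3 \<notin> vec.span {p1, p2}"
  proof
    assume "p3 \<in> vec.span {p1, p2}"
    then obtain a b where ab: "p3 = a *s p1 + b *s p2" unfolding vec_span_2 by blast
    have "a \<noteq> 0"
    proof
      assume "a = 0"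
      then have "p3 = b *s p2" "b \<noteq> 0" using ab p3(1) by auto
      then show False using span_scale[of b p2] ne(3) p2(2) p3(2) by simp
    qed
    moreover have "b \<noteq> 0"
    proof
      assume "b = 0"
      then have "p3 = a *s p1" "a \<noteq> 0" using ab p3(1) by auto
      then show False using span_scale[of a p1] ne(2) p1(2) p3(2) by simp
    qed
    moreover obtain f where "frame p1 p2 f" using frame_extend[OF p1(1) \<open>p2 \<notin> vec.span {p1}\<close>] .
    ultimately show False using radial_points_not_aligned[OF p1(3) p2(3) p3(3) _ ab] by blast
  qed
  ultimately have "frame p1 p2 p3" using p1(1) unfolding frame_iff by blast
  then show ?thesis using that p1 p2 p3 by blast
qed

end

theorem theoremD:
  fixes \<omega> :: "complex ^ 3 \<Rightarrow> complex ^ 3" and d :: nat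
  assumes "foliation \<omega>" and "foliation_degree \<omega> d" and "2 \<le> d"
  shows "(linearly_conjugated \<omega> (fermat_form d) \<longleftrightarrow>
            reduced_convex \<omega> d \<and> CS \<omega> = {1 - of_nat d, 1 / (1 - of_nat d)}) \<and>
         (reduced_convex \<omega> d \<and> CS \<omega> = {1 - of_nat d, 1 / (1 - of_nat d)} \<longleftrightarrow>
            (\<exists>s1 s2 s3. s1 \<noteq> s2 \<and> s1 \<noteq> s3 \<and> s2 \<noteq> s3 \<and>
               radial_singularity \<omega> s1 (d - 1) \<and> radial_singularity \<omega> s2 (d - 1) \<and>
               radial_singularity \<omega> s3 (d - 1))) \<and>
         (\<forall>s1 s2 s3. s1 \<noteq> s2 \<and> s1 \<noteq> s3 \<and> s2 \<noteq> s3 \<and>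
            radial_singularity \<omega> s1 (d - 1) \<and> radial_singularity \<omega> s2 (d - 1) \<and>
            radial_singularity \<omega> s3 (d - 1) \<longrightarrow>
            \<not> (\<exists>l. proj_line l \<and> s1 \<subseteq> l \<and> s2 \<subseteq> l \<and> s3 \<subseteq> l))"
proof -
  obtain m where m: "\<forall>i. hom_poly m (\<lambda>v. \<omega> v $ i)" "\<forall>v. \<omega> v \<star> v = 0" "finite {s. singular_point \<omega> s}"
    using assms(1) unfolding foliation_def by blast
  interpret H: homogeneous_form \<omega> m by standard (use m in auto)
  \<comment> \<open>The tangency count fixes the degree of the coefficients, as
    \<open>foliation_form\<close> requires.\<close>
  have md: "m = Suc d" by (rule H.foliation_degree_unique[OF assms(2)])
  interpret foliation_form \<omega> d by standard (use m md assms(3) in auto)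
  have 12: "reduced_convex \<omega> d \<and> CS \<omega> = {1 - of_nat d, 1 / (1 - of_nat d)}"
    if "linearly_conjugated \<omega> (fermat_form d)"
  proof -
    obtain p q r k where ff: "fermat_frame p q r k" using \<open>linearly_conjugated \<omega> (fermat_form d)\<close> linearly_conjugated_iff by blast
    show ?thesis unfolding reduced_convex_def
      using finite_invariant_lines fermat_card_lines[OF ff] fermat_CS[OF ff] by blast
  qed
  have 23: "\<exists>s1 s2 s3. s1 \<noteq> s2 \<and> s1 \<noteq> s3 \<and> s2 \<noteq> s3 \<and> radial_singularity \<omega> s1 (d - 1) \<and>
      radial_singularity \<omega> s2 (d - 1) \<and> radial_singularity \<omega> s3 (d - 1)"
    if "reduced_convex \<omega> d \<and> CS \<omega> = {1 - of_nat d, 1 / (1 - of_nat d)}"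
    using that three_radial_singularities unfolding reduced_convex_def by blast
  have 31: "linearly_conjugated \<omega> (fermat_form d)" "\<not> (\<exists>l. proj_line l \<and> s1 \<subseteq> l \<and> s2 \<subseteq> l \<and> s3 \<subseteq> l)"
    if s: "s1 \<noteq> s2" "s1 \<noteq> s3" "s2 \<noteq> s3" "radial_singularity \<omega> s1 (d - 1)"
      "radial_singularity \<omega> s2 (d - 1)" "radial_singularity \<omega> s3 (d - 1)" for s1 s2 s3
  proof -
    obtain p1 p2 p3 where r: "radial_at p1" "radial_at p2" "radial_at p3" and fr: "frame p1 p2 p3"
      and sp: "s1 = vec.span {p1}" "s2 = vec.span {p2}" "s3 = vec.span {p3}"
      by (rule radial_singularities_frame[OF s(4-6) s(1-3)])
    obtain q1 q2 q3 k where "fermat_frame q1 q2 q3 k" by (rule radial_imp_fermat_frame[OF r fr])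
    then show "linearly_conjugated \<omega> (fermat_form d)" unfolding linearly_conjugated_iff by blast
    show "\<not> (\<exists>l. proj_line l \<and> s1 \<subseteq> l \<and> s2 \<subseteq> l \<and> s3 \<subseteq> l)"
    proof
      assume "\<exists>l. proj_line l \<and> s1 \<subseteq> l \<and> s2 \<subseteq> l \<and> s3 \<subseteq> l"
      then obtain l where l: "proj_line l" "p1 \<in> l" "p2 \<in> l" "p3 \<in> l"
        unfolding sp using vec.span_base by blast
      have "l = vec.span {p1, p2}" using line_eq_span[OF l(1-3)] fr frame_iff by blast
      then show False using l(4) fr frame_iff by blast
    qed
  qed
  show ?thesis
  proof (intro conjI allI impI, goal_cases)
    case 1
    show ?case using 12 23 31(1) by blast
  next
    case 2
    show ?case using 12 23 31(1) by blast
  next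
    case 3
    then show ?case using 31(2) by blast
  qed
qed

end
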